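(* Let $(J,W)$ be a pure graphon such that the integral operator $T_W$ has finite rank, let $\mathbb G={\rm Aut}(J,W)$, and let $S$ be the algebra of functions on $J$ generated by the eigenfunctions of $W$. Then $\mathcal{A}_1=S^{\mathbb G}$.
   Context: A graphon is a pair $(J,W)$ where $J$ is a standard probability space with probability measure $\pi$ and $W:J\times J\to[0,1]$ is a symmetric measurable function with every section $W(x,\cdot)$ measurable. $r_W(x,y)=\int|W(x,z)-W(y,z)|\,d\pi(z)$; the graphon is pure if $r_W$ is a metric, $(J,r_W)$ is complete and $\pi$ has full support. $T_W$ is the operator $(T_Wf)(x)=\int_J W(x,y)f(y)\,d\pi(y)$ on $L^2(J)$; finite rank means its range is finite dimensional, so $W(x,y)=\sum_{i=1}^t\lambda_if_i(x)f_i(y)$ with nonzero eigenvalues $\lambda_i$ and orthonormal eigenfunctions $f_i$, normalized so that $\lambda_if_i(x)=\int W(x,y)f_i(y)\,d\pi(y)$ for every $x$. An automorphism of a pure graphon is a measure preserving bijection $g:J\to J$ such that for every $x$, $W(x^g,y^g)=W(x,y)$ for almost all $y$; $\mathbb G$ acts on functions by $f^g(x)=f(x^g)$, and $S^{\mathbb G}$ is the set of $\mathbb G$-invariant elements of $S$. For a 1-labeled simple graph $F=(V,E)$ with labeled node $1$, $t_x(F,W)=\int_{J^{V\setminus\{1\}}}\prod_{ij\in E}W(x_i,x_j)\prod_{i\ne1}d\pi(x_i)$ with $x_1=x$; $\mathcal A_1$ is the linear span of the functions $x\mapsto t_x(F,W)$ over all 1-labeled simple graphs $F$ (a subalgebra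 of $L^\infty(J)$). *)

theory Defs
  imports "HOL-Probability.Probability"
begin

text \<open>
  Standard probability spaces are taken in the sense of Lebesgue and Rokhlin: the completion of a
  Borel probability measure on a Polish space.
\<close>

definition standard_prob_space :: "'a measure \<Rightarrow> bool" where
  "standard_prob_space M \<longleftrightarrow>
     (\<exists>X N. completely_metrizable_space X \<and> second_countable X \<and>
        prob_space N \<and> space N = topspace X \<and> sets N = sigma_sets (topspace X) {U. openin X U} \<and>
        M = completion N)"

text \<open>
  The underlying set \<open>J\<close> is \<open>space M\<close> and \<open>\<pi>\<close> is the measure of \<open>M\<close>. As \<open>M\<close> is complete, joint
  measurability refers to the completed product; measurability of every (not just almost every)
  section is then a separate requirement.
\<close>

definition graphon :: "'a measure \<Rightarrow> ('a \<Rightarrow> 'a \<Rightarrow> real) \<Rightarrow> bool" where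
  "graphon M W \<longleftrightarrow>
     standard_prob_space M \<and>
     (\<lambda>(x, y). W x y) \<in> borel_measurable (completion (M \<Otimes>\<^sub>M M)) \<and>
     (\<forall>x\<in>space M. W x \<in> borel_measurable M) \<and>
     (\<forall>x\<in>space M. \<forall>y\<in>space M. W x y = W y x) \<and>
     (\<forall>x\<in>space M. \<forall>y\<in>space M. 0 \<le> W x y \<and> W x y \<le> 1)"

definition nbhd_dist :: "'a measure \<Rightarrow> ('a \<Rightarrow> 'a \<Rightarrow> real) \<Rightarrow> 'a \<Rightarrow> 'a \<Rightarrow> real" where
  "nbhd_dist M W x y = (\<integral>z. \<bar>W x z - W y z\<bar> \<partial>M)"

definition pure_graphon :: "'a measure \<Rightarrow> ('a \<Rightarrow> 'a \<Rightarrow> real) \<Rightarrow> bool" where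
  "pure_graphon M W \<longleftrightarrow>
     graphon M W \<and>
     Metric_space (space M) (nbhd_dist M W) \<and>
     Metric_space.mcomplete (space M) (nbhd_dist M W) \<and>
     (\<forall>U. openin (Metric_space.mtopology (space M) (nbhd_dist M W)) U \<and> U \<noteq> {} \<longrightarrow>
        emeasure M U > 0)"

definition square_integrable :: "'a measure \<Rightarrow> ('a \<Rightarrow> real) \<Rightarrow> bool" where
  "square_integrable M f \<longleftrightarrow> f \<in> borel_measurable M \<and> integrable M (\<lambda>x. (f x)\<^sup>2)"

definition kernel_op :: "'a measure \<Rightarrow> ('a \<Rightarrow> 'a \<Rightarrow> real) \<Rightarrow> ('a \<Rightarrow> real) \<Rightarrow> 'a \<Rightarrow> real" where
  "kernel_op M W f x = (\<integral>y. W x y * f y \<partial>M)"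

text \<open>
  The range of the operator on \<open>L\<^sup>2\<close> is spanned by finitely many of its elements; equality in
  \<open>L\<^sup>2\<close> is equality almost everywhere.
\<close>

definition finite_rank :: "'a measure \<Rightarrow> ('a \<Rightarrow> 'a \<Rightarrow> real) \<Rightarrow> bool" where
  "finite_rank M W \<longleftrightarrow>
     (\<exists>(n::nat) h. (\<forall>i<n. square_integrable M (h i)) \<and>
        (\<forall>f. square_integrable M f \<longrightarrow>
           (\<exists>c :: nat \<Rightarrow> real. AE x in M. kernel_op M W f x = (\<Sum>i<n. c i * kernel_op M W (h i) x))))"

text \<open>
  Eigenfunctions are actual functions, with the eigenvalue equation required at every point;
  only nonzero eigenvalues are considered.
\<close>

definition eigenfunctions :: "'a measure \<Rightarrow> ('a \<Rightarrow> 'a \<Rightarrow> real) \<Rightarrow> ('a \<Rightarrow> real) set" where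
  "eigenfunctions M W =
     {f. square_integrable M f \<and> \<not> (AE x in M. f x = 0) \<and>
         (\<exists>l::real. l \<noteq> 0 \<and> (\<forall>x\<in>space M. l * f x = kernel_op M W f x))}"

text \<open>
  Functions on a set \<open>J\<close> are represented by functions in \<open>extensional J\<close>, so that equality means
  equality at all points of \<open>J\<close>.
\<close>

inductive_set generated_algebra :: "'a set \<Rightarrow> ('a \<Rightarrow> real) set \<Rightarrow> ('a \<Rightarrow> real) set"
  for J :: "'a set" and \<Phi> :: "('a \<Rightarrow> real) set" where
  gen: "f \<in> \<Phi> \<Longrightarrow> restrict f J \<in> generated_algebra J \<Phi>"
| const: "(\<lambda>x\<in>J. c) \<in> generated_algebra J \<Phi>"
| add: "f \<in> generated_algebra J \<Phi> \<Longrightarrow> g \<in> generated_algebra J \<Phi> \<Longrightarrow>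
          (\<lambda>x\<in>J. f x + g x) \<in> generated_algebra J \<Phi>"
| mult: "f \<in> generated_algebra J \<Phi> \<Longrightarrow> g \<in> generated_algebra J \<Phi> \<Longrightarrow>
          (\<lambda>x\<in>J. f x * g x) \<in> generated_algebra J \<Phi>"

definition function_span :: "'a set \<Rightarrow> ('a \<Rightarrow> real) set \<Rightarrow> ('a \<Rightarrow> real) set" where
  "function_span J \<Phi> =
     {(\<lambda>x\<in>J. \<Sum>i<n. c i * \<phi> i x) | (n::nat) (c :: nat \<Rightarrow> real) \<phi>. \<forall>i<n. \<phi> i \<in> \<Phi>}"

definition eigenfunction_algebra :: "'a measure \<Rightarrow> ('a \<Rightarrow> 'a \<Rightarrow> real) \<Rightarrow> ('a \<Rightarrow> real) set" where
  "eigenfunction_algebra M W = generated_algebra (space M) (eigenfunctions M W)"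

definition graphon_Aut :: "'a measure \<Rightarrow> ('a \<Rightarrow> 'a \<Rightarrow> real) \<Rightarrow> ('a \<Rightarrow> 'a) set" where
  "graphon_Aut M W =
     {g. bij_betw g (space M) (space M) \<and> g \<in> measurable M M \<and> distr M M g = M \<and>
         (\<forall>x\<in>space M. AE y in M. W (g x) (g y) = W x y)}"

definition invariants :: "'a set \<Rightarrow> ('a \<Rightarrow> 'a) set \<Rightarrow> ('a \<Rightarrow> real) set \<Rightarrow> ('a \<Rightarrow> real) set" where
  "invariants J G S = {f \<in> S. \<forall>g\<in>G. \<forall>x\<in>J. f (g x) = f x}"

text \<open>Finite simple graphs on vertices in \<open>nat\<close>, whose labeled node is the number \<open>1\<close>.\<close>

definition one_labeled_graph :: "nat set \<Rightarrow> nat set set \<Rightarrow> bool" where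
  "one_labeled_graph V E \<longleftrightarrow> finite V \<and> 1 \<in> V \<and> (\<forall>e\<in>E. e \<subseteq> V \<and> card e = 2)"

text \<open>
  An edge \<open>ij\<close> is the set \<open>{i, j}\<close>; its ends are recovered as minimum and maximum, the order being
  immaterial by symmetry of \<open>W\<close>. The integral is over the completed product since the integrand
  need not be measurable for the plain product sigma-algebra.
\<close>

definition hom_dens1 ::
    "'a measure \<Rightarrow> ('a \<Rightarrow> 'a \<Rightarrow> real) \<Rightarrow> nat set \<Rightarrow> nat set set \<Rightarrow> 'a \<Rightarrow> real" where
  "hom_dens1 M W V E x =
     (\<integral>\<omega>. (\<Prod>e\<in>E. W (fun_upd \<omega> 1 x (Min e)) (fun_upd \<omega> 1 x (Max e)))
        \<partial>completion (Pi\<^sub>M (V - {1}) (\<lambda>_. M)))"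

definition A1 :: "'a measure \<Rightarrow> ('a \<Rightarrow> 'a \<Rightarrow> real) \<Rightarrow> ('a \<Rightarrow> real) set" where
  "A1 M W = function_span (space M) {hom_dens1 M W V E | V E. one_labeled_graph V E}"

end

(*
  Writing W(x,y) = sum_i l_i f_i(x) f_i(y), purity makes x |-> (f_i(x))_i a homeomorphism of J onto a
  compact set, so the functions in S are polynomials in finitely many coordinates.  Interpolating 1/s
  at the eigenvalues writes W as a combination of path kernels of length at least two, whence
  densities of multigraphs lie in A_1, and A_1 contained in S^G is a direct computation.

  If t_x = t_y for all one-labeled graphs, then moments show that every tuple around x can be matched,
  one point at a time, by a tuple around y with the same labeled densities.  Matching points u_i for
  which the W(.,u_i) span all f_i, and then every further point, gives an automorphism taking x to y
  (its measurability uses that J is standard).  By Stone-Weierstrass A_1 is dense in the invariant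
  continuous functions.  Density becomes equality by finite dimensionality: for p in S^G there is a
  positive kernel H(x,y) = sum phi(x) phi(y), a combination of two-labeled densities, with p in the
  span of the phi; it maps A_1 into A_1 intersected with this span, and the component r of p orthogonal
  to the latter satisfies T_H r = 0, hence r = 0.
*)
theory Submission
  imports Defs
begin

section \<open>Standard probability spaces\<close>

text \<open>\<open>W\<close> is determined only up to null sets, whereas A_1 and S are compared at
  every point. Purity bridges this: almost every section of \<open>W\<close> agrees with the finite
  sum \<open>w\<close>, nearby sections are close in L^1, and every ball has positive measure, so
  the agreement extends to the section at every point. From then on only \<open>w\<close> is
  integrated, and by full support an identity between members of S that holds almost everywhere
  holds everywhere.

  Powers of a density are again densities only when edges may be multiple, and the moment argument
  needs all powers; hence the detour through multigraphs.

  S need not be finite dimensional, so uniform density of A_1 does not by itself give equality. The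
  vanishing of T_H r comes from symmetry: T_H maps A_1 into the space to which r is orthogonal, so
  T_H r is orthogonal to A_1; being invariant it is also a uniform limit of A_1, hence orthogonal to
  itself. To be positive whatever the signs of the eigenvalues, H is built from \<open>w\<close>
  composed with itself.

  The automorphism is assembled from pointwise choices, so its measurability must be proved
  afterwards, by squeezing preimages between measurable sets of equal measure.\<close>

lemma polish_embedding:
  assumes "completely_metrizable_space X" "second_countable X"
  obtains e :: "'a \<Rightarrow> nat \<Rightarrow> real"
  where "homeomorphic_map X (top_of_set (e ` topspace X)) e" "e ` topspace X \<in> sets borel"
proof (cases "topspace X = {}")
  case True
  show ?thesis
    by (rule that[of "\<lambda>_ _. 0"]) (auto simp: True homeomorphic_map_def quotient_map_def)
next
  case False
  obtain S d where S: "Metric_space S d" and X: "X = Metric_space.mtopology S d"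
    using assms(1) unfolding completely_metrizable_space_def by blast
  interpret Metric_space S d by fact
  have tX: "topspace X = S" using X by simp
  obtain C where C: "countable C" "C \<subseteq> S" "X closure_of C = S"
    using second_countable_imp_separable_space[OF assms(2)] unfolding separable_space_def tX by blast
  have "C \<noteq> {}" using C False tX by auto
  define p where "p = from_nat_into C"
  have p: "p k \<in> S" for k using C(2) \<open>C \<noteq> {}\<close> from_nat_into[of C k] by (auto simp: p_def)
  have dense: "\<exists>k. d x (p k) < r" if "x \<in> S" "r > 0" for x r
  proof -
    have "x \<in> X closure_of C" using C that by simp
    then have "\<exists>y\<in>C. y \<in> mball x r"
      unfolding X metric_closure_of using that by auto
    then obtain y where "y \<in> C" "d x y < r" by auto
    moreover obtain k where "p k = y"
      using \<open>y \<in> C\<close> C(1) unfolding p_def by (metis from_nat_into_surj)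
    ultimately show ?thesis by auto
  qed
  \<comment> \<open>The coordinates are the distances to a countable dense set.\<close>
  define e where "e = (\<lambda>x k. d x (p k))"
  have cont: "continuous_map X euclidean e"
  proof -
    have "continuous_map X euclidean (\<lambda>x. e x k)" for k
      unfolding e_def X using continuous_map_mdist[of mtopology "metric (S, d)" id "\<lambda>_. p k"] by (simp add: p mtopology_of)
    then have "continuous_map X (product_topology (\<lambda>_. euclidean) UNIV) e"
      by (simp add: continuous_map_componentwise_UNIV)
    then show ?thesis by (simp add: euclidean_product_topology)
  qed
  \<comment> \<open>A single coordinate confines a point to the ball of radius \<open>s\<close>:
    take \<open>p k\<close> within \<open>s/2\<close> of \<open>x\<close>. Both injectivity and
    openness onto the image follow from this.\<close>
  have sep: "\<exists>k r. r > 0 \<and> e x k < r \<and> (\<forall>y\<in>S. e y k < r \<longrightarrow> d x y < s)" if x: "x \<in> S" and "s > 0" for x s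
  proof -
    obtain k where k: "d x (p k) < s/2" using dense[OF x, of "s/2"] \<open>s > 0\<close> by auto
    have "d x y < s" if "y \<in> S" "d y (p k) < s/2" for y
      using triangle[OF x p[of k] \<open>y \<in> S\<close>] k that commute[of y "p k"] by linarith
    then show ?thesis using k \<open>s > 0\<close> unfolding e_def by (intro exI[of _ k] exI[of _ "s/2"]) auto
  qed
  have inj: "inj_on e S"
  proof (rule inj_onI, rule ccontr)
    fix x y assume xy: "x \<in> S" "y \<in> S" "e x = e y" "x \<noteq> y"
    then have "d x y > 0" by simp
    from sep[OF xy(1) this] xy show False by (metis less_irrefl)
  qed
  have op: "open_map X (top_of_set (e ` S)) e"
    unfolding open_map_def
  proof (intro allI impI)
    fix U assume U: "openin X U"
    then have US: "U \<subseteq> S" using openin_subset tX by blast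
    show "openin (top_of_set (e ` S)) (e ` U)"
    proof (subst openin_subopen, intro ballI)
      fix z assume "z \<in> e ` U"
      then obtain x where x: "x \<in> U" "z = e x" by auto
      then obtain s where s: "s > 0" "mball x s \<subseteq> U"
        using U unfolding X openin_mtopology by blast
      obtain k r where kr: "e x k < r" "\<And>y. y \<in> S \<Longrightarrow> e y k < r \<Longrightarrow> d x y < s"
        using sep[of x s] x US s by blast
      define T where "T = e ` S \<inter> {\<xi>. \<xi> k < r}"
      have "open {\<xi>::nat \<Rightarrow> real. \<xi> k < r}"
        by (intro open_Collect_less continuous_intros) auto
      then have "openin (top_of_set (e ` S)) T" unfolding T_def by (auto simp: openin_open)
      moreover have "z \<in> T" using x US kr by (auto simp: T_def)
      moreover have "T \<subseteq> e ` U"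
      proof
        fix \<xi> assume "\<xi> \<in> T"
        then obtain y where y: "y \<in> S" "\<xi> = e y" "e y k < r" by (auto simp: T_def)
        then have "y \<in> mball x s" using kr x US by auto
        then show "\<xi> \<in> e ` U" using s y by auto
      qed
      ultimately show "\<exists>T. openin (top_of_set (e ` S)) T \<and> z \<in> T \<and> T \<subseteq> e ` U" by blast
    qed
  qed
  have hom: "homeomorphic_map X (top_of_set (e ` topspace X)) e"
    by (rule bijective_open_imp_homeomorphic_map)
      (use cont op inj tX in \<open>auto simp: continuous_map_in_subtopology\<close>)
  \<comment> \<open>Complete metrizability passes to the image, and a completely metrizable subspace
    of a metrizable space is a countable intersection of open sets. Hence the image is
    Borel.\<close>
  have "completely_metrizable_space (top_of_set (e ` topspace X))"
    using hom assms(1) homeomorphic_completely_metrizable_space homeomorphic_space homeomorphic_map_imp_homeomorphic_space by blast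
  then have "gdelta_in euclidean (e ` topspace X)"
    by (intro completely_metrizable_space_imp_gdelta_in) 
      (auto simp: completely_metrizable_space_euclidean completely_metrizable_imp_metrizable_space)
  then have "(countable intersection_of open) (e ` topspace X)"
    by (simp add: gdelta_in_alt)
  then obtain \<U> where "countable \<U>" "\<U> \<subseteq> Collect open" "\<Inter>\<U> = e ` topspace X"
    unfolding intersection_of_def by auto
  then have "e ` topspace X \<in> sets borel"
    using sets.countable_INT''[of borel \<U> "\<lambda>x. x"] by (auto simp: subset_iff)
  with hom show ?thesis using that by blast
qed

text \<open>\<open>F\<close> is measurable only for the completion, so images of measurable sets
  under it are not known to be Borel. Instead the graph of a Borel version of \<open>F\<close> over
  a large part of \<open>A\<close> is exhausted from inside by compact sets; their projections are
  compact, and injectivity of \<open>F\<close> recovers the exhausting set from its projection. This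
  is what later makes an automorphism measurable.\<close>

lemma standard_injective_inner:
  fixes F :: "'a \<Rightarrow> nat \<Rightarrow> real"
  assumes M: "standard_prob_space M" and F: "F \<in> borel_measurable M"
    and inj: "inj_on F (space M)" and A: "A \<in> sets M"
  shows "\<exists>B\<in>sets borel. {x \<in> space M. F x \<in> B} \<subseteq> A \<and> emeasure M {x \<in> space M. F x \<in> B} = emeasure M A"
proof -
  obtain X N where X: "completely_metrizable_space X" "second_countable X" and N: "prob_space N"
    and sp: "space N = topspace X" and se: "sets N = sigma_sets (topspace X) {U. openin X U}"
    and MN: "M = completion N"
    using M unfolding standard_prob_space_def by blast
  interpret N: prob_space N by fact
  have spM: "space M = space N" using MN by simp
  obtain e :: "'a \<Rightarrow> nat \<Rightarrow> real"
    where e: "homeomorphic_map X (top_of_set (e ` topspace X)) e" and eb: "e ` topspace X \<in> sets borel"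
    using polish_embedding[OF X] .
  have e_inj: "inj_on e (space N)" using e sp homeomorphic_imp_injective_map by metis
  have e_open: "openin (top_of_set (e ` space N)) (e ` U)" if "openin X U" for U
    using e that sp by (metis homeomorphic_imp_open_map open_map_def)
  have e_meas[measurable]: "e \<in> borel_measurable N"
  proof (rule borel_measurableI)
    fix U :: "(nat \<Rightarrow> real) set" assume "open U"
    then have "openin X {x \<in> topspace X. e x \<in> e ` topspace X \<inter> U}"
      using e by (intro openin_continuous_map_preimage[where Y = "top_of_set (e ` topspace X)"])
        (auto simp: homeomorphic_imp_continuous_map openin_open)
    moreover have "{x \<in> topspace X. e x \<in> e ` topspace X \<inter> U} = e -` U \<inter> space N" using sp by auto
    ultimately show "e -` U \<inter> space N \<in> sets N" using se by auto
  qed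
  have e_borel: "e ` D \<in> sets borel" if "D \<in> sets N" for D
  proof -
    have "D \<in> sigma_sets (topspace X) {U. openin X U}" using that se by simp
    then show ?thesis
    proof induction
      case (Basic a)
      then have "\<exists>T. open T \<and> e ` a = e ` space N \<inter> T" using e_open[of a] by (simp add: openin_open)
      then obtain T where "open T" "e ` a = e ` space N \<inter> T" by blast
      then show ?case using eb sp by auto
    next
      case Empty then show ?case by simp
    next
      case (Compl a)
      then have "a \<in> sets N" using se by simp
      then have "a \<subseteq> topspace X" using sets.sets_into_space sp by metis
      then have "e ` (topspace X - a) = e ` topspace X - e ` a"
        using e_inj sp by (intro inj_on_image_set_diff[where C = "topspace X"]) auto
      then show ?case using Compl eb by auto
    next
      case (Union a) then show ?case by (auto simp: image_UN)
    qed
  qed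
  \<comment> \<open>Each coordinate has a Borel version; since there are only countably many, the
    exceptional sets lie in one null set \<open>Z\<close>.\<close>
  have "\<exists>G. \<forall>k. G k \<in> borel_measurable N \<and> (AE x in N. F x k = G k x)"
  proof -
    have "(\<lambda>x. F x k) \<in> borel_measurable (completion N)" for k
      using F unfolding MN by (rule measurable_product_then_coordinatewise)
    then have "\<forall>k. \<exists>g. g \<in> borel_measurable N \<and> (AE x in N. F x k = g x)"
      using completion_ex_borel_measurable_real by blast
    then show ?thesis by (rule choice)
  qed
  then obtain G where G: "\<And>k. G k \<in> borel_measurable N" "\<And>k. AE x in N. F x k = G k x" by blast
  define F0 where "F0 = (\<lambda>x k. G k x)"
  have F0[measurable]: "F0 \<in> borel_measurable N"
    unfolding F0_def by (intro measurable_coordinatewise_then_product G)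
  have "AE x in N. F x = F0 x"
    using G(2) unfolding F0_def fun_eq_iff by (simp add: AE_all_countable)
  then obtain Z where Z: "{x \<in> space N. F x \<noteq> F0 x} \<subseteq> Z" "Z \<in> sets N" "emeasure N Z = 0"
    by (auto elim: AE_E)
  obtain A0 N0 N1 where A0: "A = A0 \<union> N0" "A0 \<in> sets N" "N0 \<subseteq> N1" "N1 \<in> null_sets N"
    using A MN by (auto elim: sets_completionE)
  \<comment> \<open>Off \<open>Z\<close> the version \<open>F0\<close> coincides with
    \<open>F\<close>, so the injectivity of \<open>F\<close> is available on
    \<open>A1\<close>.\<close>
  define A1 where "A1 = A0 - Z"
  have A1[measurable]: "A1 \<in> sets N" using A0 Z by (auto simp: A1_def)
  have A1s: "A1 \<subseteq> space N" using A1 sets.sets_into_space by blast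
  have "emeasure M A = emeasure N A1"
  proof -
    have "emeasure M A = emeasure M A1"
      using A A0 Z A1 MN
      by (intro emeasure_eq_AE)
        (auto simp: A1_def AE_completion_iff intro!: AE_completion AE_I[of _ _ "Z \<union> N1"] null_setsD1 null_sets.Un)
    then show ?thesis using MN A1 by simp
  qed
  define f where "f = (\<lambda>x. (e x, F0 x))"
  have f[measurable]: "f \<in> borel_measurable N"
    unfolding f_def borel_prod[symmetric] by measurable
  have Gr: "f ` A1 \<in> sets borel"
  proof -
    define E where "E = e ` A1"
    have E: "E \<in> sets borel" using e_borel A1 E_def by simp
    define g where "g = the_inv_into (space N) e"
    have g: "g (e x) = x" if "x \<in> space N" for x using that e_inj by (simp add: g_def the_inv_into_f_f)
    have "g \<in> measurable (restrict_space borel E) N"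
    proof (rule measurableI)
      fix x assume "x \<in> space (restrict_space borel E)"
      then show "g x \<in> space N" using A1s g by (auto simp: E_def space_restrict_space)
    next
      fix D assume D: "D \<in> sets N"
      have "g -` D \<inter> space (restrict_space borel E) = e ` (A1 \<inter> D)"
        using g A1s D sets.sets_into_space[OF D] by (auto simp: E_def space_restrict_space) 
      also have "\<dots> \<in> sets (restrict_space borel E)"
        using e_borel[of "A1 \<inter> D"] D E by (auto simp: sets_restrict_space_iff E_def)
      finally show "g -` D \<inter> space (restrict_space borel E) \<in> sets (restrict_space borel E)" .
    qed
    then have "(\<lambda>a. F0 (g a)) \<in> borel_measurable (restrict_space borel E)" by measurable
    then have h[measurable]: "(\<lambda>a. if a \<in> E then F0 (g a) else (\<lambda>_. 0)) \<in> borel_measurable borel"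
      using E by (subst measurable_If_restrict_space_iff) auto
    define h where "h = (\<lambda>a. if a \<in> E then F0 (g a) else (\<lambda>_. 0))"
    have [measurable]: "h \<in> borel_measurable borel" unfolding h_def by fact
    have E'[measurable]: "E \<in> sets borel" by fact
    have "h (e x) = F0 x" if "x \<in> A1" for x using that g[of x] A1s by (auto simp: h_def E_def)
    then have "f ` A1 = {q \<in> space (borel \<Otimes>\<^sub>M borel). fst q \<in> E \<and> snd q = h (fst q)}"
      by (auto simp: f_def E_def space_pair_measure)
    also have "\<dots> \<in> sets (borel \<Otimes>\<^sub>M borel)" by measurable
    finally show ?thesis unfolding borel_prod .
  qed
  define \<nu> where "\<nu> = distr N borel f"
  interpret \<nu>: prob_space \<nu> unfolding \<nu>_def by (rule N.prob_space_distr) simp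
  have "\<exists>K. compact K \<and> K \<subseteq> f ` A1 \<and> emeasure \<nu> K > emeasure \<nu> (f ` A1) - ennreal (1 / Suc n)" if "emeasure \<nu> (f ` A1) > 0" for n
  proof -
    have "emeasure \<nu> (f ` A1) = (SUP K \<in> {K. K \<subseteq> f ` A1 \<and> compact K}. emeasure \<nu> K)"
      by (rule inner_regular) (use Gr \<nu>.emeasure_space_1 in \<open>auto simp: \<nu>_def\<close>)
    moreover have "emeasure \<nu> (f ` A1) - ennreal (1 / Suc n) < emeasure \<nu> (f ` A1)"
      using that by (intro ennreal_between) (auto simp: less_top[symmetric])
    ultimately have "emeasure \<nu> (f ` A1) - ennreal (1 / Suc n) < (SUP K \<in> {K. K \<subseteq> f ` A1 \<and> compact K}. emeasure \<nu> K)"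
      by simp
    then show ?thesis unfolding less_SUP_iff by auto
  qed
  then have "\<exists>K. compact K \<and> K \<subseteq> f ` A1 \<and> emeasure \<nu> K \<ge> emeasure \<nu> (f ` A1) - ennreal (1 / Suc n)" for n
    by (cases "emeasure \<nu> (f ` A1) > 0") (force intro: less_imp_le, auto)
  then obtain K where K: "\<And>n. compact (K n)" "\<And>n. K n \<subseteq> f ` A1"
    "\<And>n. emeasure \<nu> (K n) \<ge> emeasure \<nu> (f ` A1) - ennreal (1 / Suc n)" by metis
  define U where "U = (\<Union>n. K n)"
  have Ub: "U \<in> sets borel" unfolding U_def using K(1) by (intro sets.countable_UN) (auto intro: borel_compact)
  have UA: "U \<subseteq> f ` A1" using K by (auto simp: U_def)
  have "emeasure \<nu> (f ` A1) \<le> emeasure \<nu> U + ennreal \<epsilon>" if "\<epsilon> > 0" for \<epsilon>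
  proof -
    obtain n where n: "1 / Suc n < \<epsilon>" using nat_approx_posE[OF \<open>\<epsilon> > 0\<close>] .
    have "emeasure \<nu> (f ` A1) \<le> emeasure \<nu> (K n) + ennreal (1 / Suc n)"
      using K(3)[of n] by (simp add: ennreal_minus_le_iff add.commute)
    also have "\<dots> \<le> emeasure \<nu> U + ennreal \<epsilon>"
      using n Ub by (intro add_mono emeasure_mono ennreal_leI) (auto simp: U_def \<nu>_def)
    finally show ?thesis .
  qed
  then have "emeasure \<nu> (f ` A1) \<le> emeasure \<nu> U" by (rule ennreal_le_epsilon)
  then have eqU: "emeasure \<nu> U = emeasure \<nu> (f ` A1)"
    using emeasure_mono[OF UA, of \<nu>] Gr by (simp add: \<nu>_def)
  have f_inj: "f x = f y \<Longrightarrow> x \<in> space N \<Longrightarrow> y \<in> space N \<Longrightarrow> x = y" for x y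
    using e_inj by (auto simp: f_def inj_on_def)
  define B where "B = snd ` U"
  have BU: "B = (\<Union>n. snd ` K n)" by (auto simp: B_def U_def)
  have "compact (snd ` K n)" for n by (intro compact_continuous_image continuous_intros K)
  then have B: "B \<in> sets borel" unfolding BU by (intro sets.countable_UN) (auto intro: borel_compact)
  \<comment> \<open>A point with \<open>F x\<close> in the projection shares its value with some
    point of \<open>A1\<close>; injectivity of \<open>F\<close> on the whole space makes the two
    points equal, so projecting loses nothing.\<close>
  have pre: "{x \<in> space M. F x \<in> B} = f -` U \<inter> space N"
  proof (intro set_eqI iffI)
    fix x assume x: "x \<in> {x \<in> space M. F x \<in> B}"
    then obtain u where u: "u \<in> U" "F x = snd u" by (auto simp: B_def)
    then obtain x' where x': "x' \<in> A1" "u = f x'" using UA by auto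
    have "x' \<notin> Z" using x' by (auto simp: A1_def)
    then have "F x' = F0 x'" using Z x' A1s by auto
    then have "F x = F x'" using u x' by (simp add: f_def)
    moreover have "x \<in> space M" "x' \<in> space M" using x x' A1s spM by auto
    ultimately have "x = x'" using inj by (simp add: inj_on_def)
    then show "x \<in> f -` U \<inter> space N" using u x' A1s by auto
  next
    fix x assume x: "x \<in> f -` U \<inter> space N"
    then obtain x' where "x' \<in> A1" "f x = f x'" using UA by auto
    moreover have "x = x'" by (rule f_inj) (use \<open>x' \<in> A1\<close> \<open>f x = f x'\<close> x A1s in auto)
    ultimately have xA: "x \<in> A1" by simp
    then have "F x = F0 x" using Z A1s by (auto simp: A1_def)
    then show "x \<in> {x \<in> space M. F x \<in> B}" using x spM by (force simp: B_def f_def)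
  qed
  show ?thesis
  proof (intro bexI[of _ B] conjI)
    show "B \<in> sets borel" by fact
    have "f -` U \<inter> space N \<subseteq> A1"
    proof
      fix x assume x: "x \<in> f -` U \<inter> space N"
      then obtain x' where x': "x' \<in> A1" "f x = f x'" using UA by auto
      moreover have "x = x'" by (rule f_inj) (use x' x A1s in auto)
      ultimately show "x \<in> A1" by simp
    qed
    then show "{x \<in> space M. F x \<in> B} \<subseteq> A" unfolding pre using A0 by (auto simp: A1_def)
    have *: "f -` (f ` A1) \<inter> space N = A1" using f_inj A1s by blast
    have "emeasure M {x \<in> space M. F x \<in> B} = emeasure \<nu> U"
      unfolding pre \<nu>_def using Ub MN f measurable_sets[OF f Ub] by (simp add: emeasure_distr)
    also have "\<dots> = emeasure N A1" unfolding eqU unfolding \<nu>_def using Gr * by (simp add: emeasure_distr)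
    finally show "emeasure M {x \<in> space M. F x \<in> B} = emeasure M A" using \<open>emeasure M A = emeasure N A1\<close> by simp
  qed
qed

section \<open>Linear algebra\<close>

text \<open>Elimination of the last coordinate. If some member \<open>e\<close> of \<open>V\<close>
  has a nonzero last entry, multiples of \<open>e\<close> reduce the claim to members ending in 0,
  and the functional obtained there is extended so as to vanish at \<open>e\<close>. Otherwise the
  last coordinate is either irrelevant or itself the separating functional.\<close>

lemma subspace_separation:
  fixes V :: "(nat \<Rightarrow> real) set"
  assumes "\<And>u v a. u \<in> V \<Longrightarrow> v \<in> V \<Longrightarrow> (\<lambda>i. u i + a * v i) \<in> V" "V \<noteq> {}"
    and "\<not> (\<exists>l\<in>V. \<forall>i<N. l i = v i)"
  shows "\<exists>c. (\<forall>l\<in>V. (\<Sum>i<N. c i * l i) = 0) \<and> (\<Sum>i<N. c i * v i) \<noteq> 0"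
  using assms
proof (induction N arbitrary: V v)
  case 0
  then show ?case by auto
next
  case (Suc N)
  note lin = Suc.prems(1)
  show ?case
  proof (cases "\<exists>e\<in>V. e N \<noteq> 0")
    case True
    then obtain e where e: "e \<in> V" "e N \<noteq> 0" by blast
    define V0 where "V0 = {l \<in> V. l N = 0}"
    define v' where "v' = (\<lambda>i. v i + (- (v N / e N)) * e i)"
    have red: "(\<lambda>i. l i + (- (l N / e N)) * e i) \<in> V0" if "l \<in> V" for l
      using lin[OF that e(1), of "- (l N / e N)"] e(2) by (simp add: V0_def)
    have "\<exists>c. (\<forall>l\<in>V0. (\<Sum>i<N. c i * l i) = 0) \<and> (\<Sum>i<N. c i * v' i) \<noteq> 0"
    proof (rule Suc.IH)
      show "(\<lambda>i. u i + a * w i) \<in> V0" if "u \<in> V0" "w \<in> V0" for u w a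
        using that lin by (auto simp: V0_def)
      show "V0 \<noteq> {}" using red e by auto
      show "\<not> (\<exists>l\<in>V0. \<forall>i<N. l i = v' i)"
      proof
        assume "\<exists>l\<in>V0. \<forall>i<N. l i = v' i"
        then obtain l where l: "l \<in> V0" "\<forall>i<N. l i = v' i" by blast
        have "(\<lambda>i. l i + (v N / e N) * e i) \<in> V" using lin[of l e "v N / e N"] l e by (simp add: V0_def)
        moreover have "\<forall>i<Suc N. l i + (v N / e N) * e i = v i"
        proof (intro allI impI)
          fix i assume "i < Suc N"
          then consider "i < N" | "i = N" by linarith
          then show "l i + (v N / e N) * e i = v i"
          proof cases
            case 1
            then have "l i = v i + (- (v N / e N)) * e i" using l(2) unfolding v'_def by blast
            then show ?thesis by simp
          next
            case 2
            then show ?thesis using l(1) e(2) by (simp add: V0_def)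
          qed
        qed
        ultimately have "\<exists>l\<in>V. \<forall>i<Suc N. l i = v i" by (intro bexI[where x = "\<lambda>i. l i + v N / e N * e i"])
        then show False using Suc.prems(3) by contradiction
      qed
    qed
    then obtain c where c: "\<And>l. l \<in> V0 \<Longrightarrow> (\<Sum>i<N. c i * l i) = 0" "(\<Sum>i<N. c i * v' i) \<noteq> 0" by blast
    \<comment> \<open>The last coefficient is the one that makes the functional vanish at
      \<open>e\<close>.\<close>
    define c' where "c' = c(N := - (\<Sum>i<N. c i * e i) / e N)"
    have val: "(\<Sum>i<Suc N. c' i * l i) = (\<Sum>i<N. c i * (l i + (- (l N / e N)) * e i))" for l
    proof -
      have "(\<Sum>i<N. c i * (l i + (- (l N / e N)) * e i)) = (\<Sum>i<N. c i * l i) + (\<Sum>i<N. (- (l N / e N)) * (c i * e i))"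
        by (simp add: algebra_simps sum.distrib[symmetric])
      also have "\<dots> = (\<Sum>i<N. c i * l i) - (l N / e N) * (\<Sum>i<N. c i * e i)"
        unfolding sum_distrib_left[symmetric] by simp
      finally show ?thesis by (simp add: c'_def)
    qed
    have "(\<Sum>i<Suc N. c' i * l i) = 0" if "l \<in> V" for l using c(1)[OF red[OF that]] val[of l] by simp
    moreover have "(\<Sum>i<Suc N. c' i * v i) \<noteq> 0" using c(2) val[of v] unfolding v'_def by simp
    ultimately show ?thesis by blast
  next
    case False
    then have z: "\<And>l. l \<in> V \<Longrightarrow> l N = 0" by auto
    show ?thesis
    proof (cases "v N = 0")
      case True
      have "\<not> (\<exists>l\<in>V. \<forall>i<N. l i = v i)"
        using Suc.prems(3) z True by (metis less_antisym)
      from Suc.IH[OF lin Suc.prems(2) this] obtain c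
        where "\<forall>l\<in>V. (\<Sum>i<N. c i * l i) = 0" "(\<Sum>i<N. c i * v i) \<noteq> 0" by blast
      then show ?thesis using z True by (intro exI[of _ c]) auto
    next
      case False
      have "(\<Sum>i<Suc N. (if i = N then 1 else 0) * l i) = l N" for l :: "nat \<Rightarrow> real"
        by (simp add: if_distrib[of "\<lambda>x. x * _"] sum.delta cong: if_cong)
      then show ?thesis using False z by (intro exI[of _ "\<lambda>i. if i = N then 1 else 0"]) simp
    qed
  qed
qed

lemma poly_interpolation:
  fixes A :: "real set" assumes "finite A"
  shows "\<exists>n c. \<forall>a\<in>A. (\<Sum>m<n. c m * a ^ m) = h a"
proof -
  have "\<exists>p. \<forall>a\<in>A. poly p a = h a"
    using assms
  proof (induction A)
    case empty
    then show ?case by auto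
  next
    case (insert a A)
    then obtain p where p: "\<forall>b\<in>A. poly p b = h b" by blast
    define q where "q = (\<Prod>b\<in>A. [:- b, 1:])"
    have q: "poly q x = (\<Prod>b\<in>A. x - b)" for x by (simp add: q_def poly_prod)
    have qa: "poly q a \<noteq> 0" using insert by (auto simp: q)
    have qb: "poly q b = 0" if "b \<in> A" for b using insert that by (auto simp: q)
    show ?case
      \<comment> \<open>Newton interpolation: \<open>q\<close> vanishes at the old nodes, so a
        multiple of it corrects the value at the new one.\<close>
      by (rule exI[of _ "p + smult ((h a - poly p a) / poly q a) q"]) (use p qa qb in auto)
  qed
  then obtain p where p: "\<And>a. a \<in> A \<Longrightarrow> poly p a = h a" by blast
  have "(\<Sum>m<Suc (degree p). coeff p m * a ^ m) = poly p a" for a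
    by (simp add: poly_altdef lessThan_Suc_atMost)
  then show ?thesis using p by metis
qed

text \<open>A linear term dominated by a quadratic one for both signs of \<open>s\<close> must
  vanish, as small \<open>s\<close> shows. It serves as the first-order condition for the maximiser
  below and as the degenerate case of Cauchy-Schwarz.\<close>

lemma linear_term_zero:
  fixes a b :: real
  assumes "\<And>s. 2 * s * a \<le> s\<^sup>2 * b"
  shows "a = 0"
proof (rule ccontr)
  assume "a \<noteq> 0"
  define s where "s = a / (\<bar>b\<bar> + 1)"
  have s: "a = s * (\<bar>b\<bar> + 1)" by (simp add: s_def)
  have "s \<noteq> 0" using \<open>a \<noteq> 0\<close> s by auto
  then have "s\<^sup>2 > 0" by simp
  have "2 * s * a = s\<^sup>2 * (2 * \<bar>b\<bar> + 2)" by (subst s) (simp add: power2_eq_square algebra_simps)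
  then have "s\<^sup>2 * (2 * \<bar>b\<bar> + 2) \<le> s\<^sup>2 * b" using assms[of s] by simp
  then have "2 * \<bar>b\<bar> + 2 \<le> b" using \<open>s\<^sup>2 > 0\<close> by simp
  then show False by linarith
qed

lemma continuous_on_product_coordinate [continuous_intros]:
  "continuous_on S (\<lambda>x :: 'i \<Rightarrow> 'b::topological_space. x i)"
  by (rule continuous_on_subset[OF continuous_on_product_coordinates]) simp

text \<open>Vectors of dimension \<open>n\<close> are sequences vanishing from \<open>n\<close> on,
  so the sphere is a closed subset of a Tychonoff cube.\<close>

lemma compact_unit_sphere_lessThan:
  "compact {v :: nat \<Rightarrow> real. (\<forall>i\<ge>n. v i = 0) \<and> (\<Sum>i<n. (v i)\<^sup>2) = 1}" (is "compact ?S")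
proof -
  have "compact (PiE UNIV (\<lambda>_::nat. {-1..1::real}))"
    using compactin_PiE[of "\<lambda>_. euclidean" UNIV "\<lambda>_::nat. {-1..1::real}"]
    by (simp add: euclidean_product_topology)
  moreover have "closed ?S"
    by (intro closed_Collect_conj closed_Collect_all closed_Collect_imp closed_Collect_eq continuous_intros) auto
  moreover have "?S \<subseteq> PiE UNIV (\<lambda>_::nat. {-1..1::real})"
  proof (intro subsetI, rule PiE_I)
    fix v i assume v: "v \<in> ?S"
    have "(v i)\<^sup>2 \<le> 1"
    proof (cases "i < n")
      case True
      then have "(v i)\<^sup>2 \<le> (\<Sum>i<n. (v i)\<^sup>2)" by (intro member_le_sum) auto
      then show ?thesis using v by simp
    next
      case False
      then show ?thesis using v by simp
    qed
    then show "v i \<in> {-1..1}" using abs_square_le_1[of "v i"] by (auto simp: abs_le_iff)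
  qed auto
  ultimately have "compact (PiE UNIV (\<lambda>_::nat. {-1..1::real}) \<inter> ?S)" "PiE UNIV (\<lambda>_::nat. {-1..1::real}) \<inter> ?S = ?S"
    by (auto intro: compact_Int_closed)
  then show ?thesis by (simp only:)
qed

text \<open>An eigenvector is found where the absolute value of the quadratic form is largest on the
  unit sphere. Maximising the absolute value, rather than the form, guarantees a nonzero eigenvalue
  as soon as the matrix is nonzero.\<close>

lemma symmetric_eigenvector:
  fixes C :: "nat \<Rightarrow> nat \<Rightarrow> real"
  assumes sym: "\<And>i j. i < n \<Longrightarrow> j < n \<Longrightarrow> C i j = C j i"
    and nz: "i0 < n" "j0 < n" "C i0 j0 \<noteq> 0"
  shows "\<exists>v \<mu>. \<mu> \<noteq> 0 \<and> (\<Sum>i<n. (v i)\<^sup>2) = 1 \<and> (\<forall>i<n. (\<Sum>j<n. C i j * v j) = \<mu> * v i)"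
proof -
  define B where "B = (\<lambda>x y. \<Sum>i<n. \<Sum>j<n. C i j * x i * y j)"
  define ip where "ip = (\<lambda>x y :: nat \<Rightarrow> real. \<Sum>i<n. x i * y i)"
  have ip_sq: "ip x x = (\<Sum>i<n. (x i)\<^sup>2)" for x by (simp add: ip_def power2_eq_square)
  have B_sym: "B x y = B y x" for x y
    unfolding B_def by (subst sum.swap) (auto intro!: sum.cong simp: sym)
  have B_add: "B (\<lambda>i. x i + s * y i) z = B x z + s * B y z" for x y z s
    by (simp add: B_def algebra_simps sum.distrib sum_distrib_left)
  have B_exp: "B (\<lambda>i. x i + s * y i) (\<lambda>i. x i + s * y i) = B x x + 2 * s * B x y + s\<^sup>2 * B y y" for x y s
    by (simp add: B_add B_sym[of _ "\<lambda>i. x i + s * y i"] B_sym[of y x] power2_eq_square algebra_simps)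
  have ip_exp: "ip (\<lambda>i. x i + s * y i) (\<lambda>i. x i + s * y i) = ip x x + 2 * s * ip x y + s\<^sup>2 * ip y y" for x y s
    by (simp add: ip_def algebra_simps sum.distrib sum_distrib_left power2_eq_square)
  define S where "S = {v :: nat \<Rightarrow> real. (\<forall>i\<ge>n. v i = 0) \<and> (\<Sum>i<n. (v i)\<^sup>2) = 1}"
  define u where "u = (\<lambda>k i :: nat. if i = k then 1 else 0 :: real)"
  have Bu: "B (u k) x = (\<Sum>j<n. C k j * x j)" if "k < n" for k x
    using that unfolding B_def u_def by (subst sum.swap) (simp add: if_distrib[of "\<lambda>x. _ * x * _"] sum.delta cong: if_cong)
  have ipu: "ip (u k) x = x k" if "k < n" for k x
    using that by (simp add: ip_def u_def if_distrib[of "\<lambda>x. x * _"] sum.delta cong: if_cong)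
  have uS: "u i0 \<in> S" using nz
    by (simp add: S_def u_def if_distrib[of "\<lambda>x. x\<^sup>2"] sum.delta cong: if_cong)
  have cont: "continuous_on S (\<lambda>v. \<bar>B v v\<bar>)" unfolding B_def by (intro continuous_intros)
  obtain v where v: "v \<in> S" "\<And>x. x \<in> S \<Longrightarrow> \<bar>B x x\<bar> \<le> \<bar>B v v\<bar>"
    using continuous_attains_sup[OF compact_unit_sphere_lessThan[of n, folded S_def] _ cont] uS by blast
  have hom: "B (\<lambda>i. r * x i) (\<lambda>i. r * x i) = r\<^sup>2 * B x x" for r x
    by (simp add: B_def sum_distrib_left power2_eq_square mult_ac)
  have bound: "\<bar>B x x\<bar> \<le> \<bar>B v v\<bar> * ip x x" for x
  proof (cases "ip x x = 0")
    case True
    then have "\<forall>i<n. x i = 0" by (simp add: ip_sq sum_nonneg_eq_0_iff)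
    then show ?thesis using True by (simp add: B_def)
  next
    case False
    then have pos: "ip x x > 0" by (metis ip_sq less_eq_real_def sum_nonneg zero_le_power2)
    define r where "r = 1 / sqrt (ip x x)"
    have r: "r\<^sup>2 * ip x x = 1" using pos by (simp add: r_def power_divide)
    define y where "y = (\<lambda>i. if i < n then r * x i else 0)"
    have "y \<in> S" using r by (simp add: S_def y_def ip_sq power_mult_distrib sum_distrib_left)
    moreover have "B y y = B (\<lambda>i. r * x i) (\<lambda>i. r * x i)" by (simp add: B_def y_def)
    ultimately have "r\<^sup>2 * \<bar>B x x\<bar> \<le> \<bar>B v v\<bar>" using v(2)[of y] by (simp add: hom abs_mult)
    then have "r\<^sup>2 * \<bar>B x x\<bar> * ip x x \<le> \<bar>B v v\<bar> * ip x x" using pos by (intro mult_right_mono) auto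
    moreover have "r\<^sup>2 * \<bar>B x x\<bar> * ip x x = \<bar>B x x\<bar>" using r by (simp add: mult_ac)
    ultimately show ?thesis by simp
  qed
  \<comment> \<open>Polarisation: if the quadratic form vanished everywhere, so would the bilinear
    form, including its entry at \<open>i0\<close>, \<open>j0\<close>.\<close>
  have "B v v \<noteq> 0"
  proof
    assume "B v v = 0"
    then have z: "B x x = 0" for x using bound[of x] by simp
    have "2 * B (u i0) (u j0) = 0"
      using B_exp[of "u i0" 1 "u j0"] z by simp
    then show False using nz
      by (simp add: Bu) (simp add: u_def if_distrib[of "\<lambda>x. _ * x"] sum.delta cong: if_cong)
  qed
  have ipv: "ip v v = 1" using v(1) by (simp add: S_def ip_sq)
  \<comment> \<open>Moving from \<open>v\<close> in direction \<open>d\<close> cannot increase the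
    quotient. The factor \<open>sgn (B v v)\<close> treats a maximum and a minimum of the form
    alike.\<close>
  have key: "B v d = B v v * ip v d" for d
  proof -
    have "2 * s * (sgn (B v v) * (B v d - B v v * ip v d)) \<le> s\<^sup>2 * (\<bar>B v v\<bar> * ip d d - sgn (B v v) * B d d)" for s
    proof -
      have "sgn (B v v) * B (\<lambda>i. v i + s * d i) (\<lambda>i. v i + s * d i) \<le> \<bar>B v v\<bar> * ip (\<lambda>i. v i + s * d i) (\<lambda>i. v i + s * d i)"
        by (rule order_trans[OF _ bound]) (auto simp: sgn_if)
      then show ?thesis
        unfolding B_exp ip_exp ipv using sgn_if[of "B v v"] by (simp add: algebra_simps abs_if split: if_splits)
    qed
    then have "sgn (B v v) * (B v d - B v v * ip v d) = 0" by (rule linear_term_zero)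
    then show ?thesis using \<open>B v v \<noteq> 0\<close> by (simp add: sgn_0_0)
  qed
  have "(\<Sum>j<n. C i j * v j) = B v v * v i" if "i < n" for i
  proof -
    have "ip v (u i) = ip (u i) v" by (simp add: ip_def mult.commute)
    then show ?thesis using key[of "u i"] that Bu[of i v] ipu[of i v] B_sym[of v "u i"] by simp
  qed
  then show ?thesis using \<open>B v v \<noteq> 0\<close> ipv ip_sq by metis
qed

text \<open>Bessel's inequality for the \<open>i\<close>-th unit vector bounds the squared
  \<open>i\<close>-th coordinates of the family by 1; summing over \<open>i\<close> counts the
  family.\<close>

lemma orthonormal_vectors_le:
  fixes v :: "nat \<Rightarrow> nat \<Rightarrow> real"
  assumes on: "\<And>a b. a < m \<Longrightarrow> b < m \<Longrightarrow> (\<Sum>i<n. v a i * v b i) = (if a = b then 1 else 0)"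
  shows "m \<le> n"
proof -
  have bessel: "(\<Sum>a<m. (v a i)\<^sup>2) \<le> 1" if "i < n" for i
  proof -
    define s where "s = (\<Sum>a<m. (v a i)\<^sup>2)"
    have "0 \<le> (\<Sum>k<n. ((if k = i then 1 else 0) - (\<Sum>a<m. v a i * v a k))\<^sup>2)" by (intro sum_nonneg) auto
    also have "\<dots> = (\<Sum>k<n. (if k = i then 1 else 0) - 2 * (if k = i then 1 else 0) * (\<Sum>a<m. v a i * v a k)
        + (\<Sum>a<m. \<Sum>b<m. v a i * v b i * (v a k * v b k)))"
      by (intro sum.cong) (auto simp: power2_eq_square algebra_simps sum_product)
    also have "\<dots> = 1 - 2 * (\<Sum>a<m. v a i * v a i) + (\<Sum>k<n. \<Sum>a<m. \<Sum>b<m. v a i * v b i * (v a k * v b k))"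
      using that by (simp add: sum.distrib sum_subtractf if_distrib[of "\<lambda>x. x * _"] if_distrib[of "\<lambda>x. _ * x"] sum.delta cong: if_cong)
    also have "(\<Sum>k<n. \<Sum>a<m. \<Sum>b<m. v a i * v b i * (v a k * v b k)) = (\<Sum>a<m. \<Sum>k<n. \<Sum>b<m. v a i * v b i * (v a k * v b k))"
      by (rule sum.swap)
    also have "\<dots> = (\<Sum>a<m. \<Sum>b<m. \<Sum>k<n. v a i * v b i * (v a k * v b k))"
      by (intro sum.cong refl sum.swap)
    also have "\<dots> = (\<Sum>a<m. \<Sum>b<m. v a i * v b i * (\<Sum>k<n. v a k * v b k))"
      by (simp add: sum_distrib_left)
    also have "\<dots> = (\<Sum>a<m. v a i * v a i)"
      by (intro sum.cong refl) (simp add: on if_distrib[of "\<lambda>x. _ * x"] sum.delta cong: if_cong)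
    finally show ?thesis by (simp add: power2_eq_square)
  qed
  have "real m = (\<Sum>a<m. \<Sum>i<n. (v a i)\<^sup>2)" using on by (simp add: power2_eq_square)
  also have "\<dots> = (\<Sum>i<n. \<Sum>a<m. (v a i)\<^sup>2)" by (rule sum.swap)
  also have "\<dots> \<le> (\<Sum>i<n. 1)" using bessel by (intro sum_mono) auto
  finally show ?thesis by simp
qed

text \<open>Take an orthonormal family of eigenvectors with nonzero eigenvalues that is as long as
  possible. If the part of \<open>C\<close> it does not explain were nonzero, an eigenvector of that
  remainder would extend the family. The zero eigenvalue never enters, as only the range of the
  operator matters.\<close>

lemma symmetric_spectral_decomposition:
  fixes C :: "nat \<Rightarrow> nat \<Rightarrow> real"
  assumes sym: "\<And>i j. i < n \<Longrightarrow> j < n \<Longrightarrow> C i j = C j i"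
  shows "\<exists>(m::nat) v \<mu>. (\<forall>a<m. \<forall>b<m. (\<Sum>i<n. v a i * v b i) = (if a = b then 1 else 0 :: real)) \<and>
    (\<forall>a<m. \<mu> a \<noteq> (0::real)) \<and> (\<forall>i<n. \<forall>j<n. C i j = (\<Sum>a<m. \<mu> a * v a i * v a j))"
proof -
  define fam where "fam = (\<lambda>m (v :: nat \<Rightarrow> nat \<Rightarrow> real) (\<mu> :: nat \<Rightarrow> real). (\<forall>a<m. \<forall>b<m. (\<Sum>i<n. v a i * v b i) = (if a = b then 1 else 0 :: real)) \<and>
     (\<forall>a<m. \<mu> a \<noteq> (0::real)) \<and> (\<forall>a<m. \<forall>i<n. (\<Sum>j<n. C i j * v a j) = \<mu> a * v a i))"
  have "\<exists>m. (\<exists>v \<mu>. fam m v \<mu>) \<and> (\<forall>k. (\<exists>v \<mu>. fam k v \<mu>) \<longrightarrow> k \<le> m)"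
  proof (rule Nat.ex_has_greatest_nat[where b = n and k = 0, of "\<lambda>m. \<exists>v \<mu>. fam m v \<mu>"])
    show "\<exists>v \<mu>. fam 0 v \<mu>" by (simp add: fam_def)
    show "\<forall>y. (\<exists>v \<mu>. fam y v \<mu>) \<longrightarrow> y \<le> n" unfolding fam_def using orthonormal_vectors_le by blast
  qed
  then obtain m v \<mu> where fam: "fam m v \<mu>" and mx: "\<And>k v \<mu>. fam k v \<mu> \<Longrightarrow> k \<le> m" by blast
  have on: "\<And>a b. a < m \<Longrightarrow> b < m \<Longrightarrow> (\<Sum>i<n. v a i * v b i) = (if a = b then 1 else 0)"
    and nz: "\<And>a. a < m \<Longrightarrow> \<mu> a \<noteq> 0"
    and ev: "\<And>a i. a < m \<Longrightarrow> i < n \<Longrightarrow> (\<Sum>j<n. C i j * v a j) = \<mu> a * v a i"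
    using fam by (auto simp: fam_def)
  define D where "D = (\<lambda>i j. C i j - (\<Sum>a<m. \<mu> a * v a i * v a j))"
  have Dsym: "D i j = D j i" if "i < n" "j < n" for i j
    using sym[OF that] by (simp add: D_def mult_ac)
  have Dx: "(\<Sum>j<n. D i j * x j) = (\<Sum>j<n. C i j * x j) - (\<Sum>a<m. \<mu> a * v a i * (\<Sum>j<n. v a j * x j))" for i x
  proof -
    have "(\<Sum>j<n. D i j * x j) = (\<Sum>j<n. C i j * x j) - (\<Sum>j<n. \<Sum>a<m. \<mu> a * v a i * (v a j * x j))"
      by (simp add: D_def left_diff_distrib sum_subtractf sum_distrib_right mult.assoc)
    also have "(\<Sum>j<n. \<Sum>a<m. \<mu> a * v a i * (v a j * x j)) = (\<Sum>a<m. \<mu> a * v a i * (\<Sum>j<n. v a j * x j))"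
      by (subst sum.swap) (simp add: sum_distrib_left)
    finally show ?thesis .
  qed
  have "D i j = 0" if ij: "i < n" "j < n" for i j
  proof (rule ccontr)
    assume "D i j \<noteq> 0"
    then obtain x \<nu> where x: "\<nu> \<noteq> 0" "(\<Sum>i<n. (x i)\<^sup>2) = 1" "\<And>i. i < n \<Longrightarrow> (\<Sum>j<n. D i j * x j) = \<nu> * x i"
      using symmetric_eigenvector[of n D i j] Dsym ij by blast
    have Dv: "(\<Sum>j<n. D i j * v b j) = 0" if "b < m" "i < n" for b i
    proof -
      have "(\<Sum>a<m. \<mu> a * v a i * (\<Sum>j<n. v a j * v b j)) = \<mu> b * v b i"
        using that by (simp add: on if_distrib[of "\<lambda>x. _ * x"] sum.delta cong: if_cong)
      then show ?thesis using that by (simp add: Dx ev)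
    qed
    \<comment> \<open>The remainder \<open>D\<close> is symmetric and kills every
      \<open>v b\<close>, so its eigenvectors for nonzero eigenvalues are orthogonal to all of them;
      on such vectors \<open>C\<close> and \<open>D\<close> agree.\<close>
    have orth: "(\<Sum>i<n. v b i * x i) = 0" if "b < m" for b
    proof -
      have "\<nu> * (\<Sum>i<n. v b i * x i) = (\<Sum>i<n. v b i * (\<nu> * x i))"
        by (simp add: sum_distrib_left mult_ac)
      also have "\<dots> = (\<Sum>i<n. v b i * (\<Sum>j<n. D i j * x j))"
        by (intro sum.cong refl) (simp add: x(3))
      also have "\<dots> = (\<Sum>i<n. \<Sum>j<n. v b i * (D i j * x j))" by (simp add: sum_distrib_left)
      also have "\<dots> = (\<Sum>j<n. \<Sum>i<n. v b i * (D i j * x j))" by (rule sum.swap)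
      also have "\<dots> = (\<Sum>j<n. x j * (\<Sum>i<n. D j i * v b i))"
        by (intro sum.cong refl) (auto simp: sum_distrib_left mult_ac Dsym intro!: sum.cong)
      also have "\<dots> = 0" using Dv[OF that] by simp
      finally show ?thesis using x(1) by simp
    qed
    have Cx: "(\<Sum>j<n. C i j * x j) = \<nu> * x i" if "i < n" for i
      using Dx[of i x] orth x(3)[OF that] by simp
    have "fam (Suc m) (v(m := x)) (\<mu>(m := \<nu>))"
      unfolding fam_def
    proof (intro conjI allI impI)
      fix a b assume ab: "a < Suc m" "b < Suc m"
      show "(\<Sum>i<n. (v(m := x)) a i * (v(m := x)) b i) = (if a = b then 1 else 0)"
        using ab on orth x(2) by (auto simp: less_Suc_eq power2_eq_square mult.commute)
    qed (use nz ev x Cx in \<open>auto simp: less_Suc_eq\<close>)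
    then show False using mx by fastforce
  qed
  then have CC: "\<And>i j. i < n \<Longrightarrow> j < n \<Longrightarrow> C i j = (\<Sum>a<m. \<mu> a * v a i * v a j)" by (simp add: D_def)
  show ?thesis by (intro exI[of _ m] exI[of _ v] exI[of _ \<mu>]) (simp add: on nz CC)
qed

section \<open>Finitely generated function spaces and orthogonal projection\<close>

fun list_span :: "('a \<Rightarrow> real) list \<Rightarrow> ('a \<Rightarrow> real) set" where
  "list_span [] = {\<lambda>_. 0}"
| "list_span (\<phi> # \<phi>s) = {\<lambda>x. c * \<phi> x + u x | c u. u \<in> list_span \<phi>s}"

lemma list_span_lin: "u \<in> list_span \<phi>s \<Longrightarrow> v \<in> list_span \<phi>s \<Longrightarrow> (\<lambda>x. u x + a * v x) \<in> list_span \<phi>s"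
proof (induction \<phi>s arbitrary: u v)
  case Nil
  then show ?case by simp
next
  case (Cons \<phi> \<phi>s)
  then obtain c u' d v' where "u = (\<lambda>x. c * \<phi> x + u' x)" "v = (\<lambda>x. d * \<phi> x + v' x)"
    "u' \<in> list_span \<phi>s" "v' \<in> list_span \<phi>s" by auto
  then show ?case using Cons.IH[of u' v']
    by (auto intro!: exI[of _ "c + a * d"] exI[of _ "\<lambda>x. u' x + a * v' x"] simp: algebra_simps)
qed

text \<open>The form is only positive semidefinite, because functions differing on a null set are
  not identified, and \<open>U\<close> is an arbitrary subspace of a finitely generated space,
  without a basis. Both are met by Gram-Schmidt along the generators: dropping one generator reduces
  \<open>U\<close> by at most one dimension.\<close>

lemma orthogonal_projection_exists:
  fixes ip :: "('a \<Rightarrow> real) \<Rightarrow> ('a \<Rightarrow> real) \<Rightarrow> real"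
  assumes D: "\<And>u v a. u \<in> D \<Longrightarrow> v \<in> D \<Longrightarrow> (\<lambda>x. u x + a * v x) \<in> D"
    and sym: "\<And>u v. u \<in> D \<Longrightarrow> v \<in> D \<Longrightarrow> ip u v = ip v u"
    and lin: "\<And>u v w a. u \<in> D \<Longrightarrow> v \<in> D \<Longrightarrow> w \<in> D \<Longrightarrow> ip (\<lambda>x. u x + a * v x) w = ip u w + a * ip v w"
    and pos: "\<And>u. u \<in> D \<Longrightarrow> ip u u \<ge> 0"
    and U: "U \<subseteq> D" "U \<noteq> {}" "\<And>u v a. u \<in> U \<Longrightarrow> v \<in> U \<Longrightarrow> (\<lambda>x. u x + a * v x) \<in> U"
    and "U \<subseteq> list_span \<phi>s" "p \<in> D"
  shows "\<exists>q\<in>U. \<forall>u\<in>U. ip (\<lambda>x. p x + (-1) * q x) u = 0"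
  using U \<open>U \<subseteq> list_span \<phi>s\<close> \<open>p \<in> D\<close>
proof (induction \<phi>s arbitrary: U p)
  case Nil
  then have U0: "U = {\<lambda>_. 0}" by auto
  then have "(\<lambda>_. 0) \<in> D" using Nil by auto
  moreover from this have "ip w (\<lambda>_. 0) = 0" if "w \<in> D" for w
    using lin[of "\<lambda>_. 0" "\<lambda>_. 0" w 1] sym that by simp
  ultimately show ?case using U0 D[OF Nil.prems(5), of "\<lambda>_. 0" "-1"] by auto
next
  case (Cons \<phi> \<phi>s)
  note UD = subsetD[OF Cons.prems(1)] and Ulin = Cons.prems(3)
  define U0 where "U0 = U \<inter> list_span \<phi>s"
  have zU: "(\<lambda>_. 0) \<in> U" using Cons.prems(2) Ulin[of _ _ "-1"] by fastforce
  have zs: "(\<lambda>_. 0) \<in> list_span \<phi>s" for \<phi>s :: "('a \<Rightarrow> real) list"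
    by (induction \<phi>s) (auto intro!: exI[of _ "0::real"])
  have U0: "U0 \<subseteq> D" "U0 \<noteq> {}" "\<And>u v a. u \<in> U0 \<Longrightarrow> v \<in> U0 \<Longrightarrow> (\<lambda>x. u x + a * v x) \<in> U0" "U0 \<subseteq> list_span \<phi>s"
    using zU zs UD Ulin list_span_lin by (auto simp: U0_def)
  have IH: "\<exists>q\<in>U0. \<forall>u\<in>U0. ip (\<lambda>x. p x + (-1) * q x) u = 0" if "p \<in> D" for p
    by (rule Cons.IH) (use U0 that in auto)
  show ?case
  proof (cases "U \<subseteq> list_span \<phi>s")
    case True
    then have "U0 = U" by (auto simp: U0_def)
    then show ?thesis using IH Cons.prems by simp
  next
    case False
    then obtain e where e: "e \<in> U" "e \<notin> list_span \<phi>s" by auto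
    then obtain c e0 where ce: "e = (\<lambda>x. c * \<phi> x + e0 x)" "e0 \<in> list_span \<phi>s" using Cons.prems(4) by auto
    then have "c \<noteq> 0" using e by auto
    \<comment> \<open>One member \<open>e\<close> of \<open>U\<close> outside the smaller span
      suffices: subtracting a multiple of it cancels the generator in every other member.\<close>
    have red: "\<exists>b u0. u0 \<in> U0 \<and> u = (\<lambda>x. u0 x + b * e x)" if "u \<in> U" for u
    proof -
      from that obtain d u1 where u: "u = (\<lambda>x. d * \<phi> x + u1 x)" "u1 \<in> list_span \<phi>s" using Cons.prems(4) by auto
      have "(\<lambda>x. u x + (- (d / c)) * e x) \<in> U" by (rule Ulin) fact+
      moreover have "(\<lambda>x. u x + (- (d / c)) * e x) = (\<lambda>x. u1 x + (- (d / c)) * e0 x)"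
        using u ce \<open>c \<noteq> 0\<close> by (auto simp: fun_eq_iff field_simps)
      moreover have "(\<lambda>x. u1 x + (- (d / c)) * e0 x) \<in> list_span \<phi>s" using u ce by (intro list_span_lin)
      ultimately have "(\<lambda>x. u x + (- (d / c)) * e x) \<in> U0" by (simp add: U0_def)
      then show ?thesis by (intro exI[of _ "d / c"] exI[of _ "\<lambda>x. u x + (- (d / c)) * e x"]) auto
    qed
    have eD: "e \<in> D" using e UD by blast
    obtain es where es: "es \<in> U0" "\<And>u. u \<in> U0 \<Longrightarrow> ip (\<lambda>x. e x + (-1) * es x) u = 0" using IH[OF eD] by blast
    define f where "f = (\<lambda>x. e x + (-1) * es x)"
    have fU: "f \<in> U" using e es Ulin[of e es "-1"] by (auto simp: f_def U0_def)
    have fD: "f \<in> D" using fU UD by blast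
    have f0: "ip f u = 0" if "u \<in> U0" for u using es(2)[OF that] by (simp add: f_def)
    obtain p0 where p0: "p0 \<in> U0" "\<And>u. u \<in> U0 \<Longrightarrow> ip (\<lambda>x. p x + (-1) * p0 x) u = 0" using IH[OF Cons.prems(5)] by blast
    define g where "g = (\<lambda>x. p x + (-1) * p0 x)"
    have gD: "g \<in> D" using D[OF Cons.prems(5), of p0 "-1"] p0(1) U0(1) unfolding g_def by blast
    define k where "k = ip g f / ip f f"
    \<comment> \<open>If \<open>ip f f\<close> is 0 the quotient defining \<open>k\<close> is 0 by
      convention, and semidefiniteness forces \<open>ip g f\<close> to be 0 as well.\<close>
    have kf: "ip g f = k * ip f f"
    proof (cases "ip f f = 0")
      case True
      have "2 * s * ip g f \<le> s\<^sup>2 * (ip g g)" for s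
      proof -
        have "(\<lambda>x. f x + (-s) * g x) \<in> D" by (rule D) fact+
        note hD = this
        have "ip (\<lambda>x. f x + (-s) * g x) (\<lambda>x. f x + (-s) * g x) = ip f f - 2 * s * ip g f + s\<^sup>2 * ip g g"
          unfolding lin[OF fD gD hD] sym[OF fD hD] sym[OF gD hD] lin[OF fD gD fD] lin[OF fD gD gD] sym[OF fD gD]
          by (simp add: power2_eq_square algebra_simps)
        then show ?thesis using pos[OF hD] True by simp
      qed
      then have "ip g f = 0" by (rule linear_term_zero)
      then show ?thesis using True by simp
    qed (simp add: k_def)
    define q where "q = (\<lambda>x. p0 x + k * f x)"
    have qU: "q \<in> U" using Ulin p0 fU by (auto simp: q_def U0_def)
    have "ip (\<lambda>x. p x + (-1) * q x) u = 0" if uU: "u \<in> U" for u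
    proof -
      obtain b u0 where u: "u0 \<in> U0" "u = (\<lambda>x. u0 x + b * e x)" using red[OF uU] by blast
      define u1 where "u1 = (\<lambda>x. u0 x + b * es x)"
      have u1: "u1 \<in> U0" using u es U0 by (auto simp: u1_def)
      have u1D: "u1 \<in> D" using u1 U0 by blast
      have u': "u = (\<lambda>x. u1 x + b * f x)" by (auto simp: u u1_def f_def algebra_simps)
      have pq: "(\<lambda>x. p x + (-1) * q x) = (\<lambda>x. g x + (- k) * f x)" by (auto simp: g_def q_def algebra_simps)
      have hD: "(\<lambda>x. g x + (- k) * f x) \<in> D" using D gD fD by blast
      have a1: "ip w u = ip w u1 + b * ip w f" if "w \<in> D" for w
        using lin[OF u1D fD that, of b] sym[OF that] u1D fD D[OF u1D fD, of b] that unfolding u' by (metis sym)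
      show ?thesis unfolding pq a1[OF hD] lin[OF gD fD u1D] lin[OF gD fD fD]
        using f0[OF u1] p0(2)[OF u1] kf by (simp add: g_def)
    qed
    then show ?thesis using qU by blast
  qed
qed

section \<open>Polynomials in countably many coordinates\<close>

text \<open>Points have coordinates indexed by all natural numbers, so that the coordinate space
  does not depend on the rank; the eigenfunctions are padded with zeros.\<close>

inductive_set polyfun :: "((nat \<Rightarrow> real) \<Rightarrow> real) set" where
  const: "(\<lambda>_. c) \<in> polyfun"
| coord: "(\<lambda>\<xi>. \<xi> k) \<in> polyfun"
| add: "p \<in> polyfun \<Longrightarrow> q \<in> polyfun \<Longrightarrow> (\<lambda>\<xi>. p \<xi> + q \<xi>) \<in> polyfun"
| mult: "p \<in> polyfun \<Longrightarrow> q \<in> polyfun \<Longrightarrow> (\<lambda>\<xi>. p \<xi> * q \<xi>) \<in> polyfun"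

lemma polyfun_continuous: "p \<in> polyfun \<Longrightarrow> continuous_on S p"
  by (induction rule: polyfun.induct)
    (auto intro: continuous_intros continuous_on_subset[OF continuous_on_product_coordinates])

lemma polyfun_approx:
  assumes "compact K" "continuous_on K h" "e > 0"
  shows "\<exists>q\<in>polyfun. \<forall>\<xi>\<in>K. \<bar>h \<xi> - q \<xi>\<bar> < e"
proof -
  interpret function_ring_on polyfun K
  proof
    fix x y :: "nat \<Rightarrow> real" assume "x \<noteq> y"
    then obtain k where "x k \<noteq> y k" by auto
    then show "\<exists>f\<in>polyfun. f x \<noteq> f y" by (intro bexI[of _ "\<lambda>\<xi>. \<xi> k"] polyfun.coord)
  qed (auto intro: assms polyfun.intros polyfun_continuous)
  show ?thesis using Stone_Weierstrass_basic assms by blast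
qed

text \<open>Both laws live on one compact set, where polynomials approximate continuous functions
  uniformly; continuous functions in turn decrease to indicators of closed sets, which form an
  intersection-stable generator of the Borel sets.\<close>

lemma distr_eq_of_moments:
  fixes X Y :: "'a \<Rightarrow> nat \<Rightarrow> real"
  assumes M: "prob_space M" and X: "X \<in> borel_measurable M" and Y: "Y \<in> borel_measurable M"
    and K: "compact K" "\<And>x. x \<in> space M \<Longrightarrow> X x \<in> K" "\<And>x. x \<in> space M \<Longrightarrow> Y x \<in> K"
    and eq: "\<And>q. q \<in> polyfun \<Longrightarrow> (\<integral>x. q (X x) \<partial>M) = (\<integral>x. q (Y x) \<partial>M)"
  shows "distr M borel X = distr M borel Y"
proof -
  interpret prob_space M by fact
  note [measurable] = X Y
  have cont_eq: "(\<integral>x. h (X x) \<partial>M) = (\<integral>x. h (Y x) \<partial>M)" if h: "continuous_on UNIV h" for h :: "(nat \<Rightarrow> real) \<Rightarrow> real"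
  proof (rule ccontr)
    assume neq: "(\<integral>x. h (X x) \<partial>M) \<noteq> (\<integral>x. h (Y x) \<partial>M)"
    define d where "d = \<bar>(\<integral>x. h (X x) \<partial>M) - (\<integral>x. h (Y x) \<partial>M)\<bar>"
    have "d > 0" using neq by (simp add: d_def)
    have hK: "continuous_on K h" using h continuous_on_subset by blast
    obtain q where q: "q \<in> polyfun" "\<And>\<xi>. \<xi> \<in> K \<Longrightarrow> \<bar>h \<xi> - q \<xi>\<bar> < d / 3"
      using polyfun_approx[OF K(1) hK, of "d / 3"] \<open>d > 0\<close> by auto
    have int: "integrable M (\<lambda>x. g (Z x))" if g: "continuous_on UNIV g" and Z: "Z \<in> borel_measurable M" "\<And>x. x \<in> space M \<Longrightarrow> Z x \<in> K" for g :: "(nat \<Rightarrow> real) \<Rightarrow> real" and Z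
    proof -
      have "compact (g ` K)" by (rule compact_continuous_image[OF continuous_on_subset[OF g] K(1)]) simp
      then obtain B where "\<And>\<xi>. \<xi> \<in> K \<Longrightarrow> norm (g \<xi>) \<le> B"
        using compact_imp_bounded bounded_iff by (metis imageI)
      then show ?thesis using Z borel_measurable_continuous_onI[OF g]
        by (intro integrable_const_bound[where B = B]) (auto intro: measurable_compose)
    qed
    have close: "\<bar>(\<integral>x. h (Z x) \<partial>M) - (\<integral>x. q (Z x) \<partial>M)\<bar> \<le> d / 3" if Z: "Z \<in> borel_measurable M" "\<And>x. x \<in> space M \<Longrightarrow> Z x \<in> K" for Z
    proof -
      note ih = int[OF h Z] and iq = int[OF polyfun_continuous[OF q(1)] Z]
      have "\<bar>(\<integral>x. h (Z x) \<partial>M) - (\<integral>x. q (Z x) \<partial>M)\<bar> = \<bar>\<integral>x. h (Z x) - q (Z x) \<partial>M\<bar>"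
        using ih iq by simp
      also have "\<dots> \<le> (\<integral>x. \<bar>h (Z x) - q (Z x)\<bar> \<partial>M)" by (rule integral_abs_bound)
      also have "\<dots> \<le> (\<integral>x. d / 3 \<partial>M)"
        using ih iq Z q(2) by (intro integral_mono) (auto intro: less_imp_le)
      finally show ?thesis by (simp add: prob_space)
    qed
    have "\<bar>(\<integral>x. h (X x) \<partial>M) - (\<integral>x. q (X x) \<partial>M)\<bar> \<le> d / 3" "\<bar>(\<integral>x. h (Y x) \<partial>M) - (\<integral>x. q (Y x) \<partial>M)\<bar> \<le> d / 3"
      using X Y K(2,3) by (intro close; simp)+
    then show False using eq[OF q(1)] \<open>d > 0\<close> d_def by linarith
  qed
  have meas_eq: "emeasure M (X -` C \<inter> space M) = emeasure M (Y -` C \<inter> space M)" if C: "closed C" for C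
  \<comment> \<open>The empty set is set aside because the distance to it is 0 by
    convention.\<close>
  proof (cases "C = {}")
    case False
    \<comment> \<open>For positive \<open>n\<close> the function \<open>h n\<close> is 1 on
      \<open>C\<close> and 0 at distance at least \<open>1/n\<close> from it.\<close>
    define h where "h = (\<lambda>n \<xi>. max 0 (1 - real n * infdist \<xi> C))"
    have hc: "continuous_on UNIV (h n)" for n unfolding h_def by (intro continuous_intros)
    have lim: "(\<lambda>n. \<integral>x. h n (Z x) \<partial>M) \<longlonglongrightarrow> (\<integral>x. indicator C (Z x) \<partial>M)" if Z[measurable]: "Z \<in> borel_measurable M" for Z
    proof (rule integral_dominated_convergence[where w = "\<lambda>_. 1"])
      have [measurable]: "C \<in> sets borel" using C by simp
      show "(\<lambda>x. indicator C (Z x) :: real) \<in> borel_measurable M" by measurable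
      show "(\<lambda>x. h n (Z x)) \<in> borel_measurable M" for n
        using borel_measurable_continuous_onI[OF hc] Z measurable_compose by blast
      have "(\<lambda>n. h n \<xi>) \<longlonglongrightarrow> indicator C \<xi>" for \<xi>
      proof (cases "\<xi> \<in> C")
        case True
        then show ?thesis using C False by (simp add: h_def)
      next
        case False': False
        have pos: "infdist \<xi> C > 0" using C False False' infdist_pos_not_in_closed by blast
        obtain N :: nat where N: "1 / infdist \<xi> C < real N" using reals_Archimedean2 by blast
        have "h n \<xi> = 0" if "n \<ge> N" for n
        proof -
          have "1 / infdist \<xi> C < real n" using N that by (meson less_le_trans of_nat_mono)
          then show ?thesis using pos by (simp add: h_def field_simps)
        qed
        then show ?thesis using False' by (auto intro!: tendsto_eventually eventually_sequentiallyI[of N])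
      qed
      then show "AE x in M. (\<lambda>n. h n (Z x)) \<longlonglongrightarrow> indicator C (Z x)" by simp
      have "0 \<le> real n * infdist \<xi> C" for n \<xi> by (intro mult_nonneg_nonneg infdist_nonneg) auto
      then show "AE x in M. norm (h n (Z x)) \<le> 1" for n by (auto simp: h_def)
    qed auto
    have "(\<integral>x. indicator C (X x) \<partial>M) = (\<integral>x. indicator C (Y x) \<partial>M :: real)"
      using LIMSEQ_unique[OF lim[OF X]] lim[OF Y] cont_eq[OF hc] by simp
    moreover have "(\<integral>x. indicator C (Z x) \<partial>M) = measure M (Z -` C \<inter> space M)" for Z :: "'a \<Rightarrow> nat \<Rightarrow> real"
    proof -
      have "(\<lambda>x. indicator C (Z x)) = (indicator (Z -` C) :: 'a \<Rightarrow> real)" by (auto simp: indicator_def fun_eq_iff)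
      then show ?thesis by simp
    qed
    ultimately show ?thesis by (simp add: emeasure_eq_measure)
  qed simp
  show ?thesis
  proof (rule measure_eqI_generator_eq[where E = "Collect closed" and \<Omega> = UNIV and A = "\<lambda>_. UNIV"])
    show "Int_stable (Collect closed :: (nat \<Rightarrow> real) set set)" by (auto simp: Int_stable_def)
    show "emeasure (distr M borel X) C = emeasure (distr M borel Y) C" if "C \<in> Collect closed" for C
      using that meas_eq by (simp add: emeasure_distr)
    show "sets (distr M borel X) = sigma_sets UNIV (Collect closed)" 
      "sets (distr M borel Y) = sigma_sets UNIV (Collect closed)"
      by (simp_all add: borel_eq_closed)
  qed (auto simp: emeasure_distr)
qed

section \<open>Finite rank kernels and functions of several points\<close>

context prob_space
begin

definition bounded_meas :: "('a \<Rightarrow> real) set" where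
  "bounded_meas = {a \<in> borel_measurable M. \<exists>C. \<forall>x\<in>space M. \<bar>a x\<bar> \<le> C}"

lemma bounded_meas_meas[measurable_dest]: "a \<in> bounded_meas \<Longrightarrow> a \<in> borel_measurable M" by (simp add: bounded_meas_def)

lemma bounded_meas_integrable: assumes "a \<in> bounded_meas" shows "integrable M a"
proof -
  obtain C where "\<forall>x\<in>space M. \<bar>a x\<bar> \<le> C" using assms by (auto simp: bounded_meas_def)
  then show ?thesis using assms by (intro integrable_const_bound[where B = C]) (auto simp: bounded_meas_def)
qed

lemma bounded_meas_const: "(\<lambda>_. c) \<in> bounded_meas" by (auto simp: bounded_meas_def)

lemma bounded_meas_add: assumes "a \<in> bounded_meas" "b \<in> bounded_meas" shows "(\<lambda>x. a x + b x) \<in> bounded_meas"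
proof -
  obtain A B where "\<And>x. x \<in> space M \<Longrightarrow> \<bar>a x\<bar> \<le> A" "\<And>x. x \<in> space M \<Longrightarrow> \<bar>b x\<bar> \<le> B"
    using assms by (auto simp: bounded_meas_def)
  then have "\<forall>x\<in>space M. \<bar>a x + b x\<bar> \<le> A + B" by (meson abs_triangle_ineq add_mono order_trans)
  then show ?thesis using assms by (auto simp: bounded_meas_def)
qed

lemma bounded_meas_mult: assumes "a \<in> bounded_meas" "b \<in> bounded_meas" shows "(\<lambda>x. a x * b x) \<in> bounded_meas"
proof -
  obtain A B where AB: "\<And>x. x \<in> space M \<Longrightarrow> \<bar>a x\<bar> \<le> A" "\<And>x. x \<in> space M \<Longrightarrow> \<bar>b x\<bar> \<le> B"
    using assms by (auto simp: bounded_meas_def)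
  have "\<forall>x\<in>space M. \<bar>a x * b x\<bar> \<le> A * B"
  proof
    fix x assume "x \<in> space M"
    then show "\<bar>a x * b x\<bar> \<le> A * B" unfolding abs_mult using AB[of x] by (intro mult_mono) auto
  qed
  then show ?thesis using assms by (auto simp: bounded_meas_def)
qed

lemma bounded_meas_cmult: "a \<in> bounded_meas \<Longrightarrow> (\<lambda>x. c * a x) \<in> bounded_meas"
  by (rule bounded_meas_mult[OF bounded_meas_const])

lemma bounded_meas_lin: "a \<in> bounded_meas \<Longrightarrow> b \<in> bounded_meas \<Longrightarrow> (\<lambda>x. a x + c * b x) \<in> bounded_meas"
  by (intro bounded_meas_add bounded_meas_cmult)

lemma bounded_meas_sum: "(\<And>i. i \<in> A \<Longrightarrow> a i \<in> bounded_meas) \<Longrightarrow> (\<lambda>x. \<Sum>i\<in>A. a i x) \<in> bounded_meas"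
  by (induction A rule: infinite_finite_induct) (auto intro: bounded_meas_const bounded_meas_add)

end

text \<open>What remains of a pure graphon after passing to the coordinates given by its
  eigenfunctions: compactness of the image stands for completeness, injectivity for the metric
  separating points, and \<open>f_supp\<close> for full support. The metric itself no longer
  occurs.\<close>

locale finite_rank_kernel = prob_space M for M :: "'a measure" +
  fixes t :: nat and f :: "nat \<Rightarrow> 'a \<Rightarrow> real" and l :: "nat \<Rightarrow> real"
  assumes f_meas[measurable]: "f i \<in> borel_measurable M"
    and f_zero: "t \<le> i \<Longrightarrow> f i x = 0"
    and f_bdd: "\<exists>C. \<forall>i. \<forall>x\<in>space M. \<bar>f i x\<bar> \<le> C"
    and f_orth: "i < t \<Longrightarrow> j < t \<Longrightarrow> (\<integral>x. f i x * f j x \<partial>M) = (if i = j then 1 else 0)"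
    and l_nz: "i < t \<Longrightarrow> l i \<noteq> 0"
    and compact_image: "compact ((\<lambda>x i. f i x) ` space M)"
    and f_inj: "inj_on (\<lambda>x i. f i x) (space M)"
    and f_supp: "open U \<Longrightarrow> x \<in> space M \<Longrightarrow> (\<lambda>i. f i x) \<in> U \<Longrightarrow> measure M {y \<in> space M. (\<lambda>i. f i y) \<in> U} > 0"
begin

definition F :: "'a \<Rightarrow> nat \<Rightarrow> real" where "F x = (\<lambda>i. f i x)"

definition w :: "'a \<Rightarrow> 'a \<Rightarrow> real" where "w x y = (\<Sum>i<t. l i * f i x * f i y)"

text \<open>The algebra S in this model. Its members are functions on the whole type; restricting
  them to the space gives S, see \<open>eigenfunction_algebra_eq\<close>.\<close>

definition kernel_poly :: "('a \<Rightarrow> real) set" where "kernel_poly = {\<lambda>x. q (F x) | q. q \<in> polyfun}"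

lemma w_sym: "w x y = w y x"
  by (simp add: w_def mult_ac)

lemma f_bounded_meas: "f i \<in> bounded_meas"
  using f_bdd by (auto simp: bounded_meas_def)

lemma F_meas[measurable]: "F \<in> borel_measurable M"
  unfolding F_def by (intro measurable_coordinatewise_then_product) simp

lemma compact_F: "compact (F ` space M)"
  using compact_image by (simp add: F_def)

lemma inj_F: "inj_on F (space M)"
  using f_inj by (simp add: F_def[abs_def])

lemma supp_F: "open U \<Longrightarrow> x \<in> space M \<Longrightarrow> F x \<in> U \<Longrightarrow> measure M {y \<in> space M. F y \<in> U} > 0"
  using f_supp by (simp add: F_def)

lemma kernel_poly_bounded_meas: assumes "a \<in> kernel_poly" shows "a \<in> bounded_meas"
proof -
  obtain q where q: "q \<in> polyfun" "a = (\<lambda>x. q (F x))" using assms by (auto simp: kernel_poly_def)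
  from q(1) have "(\<lambda>x. q (F x)) \<in> bounded_meas"
    by induction (auto intro: bounded_meas_const bounded_meas_add bounded_meas_mult simp: F_def f_bounded_meas)
  then show ?thesis using q by simp
qed

lemma kernel_poly_const: "(\<lambda>_. c) \<in> kernel_poly"
  unfolding kernel_poly_def by (intro CollectI exI[of _ "\<lambda>_. c"]) (simp add: polyfun.const)
lemma kernel_poly_f: "f i \<in> kernel_poly" unfolding kernel_poly_def using polyfun.coord[of i] by (force simp: F_def)
lemma kernel_poly_add: "a \<in> kernel_poly \<Longrightarrow> b \<in> kernel_poly \<Longrightarrow> (\<lambda>x. a x + b x) \<in> kernel_poly"
  unfolding kernel_poly_def using polyfun.add by fastforce
lemma kernel_poly_mult: "a \<in> kernel_poly \<Longrightarrow> b \<in> kernel_poly \<Longrightarrow> (\<lambda>x. a x * b x) \<in> kernel_poly"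
  unfolding kernel_poly_def using polyfun.mult by fastforce

lemma kernel_poly_induct[consumes 1, case_names const f add mult]:
  assumes "a \<in> kernel_poly" "\<And>c. P (\<lambda>_. c)" "\<And>i. P (f i)"
    "\<And>a b. a \<in> kernel_poly \<Longrightarrow> b \<in> kernel_poly \<Longrightarrow> P a \<Longrightarrow> P b \<Longrightarrow> P (\<lambda>x. a x + b x)"
    "\<And>a b. a \<in> kernel_poly \<Longrightarrow> b \<in> kernel_poly \<Longrightarrow> P a \<Longrightarrow> P b \<Longrightarrow> P (\<lambda>x. a x * b x)"
  shows "P a"
proof -
  obtain q where q: "q \<in> polyfun" "a = (\<lambda>x. q (F x))" using assms(1) by (auto simp: kernel_poly_def)
  from q(1) have "P (\<lambda>x. q (F x))"
  proof induction
    case (coord k)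
    then show ?case using assms(3)[of k] by (simp add: F_def)
  next
    case (add p q)
    then show ?case by (intro assms(4)) (auto simp: kernel_poly_def)
  next
    case (mult p q)
    then show ?case by (intro assms(5)) (auto simp: kernel_poly_def)
  qed (rule assms(2))
  then show ?thesis using q by simp
qed

lemma kernel_poly_cmult: "a \<in> kernel_poly \<Longrightarrow> (\<lambda>x. c * a x) \<in> kernel_poly" by (rule kernel_poly_mult[OF kernel_poly_const])

lemma kernel_poly_sum: "(\<And>i. i \<in> A \<Longrightarrow> a i \<in> kernel_poly) \<Longrightarrow> (\<lambda>x. \<Sum>i\<in>A. a i x) \<in> kernel_poly"
  by (induction A rule: infinite_finite_induct) (auto intro: kernel_poly_const kernel_poly_add)

text \<open>A value different from 0 persists on an open set of coordinates, which has positive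
  measure by full support. This upgrades identities in S from almost everywhere to
  everywhere.\<close>

lemma kernel_poly_zero_AE:
  assumes "a \<in> kernel_poly" "AE x in M. a x = 0" "x \<in> space M"
  shows "a x = 0"
proof (rule ccontr)
  assume "a x \<noteq> 0"
  obtain q where q: "q \<in> polyfun" "a = (\<lambda>x. q (F x))" using assms(1) by (auto simp: kernel_poly_def)
  have "continuous_on UNIV q" using q polyfun_continuous by blast
  then have op: "open {\<xi>. q \<xi> \<noteq> 0}"
    by (intro open_Collect_neq) (auto intro: continuous_intros)
  have "measure M {y \<in> space M. F y \<in> {\<xi>. q \<xi> \<noteq> 0}} > 0"
    by (rule supp_F[OF op assms(3)]) (use \<open>a x \<noteq> 0\<close> q in auto)
  moreover have "measure M {y \<in> space M. F y \<in> {\<xi>. q \<xi> \<noteq> 0}} = 0"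
  proof -
    have [measurable]: "a \<in> borel_measurable M" using kernel_poly_bounded_meas[OF assms(1)] by (simp add: bounded_meas_def)
    have "{y \<in> space M. \<not> a y = 0} \<in> events" by measurable
    then have "emeasure M {y \<in> space M. \<not> a y = 0} = 0"
      using AE_iff_measurable[of "{y \<in> space M. \<not> a y = 0}" M "\<lambda>x. a x = 0"] assms(2) by simp
    then show ?thesis using q by (simp add: measure_def)
  qed
  ultimately show False by simp
qed

section \<open>Functions of several points, gluing and unlabeling\<close>

declare fun_upd_apply[simp del] fun_upd_same[simp] fun_upd_other[simp]

text \<open>An assignment \<open>\<eta>\<close> puts a point at every natural number, labeled or
  not. Integrating out node \<open>j\<close> unlabels it, and the result ignores
  \<open>\<eta> j\<close>.\<close>

definition integral_at :: "nat \<Rightarrow> ((nat \<Rightarrow> 'a) \<Rightarrow> real) \<Rightarrow> (nat \<Rightarrow> 'a) \<Rightarrow> real" where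
  "integral_at j P = (\<lambda>\<eta>. \<integral>y. P (\<eta>(j := y)) \<partial>M)"

definition indep_of :: "nat \<Rightarrow> ((nat \<Rightarrow> 'a) \<Rightarrow> real) \<Rightarrow> bool" where
  "indep_of j P \<longleftrightarrow> (\<forall>\<eta> y. P (\<eta>(j := y)) = P \<eta>)"

inductive_set point_poly :: "((nat \<Rightarrow> 'a) \<Rightarrow> real) set" where
  const: "(\<lambda>_. c) \<in> point_poly"
| f: "(\<lambda>\<eta>. f i (\<eta> j)) \<in> point_poly"
| add: "P \<in> point_poly \<Longrightarrow> Q \<in> point_poly \<Longrightarrow> (\<lambda>\<eta>. P \<eta> + Q \<eta>) \<in> point_poly"
| mult: "P \<in> point_poly \<Longrightarrow> Q \<in> point_poly \<Longrightarrow> (\<lambda>\<eta>. P \<eta> * Q \<eta>) \<in> point_poly"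

text \<open>The span of multigraph densities with arbitrary sets of labeled nodes.\<close>

inductive_set multi_dens :: "((nat \<Rightarrow> 'a) \<Rightarrow> real) set" where
  const: "(\<lambda>_. c) \<in> multi_dens"
| edge: "i \<noteq> j \<Longrightarrow> (\<lambda>\<eta>. w (\<eta> i) (\<eta> j)) \<in> multi_dens"
| add: "P \<in> multi_dens \<Longrightarrow> Q \<in> multi_dens \<Longrightarrow> (\<lambda>\<eta>. P \<eta> + Q \<eta>) \<in> multi_dens"
| mult: "P \<in> multi_dens \<Longrightarrow> Q \<in> multi_dens \<Longrightarrow> (\<lambda>\<eta>. P \<eta> * Q \<eta>) \<in> multi_dens"
| int: "P \<in> multi_dens \<Longrightarrow> integral_at j P \<in> multi_dens"

text \<open>Tensor form with respect to one node: every function in \<open>point_poly\<close> is a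
  finite sum of products in which node \<open>j\<close> sits in one factor alone. Integration over
  that node then replaces the factor by its mean, so \<open>point_poly\<close> is closed under
  unlabeling without appeal to Fubini's theorem.\<close>

inductive_set separated_at :: "nat \<Rightarrow> ((nat \<Rightarrow> 'a) \<Rightarrow> real) set" for j where
  prod: "a \<in> point_poly \<Longrightarrow> indep_of j a \<Longrightarrow> c \<in> kernel_poly \<Longrightarrow> (\<lambda>\<eta>. a \<eta> * c (\<eta> j)) \<in> separated_at j"
| add: "P \<in> separated_at j \<Longrightarrow> Q \<in> separated_at j \<Longrightarrow> (\<lambda>\<eta>. P \<eta> + Q \<eta>) \<in> separated_at j"

lemma point_poly_sum: "(\<And>i. i \<in> A \<Longrightarrow> a i \<in> point_poly) \<Longrightarrow> (\<lambda>x. \<Sum>i\<in>A. a i x) \<in> point_poly"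
  by (induction A rule: infinite_finite_induct) (auto intro: point_poly.intros)

lemma point_poly_prod: "(\<And>i. i \<in> A \<Longrightarrow> a i \<in> point_poly) \<Longrightarrow> (\<lambda>x. \<Prod>i\<in>A. a i x) \<in> point_poly"
  by (induction A rule: infinite_finite_induct) (auto intro: point_poly.intros)

lemma point_poly_w: "(\<lambda>\<eta>. w (\<eta> i) (\<eta> j)) \<in> point_poly"
  unfolding w_def by (intro point_poly_sum point_poly.mult point_poly.const point_poly.f)

lemma separated_at_mult:
  assumes "P \<in> separated_at j" "Q \<in> separated_at j" shows "(\<lambda>\<eta>. P \<eta> * Q \<eta>) \<in> separated_at j"
  using assms(1)
proof induction
  case (prod a c)
  note ac = prod
  from assms(2) show ?case
  proof induction
    case (prod b d)
    have "(\<lambda>\<eta>. (a \<eta> * b \<eta>) * (\<lambda>x. c x * d x) (\<eta> j)) \<in> separated_at j"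
      using ac prod by (intro separated_at.prod point_poly.mult kernel_poly_mult) (auto simp: indep_of_def)
    then show ?case by (simp add: mult_ac)
  next
    case (add P Q)
    then show ?case using separated_at.add by (auto simp: distrib_left)
  qed
next
  case (add P P')
  then show ?case using separated_at.add by (auto simp: distrib_right)
qed

lemma point_poly_separated_at: "P \<in> point_poly \<Longrightarrow> P \<in> separated_at j"
proof (induction rule: point_poly.induct)
  case (const c)
  show ?case using separated_at.prod[OF point_poly.const[of c] _ kernel_poly_const[of 1], of j] by (simp add: indep_of_def)
next
  case (f i k)
  show ?case
  proof (cases "k = j")
    case True
    then show ?thesis using separated_at.prod[OF point_poly.const[of 1] _ kernel_poly_f[of i], of j] by (simp add: indep_of_def)
  next
    case False
    then show ?thesis using separated_at.prod[OF point_poly.f[of i k] _ kernel_poly_const[of 1], of j] by (simp add: indep_of_def)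
  qed
qed (auto intro: separated_at.add separated_at_mult)

lemma separated_at_section: "P \<in> separated_at j \<Longrightarrow> (\<lambda>y. P (\<eta>(j := y))) \<in> bounded_meas"
proof (induction rule: separated_at.induct)
  case (prod a c)
  then show ?case using bounded_meas_cmult[OF kernel_poly_bounded_meas[OF prod(3)], of "a \<eta>"] by (simp add: indep_of_def)
qed (auto intro: bounded_meas_add)

lemma point_poly_section: "P \<in> point_poly \<Longrightarrow> (\<lambda>y. P (\<eta>(j := y))) \<in> bounded_meas"
  using point_poly_separated_at separated_at_section by blast

lemma integral_at_add: "P \<in> point_poly \<Longrightarrow> Q \<in> point_poly \<Longrightarrow> integral_at j (\<lambda>\<eta>. P \<eta> + Q \<eta>) = (\<lambda>\<eta>. integral_at j P \<eta> + integral_at j Q \<eta>)"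
  by (auto simp: integral_at_def point_poly_section bounded_meas_integrable)

lemma integral_at_cmult: "integral_at j (\<lambda>\<eta>. c * P \<eta>) = (\<lambda>\<eta>. c * integral_at j P \<eta>)"
  by (auto simp: integral_at_def)

lemma integral_at_indep_mult: "indep_of j P \<Longrightarrow> integral_at j (\<lambda>\<eta>. P \<eta> * Q \<eta>) = (\<lambda>\<eta>. P \<eta> * integral_at j Q \<eta>)"
  "indep_of j P \<Longrightarrow> integral_at j (\<lambda>\<eta>. Q \<eta> * P \<eta>) = (\<lambda>\<eta>. integral_at j Q \<eta> * P \<eta>)"
  by (auto simp: integral_at_def indep_of_def)

lemma integral_at_indep: "indep_of j P \<Longrightarrow> integral_at j P = P"
  by (auto simp: integral_at_def indep_of_def prob_space)

lemma point_poly_integral_at: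
  assumes "P \<in> point_poly" shows "integral_at j P \<in> point_poly"
proof -
  have "P \<in> separated_at j" using assms by (rule point_poly_separated_at)
  then show ?thesis
  proof induction
    case (prod a c)
    have "integral_at j (\<lambda>\<eta>. a \<eta> * c (\<eta> j)) = (\<lambda>\<eta>. a \<eta> * (\<integral>y. c y \<partial>M))"
      using prod by (auto simp: integral_at_def indep_of_def)
    then show ?case using prod by (auto intro: point_poly.intros)
  next
    case (add P Q)
    have "integral_at j (\<lambda>\<eta>. P \<eta> + Q \<eta>) = (\<lambda>\<eta>. integral_at j P \<eta> + integral_at j Q \<eta>)"
      using add by (auto simp: integral_at_def bounded_meas_integrable separated_at_section)
    then show ?case using add by (auto intro: point_poly.intros)
  qed
qed

lemma multi_dens_point_poly: "P \<in> multi_dens \<Longrightarrow> P \<in> point_poly"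
  by (induction rule: multi_dens.induct) (auto intro: point_poly.intros point_poly_integral_at point_poly_w)

text \<open>With all other nodes frozen, a function of several points becomes a continuous function
  on the compact image of \<open>F\<close>, which is how maxima, minima and closed zero sets are
  obtained later.\<close>

lemma point_poly_slice: "P \<in> point_poly \<Longrightarrow> \<exists>q\<in>polyfun. \<forall>x. P (\<eta>(n := x)) = q (F x)"
proof (induction rule: point_poly.induct)
  case (f i j)
  show ?case
  proof (cases "j = n")
    case True
    then show ?thesis by (intro bexI[OF _ polyfun.coord[of i]]) (simp add: F_def)
  next
    case False
    then show ?thesis by (intro bexI[OF _ polyfun.const[of "f i (\<eta> j)"]]) simp
  qed
next
  case (add P Q)
  then obtain p q where "p \<in> polyfun" "q \<in> polyfun" "\<forall>x. P (\<eta>(n := x)) = p (F x)" "\<forall>x. Q (\<eta>(n := x)) = q (F x)" by blast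
  then show ?case by (intro bexI[of _ "\<lambda>\<xi>. p \<xi> + q \<xi>"]) (auto intro: polyfun.intros)
next
  case (mult P Q)
  then obtain p q where "p \<in> polyfun" "q \<in> polyfun" "\<forall>x. P (\<eta>(n := x)) = p (F x)" "\<forall>x. Q (\<eta>(n := x)) = q (F x)" by blast
  then show ?case by (intro bexI[of _ "\<lambda>\<xi>. p \<xi> * q \<xi>"]) (auto intro: polyfun.intros)
qed (auto intro: polyfun.intros)

lemma point_poly_diag: "P \<in> point_poly \<Longrightarrow> (\<lambda>x. P (\<lambda>_. x)) \<in> kernel_poly"
  by (induction rule: point_poly.induct) (auto intro: kernel_poly_const kernel_poly_f kernel_poly_add kernel_poly_mult)

text \<open>Injectivity keeps the two ends of an edge distinct and keeps an integrated node apart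
  from the others.\<close>

lemma multi_dens_reindex: "P \<in> multi_dens \<Longrightarrow> inj \<sigma> \<Longrightarrow> (\<lambda>\<eta>. P (\<eta> \<circ> \<sigma>)) \<in> multi_dens"
proof (induction rule: multi_dens.induct)
  case (edge i j)
  then show ?case using multi_dens.edge[of "\<sigma> i" "\<sigma> j"] by (auto simp: inj_eq)
next
  case (int P j)
  have "(\<eta> \<circ> \<sigma>)(j := y) = (\<eta>(\<sigma> j := y)) \<circ> \<sigma>" for \<eta> :: "nat \<Rightarrow> 'a" and y
    using int.prems by (auto simp: fun_eq_iff inj_eq fun_upd_apply)
  then have eq: "(\<lambda>\<eta>. integral_at j P (\<eta> \<circ> \<sigma>)) = integral_at (\<sigma> j) (\<lambda>\<eta>. P (\<eta> \<circ> \<sigma>))" by (simp add: integral_at_def)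
  show ?case unfolding eq by (intro multi_dens.int int.IH int.prems)
qed (auto intro: multi_dens.intros)

lemma multi_dens_cmult: "P \<in> multi_dens \<Longrightarrow> (\<lambda>\<eta>. c * P \<eta>) \<in> multi_dens" by (intro multi_dens.mult multi_dens.const)

lemma multi_dens_sum: "(\<And>i. i \<in> A \<Longrightarrow> P i \<in> multi_dens) \<Longrightarrow> (\<lambda>\<eta>. \<Sum>i\<in>A. P i \<eta>) \<in> multi_dens"
  by (induction A rule: infinite_finite_induct) (auto intro: multi_dens.intros)

lemma multi_dens_power: "P \<in> multi_dens \<Longrightarrow> (\<lambda>\<eta>. P \<eta> ^ n) \<in> multi_dens"
  by (induction n) (auto intro: multi_dens.intros)

text \<open>The counterpart of A_1 with multigraphs in place of simple graphs; node 1 is the labeled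
  one. That nothing is gained by multiple edges is
  \<open>density_algebra_one_label_dens\<close>.\<close>

definition density_algebra :: "('a \<Rightarrow> real) set" where "density_algebra = {a. (\<lambda>\<eta>. a (\<eta> 1)) \<in> multi_dens}"

lemma density_algebra_const: "(\<lambda>_. c) \<in> density_algebra" by (simp add: density_algebra_def multi_dens.const)
lemma density_algebra_add: "a \<in> density_algebra \<Longrightarrow> b \<in> density_algebra \<Longrightarrow> (\<lambda>x. a x + b x) \<in> density_algebra" by (simp add: density_algebra_def multi_dens.add)
lemma density_algebra_mult: "a \<in> density_algebra \<Longrightarrow> b \<in> density_algebra \<Longrightarrow> (\<lambda>x. a x * b x) \<in> density_algebra" by (simp add: density_algebra_def multi_dens.mult)
lemma density_algebra_lin: "a \<in> density_algebra \<Longrightarrow> b \<in> density_algebra \<Longrightarrow> (\<lambda>x. a x + c * b x) \<in> density_algebra"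
  by (intro density_algebra_add density_algebra_mult density_algebra_const)

lemma density_algebra_at: assumes "a \<in> density_algebra" shows "(\<lambda>\<eta>. a (\<eta> j)) \<in> multi_dens"
proof -
  have "(\<lambda>\<eta>. a ((\<eta> \<circ> Transposition.transpose 1 j) 1)) \<in> multi_dens"
    using assms by (intro multi_dens_reindex) (auto simp: density_algebra_def)
  then show ?thesis by (simp add: o_def)
qed

text \<open>In graph terms, \<open>a\<close> is glued onto node 2 of the two-labeled graph and node
  2 is then unlabeled.\<close>

lemma density_algebra_kernel:
  assumes "(\<lambda>\<eta>. H (\<eta> 1) (\<eta> 2)) \<in> multi_dens" "a \<in> density_algebra"
  shows "(\<lambda>x. \<integral>y. H x y * a y \<partial>M) \<in> density_algebra"
proof -
  have "integral_at 2 (\<lambda>\<eta>. H (\<eta> 1) (\<eta> 2) * a (\<eta> 2)) \<in> multi_dens"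
    using assms by (intro multi_dens.int multi_dens.mult density_algebra_at)
  then show ?thesis by (simp add: integral_at_def density_algebra_def)
qed

lemma density_algebra_kernel_poly: assumes "a \<in> density_algebra" shows "a \<in> kernel_poly"
  using point_poly_diag[OF multi_dens_point_poly[OF assms[unfolded density_algebra_def, simplified]]] by simp

text \<open>The pairs of coordinate vectors told apart by one density form an open set. By
  Lindelof's theorem countably many of these sets have the same union as all of them.\<close>

lemma density_algebra_countable_separation:
  obtains \<sigma> :: "nat \<Rightarrow> 'a \<Rightarrow> real" where "\<And>n. \<sigma> n \<in> density_algebra"
    "\<And>x y. (\<And>n. \<sigma> n x = \<sigma> n y) \<Longrightarrow> \<forall>a\<in>density_algebra. a x = a y"
proof -
  have "\<forall>a\<in>density_algebra. \<exists>p. p \<in> polyfun \<and> a = (\<lambda>x. p (F x))" using density_algebra_kernel_poly by (auto simp: kernel_poly_def)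
  then obtain p where p: "\<And>a. a \<in> density_algebra \<Longrightarrow> p a \<in> polyfun" "\<And>a. a \<in> density_algebra \<Longrightarrow> a = (\<lambda>x. p a (F x))"
    by metis
  define W where "W = (\<lambda>a. {z :: (nat \<Rightarrow> real) \<times> (nat \<Rightarrow> real). p a (fst z) \<noteq> p a (snd z)})"
  have W: "open (W a)" if "a \<in> density_algebra" for a
    unfolding W_def
    by (intro open_Collect_neq continuous_on_compose2[OF polyfun_continuous[OF p(1)[OF that], of UNIV]] continuous_intros) auto
  obtain \<F> where \<F>: "\<F> \<subseteq> W ` density_algebra" "countable \<F>" "\<Union>\<F> = \<Union>(W ` density_algebra)"
    using Lindelof[of "W ` density_algebra"] W by (metis (no_types, lifting) imageE)
  then obtain B where B: "countable B" "B \<subseteq> density_algebra" "\<F> = W ` B"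
    using countable_subset_image[of \<F> W density_algebra] by auto
  \<comment> \<open>The zero function separates nothing, but makes the family nonempty so that it
    can be enumerated.\<close>
  define B' where "B' = insert (\<lambda>_. 0) B"
  have B': "countable B'" "B' \<noteq> {}" "B' \<subseteq> density_algebra" using B density_algebra_const by (auto simp: B'_def)
  define \<sigma> where "\<sigma> = from_nat_into B'"
  show thesis
  proof (rule that[of \<sigma>])
    show "\<sigma> n \<in> density_algebra" for n using B' from_nat_into[of B' n] by (auto simp: \<sigma>_def)
    fix x y assume eq: "\<And>n. \<sigma> n x = \<sigma> n y"
    have eqB: "b x = b y" if "b \<in> B" for b
    proof -
      have "b \<in> B'" using that by (simp add: B'_def)
      then obtain n where "\<sigma> n = b" using B'(1) from_nat_into_surj unfolding \<sigma>_def by metis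
      then show ?thesis using eq by auto
    qed
    show "\<forall>a\<in>density_algebra. a x = a y"
    proof (rule ballI, rule ccontr)
      fix a assume a: "a \<in> density_algebra" "a x \<noteq> a y"
      then have "(F x, F y) \<in> W a" using fun_cong[OF p(2)[OF a(1)]] by (simp add: W_def)
      then obtain b where b: "b \<in> B" "(F x, F y) \<in> W b" using a(1) \<F>(3) B(3) by auto
      then have "b x \<noteq> b y" using fun_cong[OF p(2)[of b]] B by (auto simp: W_def)
      then show False using eqB b by blast
    qed
  qed
qed

text \<open>The space is collapsed along the fibres on which all densities agree; the quotient is
  realised as the compact image \<open>K\<close> under a countable separating family. A function
  constant on fibres descends to \<open>K\<close>, where the densities separate points and
  Stone-Weierstrass applies.\<close>

lemma density_algebra_dense:
  assumes h: "h \<in> kernel_poly" and const: "\<And>x y. x \<in> space M \<Longrightarrow> y \<in> space M \<Longrightarrow> (\<forall>a\<in>density_algebra. a x = a y) \<Longrightarrow> h x = h y"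
    and e: "e > 0"
  shows "\<exists>a\<in>density_algebra. \<forall>x\<in>space M. \<bar>h x - a x\<bar> < e"
proof -
  obtain q where q: "q \<in> polyfun" "h = (\<lambda>x. q (F x))" using h by (auto simp: kernel_poly_def)
  obtain \<sigma> :: "nat \<Rightarrow> 'a \<Rightarrow> real" where \<sigma>: "\<And>n. \<sigma> n \<in> density_algebra"
    and sep: "\<And>x y. (\<And>n. \<sigma> n x = \<sigma> n y) \<Longrightarrow> \<forall>a\<in>density_algebra. a x = a y"
    using density_algebra_countable_separation by blast
  define \<tau> where "\<tau> = (\<lambda>x n. \<sigma> n x)"
  define X where "X = F ` space M"
  define G where "G = the_inv_into (space M) F"
  have G: "G (F x) = x" if "x \<in> space M" for x using that inj_F by (simp add: G_def the_inv_into_f_f)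
  define T where "T = (\<lambda>\<xi>. \<tau> (G \<xi>))"
  have Tc: "continuous_on X T"
  proof (rule continuous_on_coordinatewise_then_product)
    fix n
    obtain p where p: "p \<in> polyfun" "\<sigma> n = (\<lambda>x. p (F x))" using density_algebra_kernel_poly[OF \<sigma>, of n] by (auto simp: kernel_poly_def)
    have "continuous_on X p" using p polyfun_continuous by blast
    then show "continuous_on X (\<lambda>\<xi>. T \<xi> n)"
      by (rule continuous_on_eq) (use p G in \<open>auto simp: T_def \<tau>_def X_def\<close>)
  qed
  have X: "compact X" using compact_F by (simp add: X_def)
  define K where "K = T ` X"
  have K: "compact K" unfolding K_def by (rule compact_continuous_image[OF Tc X])
  have KJ: "K = \<tau> ` space M" using G by (force simp: K_def T_def X_def)
  define hh where "hh = (\<lambda>\<kappa>. h (SOME x. x \<in> space M \<and> \<tau> x = \<kappa>))"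
  have hh: "hh (\<tau> x) = h x" if "x \<in> space M" for x
  proof -
    define y where "y = (SOME z. z \<in> space M \<and> \<tau> z = \<tau> x)"
    have y: "y \<in> space M \<and> \<tau> y = \<tau> x" unfolding y_def by (rule someI[of _ x]) (use that in auto)
    have "\<tau> y = \<tau> x" using y by simp
    then have "\<forall>a\<in>density_algebra. a y = a x" by (intro sep) (metis \<tau>_def)
    then have "h y = h x" using const y that by blast
    then show ?thesis by (simp add: hh_def y_def)
  qed
  \<comment> \<open>The usual argument for a continuous map from a compact space to a Hausdorff
    space: preimages of closed sets under \<open>hh\<close> are images under \<open>T\<close> of
    compact sets, hence closed.\<close>
  have hhc: "continuous_on K hh"
    unfolding continuous_on_closed_vimage[OF compact_imp_closed[OF K]]
  proof (intro allI impI)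
    fix B :: "real set" assume "closed B"
    have "hh -` B \<inter> K = \<tau> ` {x \<in> space M. h x \<in> B}" using hh by (auto simp: KJ)
    moreover have "T ` (X \<inter> q -` B) = \<tau> ` {x \<in> space M. h x \<in> B}"
    proof -
      have "X \<inter> q -` B = F ` {x \<in> space M. h x \<in> B}" using q by (auto simp: X_def)
      then show ?thesis using G by (auto simp: T_def image_image intro!: image_cong)
    qed
    ultimately have "hh -` B \<inter> K = T ` (X \<inter> q -` B)" by simp
    moreover have "compact (X \<inter> q -` B)"
      using \<open>closed B\<close> X q(1) by (intro compact_Int_closed closed_vimage polyfun_continuous)
    ultimately have "compact (hh -` B \<inter> K)"
      using compact_continuous_image[OF continuous_on_subset[OF Tc]] by (metis inf_le1)
    then show "closed (hh -` B \<inter> K)" by (rule compact_imp_closed)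
  qed
  define RR where "RR = {g. continuous_on K g \<and> (\<exists>a\<in>density_algebra. \<forall>x\<in>space M. g (\<tau> x) = a x)}"
  interpret SW: function_ring_on RR K
  proof
    show "(\<lambda>x. g x + g' x) \<in> RR" if "g \<in> RR" "g' \<in> RR" for g g'
    proof -
      from that obtain a b where ab: "a \<in> density_algebra" "b \<in> density_algebra" "\<forall>x\<in>space M. g (\<tau> x) = a x" "\<forall>x\<in>space M. g' (\<tau> x) = b x" by (auto simp: RR_def)
      then show ?thesis using that density_algebra_add[OF ab(1,2)] by (auto simp: RR_def intro!: continuous_intros bexI[of _ "\<lambda>x. a x + b x"])
    qed
    show "(\<lambda>x. g x * g' x) \<in> RR" if "g \<in> RR" "g' \<in> RR" for g g'
    proof -
      from that obtain a b where ab: "a \<in> density_algebra" "b \<in> density_algebra" "\<forall>x\<in>space M. g (\<tau> x) = a x" "\<forall>x\<in>space M. g' (\<tau> x) = b x" by (auto simp: RR_def)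
      then show ?thesis using that density_algebra_mult[OF ab(1,2)] by (auto simp: RR_def intro!: continuous_intros bexI[of _ "\<lambda>x. a x * b x"])
    qed
    show "(\<lambda>_. c) \<in> RR" for c using density_algebra_const[of c] by (auto simp: RR_def intro!: bexI[of _ "\<lambda>_. c"])
    show "\<exists>g\<in>RR. g \<kappa> \<noteq> g \<kappa>'" if \<kappa>: "\<kappa> \<in> K" "\<kappa>' \<in> K" "\<kappa> \<noteq> \<kappa>'" for \<kappa> \<kappa>'
    proof -
      obtain x y where xy: "\<kappa> = \<tau> x" "\<kappa>' = \<tau> y" "x \<in> space M" "y \<in> space M" using \<kappa> KJ by auto
      then obtain n where n: "\<tau> x n \<noteq> \<tau> y n" using \<kappa> by auto
      have "(\<lambda>\<kappa>. \<kappa> n) \<in> RR"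
        using \<sigma>[of n] by (auto simp: RR_def \<tau>_def intro!: bexI[of _ "\<sigma> n"] continuous_on_subset[OF continuous_on_product_coordinates])
      then show ?thesis using n xy by (intro bexI[of _ "\<lambda>\<kappa>. \<kappa> n"]) simp_all
    qed
  qed (auto simp: K RR_def)
  obtain g where g: "g \<in> RR" "\<And>\<kappa>. \<kappa> \<in> K \<Longrightarrow> \<bar>hh \<kappa> - g \<kappa>\<bar> < e"
    using SW.Stone_Weierstrass_basic[OF hhc e] by blast
  then obtain a where a: "a \<in> density_algebra" "\<And>x. x \<in> space M \<Longrightarrow> g (\<tau> x) = a x" by (auto simp: RR_def)
  have "\<bar>h x - a x\<bar> < e" if "x \<in> space M" for x
    using g(2)[of "\<tau> x"] that KJ hh[OF that] a(2)[OF that] by auto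
  then show ?thesis using a by blast
qed

end

section \<open>From density to equality\<close>

lemma zero_list_span: "(\<lambda>_. 0) \<in> list_span \<phi>s"
  by (induction \<phi>s) (auto intro!: exI[of _ "0::real"])

lemma list_span_add: "u \<in> list_span \<phi>s \<Longrightarrow> v \<in> list_span \<phi>s \<Longrightarrow> (\<lambda>x. u x + v x) \<in> list_span \<phi>s"
  using list_span_lin[of u \<phi>s v 1] by simp

lemma list_span_cmult: "u \<in> list_span \<phi>s \<Longrightarrow> (\<lambda>x. c * u x) \<in> list_span \<phi>s"
  using list_span_lin[OF zero_list_span, of u \<phi>s c] by simp

lemma list_span_append1: "u \<in> list_span \<phi>s \<Longrightarrow> u \<in> list_span (\<phi>s @ \<psi>s)"
proof (induction \<phi>s arbitrary: u)
  case (Cons \<phi> \<phi>s)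
  then show ?case by auto
qed (simp add: zero_list_span)

lemma list_span_Cons2: "u \<in> list_span \<phi>s \<Longrightarrow> u \<in> list_span (\<phi> # \<phi>s)"
  by (auto intro!: exI[of _ "0::real"])

lemma list_span_append2: "u \<in> list_span \<psi>s \<Longrightarrow> u \<in> list_span (\<phi>s @ \<psi>s)"
  by (induction \<phi>s) (simp, metis append_Cons list_span_Cons2)

lemma list_span_member: "\<phi> \<in> set \<phi>s \<Longrightarrow> \<phi> \<in> list_span \<phi>s"
proof (induction \<phi>s)
  case (Cons \<psi> \<phi>s)
  show ?case
  proof (cases "\<phi> = \<psi>")
    case True
    then show ?thesis using zero_list_span[of \<phi>s] by (auto intro!: exI[of _ "1::real"] exI[of _ "\<lambda>_. 0::real"])
  next
    case False
    then show ?thesis using Cons list_span_Cons2 by auto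
  qed
qed simp

lemma list_span_sum: "(\<lambda>x. \<Sum>\<phi>\<leftarrow>\<phi>s. \<phi> x * d \<phi>) \<in> list_span \<phi>s"
proof (induction \<phi>s)
  case (Cons \<phi> \<phi>s)
  then show ?case by (auto simp: mult.commute intro!: exI[of _ "d \<phi>"] exI[of _ "\<lambda>x. \<Sum>\<phi>\<leftarrow>\<phi>s. \<phi> x * d \<phi>"])
qed simp

text \<open>All pairwise products. They generate the products of the two spans, and the positive
  kernel belonging to this list is the pointwise (Schur) product of the two kernels.\<close>

definition product_list :: "('a \<Rightarrow> real) list \<Rightarrow> ('a \<Rightarrow> real) list \<Rightarrow> ('a \<Rightarrow> real) list" where
  "product_list \<phi>s \<psi>s = concat (map (\<lambda>\<phi>. map (\<lambda>\<psi> x. \<phi> x * \<psi> x) \<psi>s) \<phi>s)"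

lemma list_span_map_times: "v \<in> list_span \<psi>s \<Longrightarrow> (\<lambda>x. \<phi> x * v x) \<in> list_span (map (\<lambda>\<psi> x. \<phi> x * \<psi> x) \<psi>s)"
proof (induction \<psi>s arbitrary: v)
  case (Cons \<psi> \<psi>s)
  then obtain c u where "v = (\<lambda>x. c * \<psi> x + u x)" "u \<in> list_span \<psi>s" by auto
  then show ?case using Cons.IH[of u]
    by (auto simp: algebra_simps intro!: exI[of _ c] exI[of _ "\<lambda>x. \<phi> x * u x"])
qed simp

lemma list_span_product:
  assumes "v \<in> list_span \<psi>s"
  shows "u \<in> list_span \<phi>s \<Longrightarrow> (\<lambda>x. u x * v x) \<in> list_span (product_list \<phi>s \<psi>s)"
proof (induction \<phi>s arbitrary: u)
  case Nil
  then show ?case by (simp add: product_list_def)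
next
  case (Cons \<phi> \<phi>s)
  then obtain c u' where u: "u = (\<lambda>x. c * \<phi> x + u' x)" "u' \<in> list_span \<phi>s" by auto
  have "(\<lambda>x. c * (\<phi> x * v x)) \<in> list_span (product_list (\<phi> # \<phi>s) \<psi>s)"
    using list_span_append1[OF list_span_cmult[OF list_span_map_times[OF assms]]] by (simp add: product_list_def)
  moreover have "(\<lambda>x. u' x * v x) \<in> list_span (product_list (\<phi> # \<phi>s) \<psi>s)"
    using list_span_append2[OF Cons.IH[OF u(2)]] by (simp add: product_list_def)
  ultimately have "(\<lambda>x. c * (\<phi> x * v x) + u' x * v x) \<in> list_span (product_list (\<phi> # \<phi>s) \<psi>s)"
    by (rule list_span_add)
  then show ?case by (simp add: u algebra_simps)
qed

lemma sum_product_list: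
  "(\<Sum>\<theta>\<leftarrow>product_list \<phi>s \<psi>s. \<theta> x * \<theta> y) = (\<Sum>\<phi>\<leftarrow>\<phi>s. \<phi> x * \<phi> y) * (\<Sum>\<psi>\<leftarrow>\<psi>s. \<psi> x * \<psi> y)"
proof (induction \<phi>s)
  case (Cons \<phi> \<phi>s)
  have "(\<Sum>\<theta>\<leftarrow>map (\<lambda>\<psi> x. \<phi> x * \<psi> x) \<psi>s. \<theta> x * \<theta> y) = (\<phi> x * \<phi> y) * (\<Sum>\<psi>\<leftarrow>\<psi>s. \<psi> x * \<psi> y)"
    by (induction \<psi>s) (auto simp: algebra_simps)
  then show ?case using Cons by (simp add: product_list_def algebra_simps)
qed (simp add: product_list_def)

section \<open>Automorphisms of the kernel and positive kernels made of densities\<close>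

context finite_rank_kernel
begin

text \<open>Invariance is required here at every pair of points. The agreement with automorphisms
  defined by almost all \<open>y\<close> is \<open>kernel_aut_eq\<close>.\<close>

definition kernel_aut :: "('a \<Rightarrow> 'a) set" where
  "kernel_aut = {g. bij_betw g (space M) (space M) \<and> g \<in> measurable M M \<and> distr M M g = M \<and>
     (\<forall>x\<in>space M. \<forall>y\<in>space M. w (g x) (g y) = w x y)}"

lemma kernel_aut_integral:
  assumes "g \<in> kernel_aut" "a \<in> bounded_meas" shows "(\<integral>x. a (g x) \<partial>M) = (\<integral>x. a x \<partial>M)"
proof -
  have "(\<integral>x. a x \<partial>distr M M g) = (\<integral>x. a (g x) \<partial>M)"
    using assms by (intro integral_distr) (auto simp: kernel_aut_def bounded_meas_def)
  then show ?thesis using assms by (simp add: kernel_aut_def)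
qed

text \<open>Since \<open>g\<close> preserves the measure, \<open>g y\<close> may be substituted for
  the point at each unlabeled node. Every node must carry a point of the space, as \<open>g\<close>
  is controlled only there.\<close>

lemma multi_dens_invariant:
  assumes "P \<in> multi_dens" "g \<in> kernel_aut" "\<And>i. \<eta> i \<in> space M"
  shows "P (g \<circ> \<eta>) = P \<eta>"
  using assms(1,3)
proof (induction arbitrary: \<eta> rule: multi_dens.induct)
  case (edge i j)
  then show ?case using assms(2) by (simp add: kernel_aut_def)
next
  case (int P j)
  have "integral_at j P (g \<circ> \<eta>) = (\<integral>y. P ((g \<circ> \<eta>)(j := g y)) \<partial>M)"
    unfolding integral_at_def using kernel_aut_integral[OF assms(2) point_poly_section[OF multi_dens_point_poly[OF int.hyps]]] by simp
  also have "\<dots> = (\<integral>y. P (\<eta>(j := y)) \<partial>M)"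
  proof (rule Bochner_Integration.integral_cong[OF refl])
    fix y assume "y \<in> space M"
    then have "P (g \<circ> \<eta>(j := y)) = P (\<eta>(j := y))"
      using int.prems by (intro int.IH) (auto simp: fun_upd_apply)
    moreover have "(g \<circ> \<eta>)(j := g y) = g \<circ> \<eta>(j := y)" by (auto simp: fun_eq_iff fun_upd_apply)
    ultimately show "P ((g \<circ> \<eta>)(j := g y)) = P (\<eta>(j := y))" by simp
  qed
  finally show ?case by (simp only: integral_at_def)
qed auto

text \<open>A path of two edges squares the eigenvalues; unlike \<open>w\<close> it is therefore a
  positive kernel in all cases.\<close>

lemma w_conv: "(\<integral>z. w x z * w z y \<partial>M) = (\<Sum>i<t. (l i)\<^sup>2 * f i x * f i y)"
proof -
  have "(\<integral>z. w x z * w z y \<partial>M) = (\<integral>z. (\<Sum>i<t. \<Sum>j<t. (l i * l j * f i x * f j y) * (f i z * f j z)) \<partial>M)"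
    by (simp add: w_def sum_product mult_ac)
  also have "\<dots> = (\<Sum>i<t. \<Sum>j<t. (l i * l j * f i x * f j y) * (\<integral>z. f i z * f j z \<partial>M))"
    by (simp add: bounded_meas_integrable bounded_meas_mult f_bounded_meas)
  also have "\<dots> = (\<Sum>i<t. (l i)\<^sup>2 * f i x * f i y)"
    by (intro sum.cong refl)
      (simp add: f_orth if_distrib[of "\<lambda>x. _ * x"] sum.delta power2_eq_square cong: if_cong)
  finally show ?thesis .
qed

text \<open>Induction on the polynomial: a coordinate comes from the two-edge path, sums concatenate
  the lists of functions, and products use Schur products. Only membership of \<open>p\<close> in
  the span is demanded, so that the eigenfunctions may enter all together and no individual one has
  to be a density.\<close>

lemma positive_kernel_spanning:
  assumes "p \<in> kernel_poly"
  shows "\<exists>H \<phi>s. (\<lambda>\<eta>. H (\<eta> 1) (\<eta> 2)) \<in> multi_dens \<and> (\<forall>x y. H x y = (\<Sum>\<phi>\<leftarrow>\<phi>s. \<phi> x * \<phi> y)) \<and>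
     set \<phi>s \<subseteq> kernel_poly \<and> p \<in> list_span \<phi>s"
  using assms
proof (induction rule: kernel_poly_induct)
  case (const c)
  show ?case
    by (rule exI[of _ "\<lambda>_ _. 1"], rule exI[of _ "[\<lambda>_. 1]"]) (auto intro: multi_dens.const kernel_poly_const)
next
  case (f k)
  show ?case
  proof (cases "k < t")
    case True
    \<comment> \<open>The factor \<open>l i\<close> in each function turns the sum of squares into
      the weights of the two-edge path.\<close>
    define \<phi>s where "\<phi>s = map (\<lambda>i x. l i * f i x) [0..<t]"
    define H where "H = (\<lambda>x y. \<integral>z. w x z * w z y \<partial>M)"
    have "integral_at 3 (\<lambda>\<eta>. w (\<eta> 1) (\<eta> 3) * w (\<eta> 3) (\<eta> 2)) \<in> multi_dens"
      by (intro multi_dens.int multi_dens.mult multi_dens.edge) auto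
    then have "(\<lambda>\<eta>. H (\<eta> 1) (\<eta> 2)) \<in> multi_dens" by (simp add: integral_at_def H_def)
    moreover have "H x y = (\<Sum>\<phi>\<leftarrow>\<phi>s. \<phi> x * \<phi> y)" for x y
      by (simp add: H_def w_conv \<phi>s_def o_def interv_sum_list_conv_sum_set_nat atLeast0LessThan power2_eq_square mult_ac)
    moreover have "set \<phi>s \<subseteq> kernel_poly" by (auto simp: \<phi>s_def intro: kernel_poly_cmult kernel_poly_f)
    moreover have "f k \<in> list_span \<phi>s"
    proof -
      have "(\<lambda>x. l k * f k x) \<in> list_span \<phi>s"
        using True by (intro list_span_member) (auto simp: \<phi>s_def)
      then have "(\<lambda>x. (1 / l k) * (l k * f k x)) \<in> list_span \<phi>s" by (rule list_span_cmult)
      then show ?thesis using l_nz[OF True] by simp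
    qed
    ultimately show ?thesis by blast
  next
    case False
    then have "f k = (\<lambda>_. 0)" using f_zero by auto
    then show ?thesis
      by (intro exI[of _ "\<lambda>_ _. 0"] exI[of _ "[]"]) (auto intro: multi_dens.const)
  qed
next
  case (add a b)
  from add.IH(1) obtain H \<phi>s where H: "(\<lambda>\<eta>. H (\<eta> 1) (\<eta> 2)) \<in> multi_dens" "\<And>x y. H x y = (\<Sum>\<phi>\<leftarrow>\<phi>s. \<phi> x * \<phi> y)" "set \<phi>s \<subseteq> kernel_poly" "a \<in> list_span \<phi>s"
    by blast
  from add.IH(2) obtain H' \<psi>s where H': "(\<lambda>\<eta>. H' (\<eta> 1) (\<eta> 2)) \<in> multi_dens" "\<And>x y. H' x y = (\<Sum>\<phi>\<leftarrow>\<psi>s. \<phi> x * \<phi> y)" "set \<psi>s \<subseteq> kernel_poly" "b \<in> list_span \<psi>s"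
    by blast
  show ?case
    by (rule exI[of _ "\<lambda>x y. H x y + H' x y"], rule exI[of _ "\<phi>s @ \<psi>s"])
      (use H H' in \<open>auto intro: multi_dens.add list_span_add list_span_append1 list_span_append2\<close>)
next
  case (mult a b)
  from mult.IH(1) obtain H \<phi>s where H: "(\<lambda>\<eta>. H (\<eta> 1) (\<eta> 2)) \<in> multi_dens" "\<And>x y. H x y = (\<Sum>\<phi>\<leftarrow>\<phi>s. \<phi> x * \<phi> y)" "set \<phi>s \<subseteq> kernel_poly" "a \<in> list_span \<phi>s"
    by blast
  from mult.IH(2) obtain H' \<psi>s where H': "(\<lambda>\<eta>. H' (\<eta> 1) (\<eta> 2)) \<in> multi_dens" "\<And>x y. H' x y = (\<Sum>\<phi>\<leftarrow>\<psi>s. \<phi> x * \<phi> y)" "set \<psi>s \<subseteq> kernel_poly" "b \<in> list_span \<psi>s"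
    by blast
  show ?case
  proof (intro exI conjI allI)
    show "(\<lambda>\<eta>. H (\<eta> 1) (\<eta> 2) * H' (\<eta> 1) (\<eta> 2)) \<in> multi_dens" using H H' by (intro multi_dens.mult)
    show "H x y * H' x y = (\<Sum>\<theta>\<leftarrow>product_list \<phi>s \<psi>s. \<theta> x * \<theta> y)" for x y
      by (simp add: H(2) H'(2) sum_product_list)
    show "set (product_list \<phi>s \<psi>s) \<subseteq> kernel_poly"
      using H(3) H'(3) by (auto simp: product_list_def intro: kernel_poly_mult)
    show "(\<lambda>x. a x * b x) \<in> list_span (product_list \<phi>s \<psi>s)"
      using H H' by (intro list_span_product)
  qed
qed

lemma list_span_kernel_poly: "set \<phi>s \<subseteq> kernel_poly \<Longrightarrow> u \<in> list_span \<phi>s \<Longrightarrow> u \<in> kernel_poly"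
  by (induction \<phi>s arbitrary: u) (auto intro!: kernel_poly_const kernel_poly_add kernel_poly_cmult)

lemma list_sum_integral:
  assumes "set \<phi>s \<subseteq> bounded_meas" "a \<in> bounded_meas"
  shows "(\<lambda>y. (\<Sum>\<phi>\<leftarrow>\<phi>s. \<phi> y * d \<phi>) * a y) \<in> bounded_meas"
    and "(\<integral>y. (\<Sum>\<phi>\<leftarrow>\<phi>s. \<phi> y * d \<phi>) * a y \<partial>M) = (\<Sum>\<phi>\<leftarrow>\<phi>s. d \<phi> * (\<integral>y. \<phi> y * a y \<partial>M))"
proof -
  have "(\<lambda>y. (\<Sum>\<phi>\<leftarrow>\<phi>s. \<phi> y * d \<phi>) * a y) \<in> bounded_meas \<and>
    (\<integral>y. (\<Sum>\<phi>\<leftarrow>\<phi>s. \<phi> y * d \<phi>) * a y \<partial>M) = (\<Sum>\<phi>\<leftarrow>\<phi>s. d \<phi> * (\<integral>y. \<phi> y * a y \<partial>M))"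
    using assms(1)
  proof (induction \<phi>s)
    case (Cons \<phi> \<phi>s)
    have B1: "(\<lambda>y. d \<phi> * (\<phi> y * a y)) \<in> bounded_meas" using Cons assms by (intro bounded_meas_cmult bounded_meas_mult) auto
    have B2: "(\<lambda>y. (\<Sum>\<phi>\<leftarrow>\<phi>s. \<phi> y * d \<phi>) * a y) \<in> bounded_meas"
      and eq: "(\<integral>y. (\<Sum>\<phi>\<leftarrow>\<phi>s. \<phi> y * d \<phi>) * a y \<partial>M) = (\<Sum>\<phi>\<leftarrow>\<phi>s. d \<phi> * (\<integral>y. \<phi> y * a y \<partial>M))"
      using Cons by auto
    have "(\<lambda>y. (\<Sum>\<phi>\<leftarrow>\<phi> # \<phi>s. \<phi> y * d \<phi>) * a y) = (\<lambda>y. d \<phi> * (\<phi> y * a y) + (\<Sum>\<phi>\<leftarrow>\<phi>s. \<phi> y * d \<phi>) * a y)"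
      by (simp add: algebra_simps)
    then show ?case
      using bounded_meas_add[OF B1 B2] Bochner_Integration.integral_add[OF bounded_meas_integrable[OF B1] bounded_meas_integrable[OF B2]] eq
      by simp
  qed (auto intro: bounded_meas_const)
  then show "(\<lambda>y. (\<Sum>\<phi>\<leftarrow>\<phi>s. \<phi> y * d \<phi>) * a y) \<in> bounded_meas"
    "(\<integral>y. (\<Sum>\<phi>\<leftarrow>\<phi>s. \<phi> y * d \<phi>) * a y \<partial>M) = (\<Sum>\<phi>\<leftarrow>\<phi>s. d \<phi> * (\<integral>y. \<phi> y * a y \<partial>M))"
    by blast+
qed

lemma kernel_poly_square_zero:
  assumes "a \<in> kernel_poly" "(\<integral>x. a x * a x \<partial>M) = 0" "x \<in> space M"
  shows "a x = 0"
proof (rule kernel_poly_zero_AE[OF assms(1) _ assms(3)])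
  have "integrable M (\<lambda>x. a x * a x)" using assms kernel_poly_bounded_meas by (intro bounded_meas_integrable bounded_meas_mult)
  then have "AE x in M. a x * a x = 0"
    using assms(2) by (subst integral_nonneg_eq_0_iff_AE[symmetric]) auto
  then show "AE x in M. a x = 0" by simp
qed

text \<open>Density of \<open>density_algebra\<close> is turned into equality by compressing to a finite dimensional space:
  the kernel \<open>H\<close> below maps \<open>density_algebra\<close> into its intersection with the span of \<open>\<phi>s\<close>, and it is
  positive definite there.\<close>

lemma invariant_in_density_algebra:
  assumes orbits: "\<And>x y. x \<in> space M \<Longrightarrow> y \<in> space M \<Longrightarrow> (\<forall>a\<in>density_algebra. a x = a y) \<Longrightarrow> \<exists>g\<in>kernel_aut. g x = y"
    and p: "p \<in> kernel_poly" and inv: "\<And>g x. g \<in> kernel_aut \<Longrightarrow> x \<in> space M \<Longrightarrow> p (g x) = p x"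
  shows "\<exists>a\<in>density_algebra. \<forall>x\<in>space M. p x = a x"
proof -
  obtain H \<phi>s where HR: "(\<lambda>\<eta>. H (\<eta> 1) (\<eta> 2)) \<in> multi_dens" and H: "\<And>x y. H x y = (\<Sum>\<phi>\<leftarrow>\<phi>s. \<phi> x * \<phi> y)"
    and \<phi>s: "set \<phi>s \<subseteq> kernel_poly" and p\<phi>: "p \<in> list_span \<phi>s"
    using positive_kernel_spanning[OF p] by blast
  have \<phi>B: "set \<phi>s \<subseteq> bounded_meas" using \<phi>s kernel_poly_bounded_meas by auto
  \<comment> \<open>This intersection comes without a basis, but it sits inside a finitely generated
    space, which is all that the projection needs.\<close>
  define U where "U = density_algebra \<inter> list_span \<phi>s"
  have U: "U \<subseteq> bounded_meas" "U \<noteq> {}" "\<And>u v a. u \<in> U \<Longrightarrow> v \<in> U \<Longrightarrow> (\<lambda>x. u x + a * v x) \<in> U" "U \<subseteq> list_span \<phi>s"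
    using density_algebra_kernel_poly kernel_poly_bounded_meas density_algebra_const[of 0] zero_list_span by (auto simp: U_def intro: density_algebra_lin list_span_lin)
  have "\<exists>q\<in>U. \<forall>u\<in>U. (\<integral>x. (p x + (-1) * q x) * u x \<partial>M) = 0"
  proof (rule orthogonal_projection_exists[where D = bounded_meas and \<phi>s = \<phi>s and ip = "\<lambda>u v. \<integral>x. u x * v x \<partial>M"])
    show "(\<integral>x. (u x + a * v x) * h x \<partial>M) = (\<integral>x. u x * h x \<partial>M) + a * (\<integral>x. v x * h x \<partial>M)"
      if "u \<in> bounded_meas" "v \<in> bounded_meas" "h \<in> bounded_meas" for u v h a
      using that by (simp add: distrib_right mult.assoc bounded_meas_integrable bounded_meas_mult)
  qed (use U p kernel_poly_bounded_meas bounded_meas_lin in \<open>auto simp: mult.commute\<close>)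
  then obtain q where qU: "q \<in> U" and orth: "\<And>u. u \<in> U \<Longrightarrow> (\<integral>x. (p x + (-1) * q x) * u x \<partial>M) = 0" by blast
  define r where "r = (\<lambda>x. p x + (-1) * q x)"
  have q: "q \<in> density_algebra" "q \<in> list_span \<phi>s" using qU by (auto simp: U_def)
  have r\<phi>: "r \<in> list_span \<phi>s" unfolding r_def using p\<phi> q(2) by (rule list_span_lin)
  have rS: "r \<in> kernel_poly" using list_span_kernel_poly[OF \<phi>s r\<phi>] .
  have rB: "r \<in> bounded_meas" using rS kernel_poly_bounded_meas by blast
  have q_inv: "q (g x) = q x" if "g \<in> kernel_aut" "x \<in> space M" for g x
    using multi_dens_invariant[of "\<lambda>\<eta>. q (\<eta> 1)" g "\<lambda>_. x"] q(1) that by (simp add: density_algebra_def)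
  have r_inv: "r (g x) = r x" if "g \<in> kernel_aut" "x \<in> space M" for g x
    using q_inv inv that by (simp add: r_def)
  define T where "T = (\<lambda>a x. \<integral>y. H x y * a y \<partial>M)"
  have H': "H x y = (\<Sum>\<phi>\<leftarrow>\<phi>s. \<phi> y * \<phi> x)" for x y by (simp add: H mult.commute)
  have T: "T a = (\<lambda>x. \<Sum>\<phi>\<leftarrow>\<phi>s. \<phi> x * (\<integral>y. \<phi> y * a y \<partial>M))" if "a \<in> bounded_meas" for a
    using list_sum_integral(2)[OF \<phi>B that] by (simp add: T_def H')
  have T\<phi>: "T a \<in> list_span \<phi>s" if "a \<in> bounded_meas" for a unfolding T[OF that] by (rule list_span_sum)
  have T_ip: "(\<integral>x. T a x * b x \<partial>M) = (\<Sum>\<phi>\<leftarrow>\<phi>s. (\<integral>y. \<phi> y * a y \<partial>M) * (\<integral>y. \<phi> y * b y \<partial>M))"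
    if "a \<in> bounded_meas" "b \<in> bounded_meas" for a b
    unfolding T[OF that(1)] by (rule list_sum_integral(2)[OF \<phi>B that(2)])
  define s where "s = T r"
  have sS: "s \<in> kernel_poly" unfolding s_def by (rule list_span_kernel_poly[OF \<phi>s T\<phi>[OF rB]])
  have sB: "s \<in> bounded_meas" using sS kernel_poly_bounded_meas by blast
  have s_inv: "s (g x) = s x" if g: "g \<in> kernel_aut" and x: "x \<in> space M" for g x
  proof -
    have "s (g x) = (\<integral>y. H (g x) (g y) * r (g y) \<partial>M)"
      unfolding s_def T_def
      using kernel_aut_integral[OF g list_sum_integral(1)[OF \<phi>B rB, of "\<lambda>\<phi>. \<phi> (g x)"]] by (simp add: H')
    also have "\<dots> = (\<integral>y. H x y * r y \<partial>M)"
    proof (rule Bochner_Integration.integral_cong[OF refl])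
      fix y assume y: "y \<in> space M"
      have "H (g x) (g y) = H x y"
        using multi_dens_invariant[OF HR g, of "(\<lambda>_. x)(2 := y)"] x y by (simp add: fun_upd_apply)
      then show "H (g x) (g y) * r (g y) = H x y * r y" using r_inv[OF g y] by simp
    qed
    finally show ?thesis by (simp add: s_def T_def)
  qed
  \<comment> \<open>\<open>T\<close> is symmetric, so pairing \<open>T r\<close> with
    \<open>a\<close> is pairing \<open>r\<close> with \<open>T a\<close>; and \<open>T a\<close>
    lies in \<open>U\<close>, to which \<open>r\<close> is orthogonal.\<close>
  have s_orth: "(\<integral>x. s x * a x \<partial>M) = 0" if a: "a \<in> density_algebra" for a
  proof -
    have aB: "a \<in> bounded_meas" using a density_algebra_kernel_poly kernel_poly_bounded_meas by blast
    have "T a \<in> U" using density_algebra_kernel[OF HR a] T\<phi>[OF aB] by (simp add: U_def T_def)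
    then have "(\<integral>x. T a x * r x \<partial>M) = 0" using orth by (simp add: r_def mult.commute)
    then show ?thesis unfolding s_def T_ip[OF rB aB] T_ip[OF aB rB] by (simp add: mult.commute)
  qed
  have "(\<integral>x. s x * s x \<partial>M) = 0"
  proof (rule ccontr)
    assume neq: "(\<integral>x. s x * s x \<partial>M) \<noteq> 0"
    define S where "S = (\<integral>x. \<bar>s x\<bar> \<partial>M)"
    \<comment> \<open>For \<open>a\<close> within \<open>e\<close> of \<open>s\<close>,
      orthogonality gives that the integral of \<open>s\<close> squared is at most
      \<open>e * S\<close>. Dividing by \<open>S + 1\<close> makes this strictly smaller than the
      integral itself.\<close>
    define e where "e = (\<integral>x. s x * s x \<partial>M) / (S + 1)"
    have S0: "S \<ge> 0" unfolding S_def by (rule Bochner_Integration.integral_nonneg) simp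
    have "(\<integral>x. s x * s x \<partial>M) \<ge> 0" by (rule Bochner_Integration.integral_nonneg) simp
    then have "(\<integral>x. s x * s x \<partial>M) > 0" using neq by linarith
    then have e: "e > 0" unfolding e_def using S0 by (intro divide_pos_pos) linarith+
    have "\<exists>a\<in>density_algebra. \<forall>x\<in>space M. \<bar>s x - a x\<bar> < e"
    proof (rule density_algebra_dense[OF sS _ e])
      fix x y assume xy: "x \<in> space M" "y \<in> space M" "\<forall>a\<in>density_algebra. a x = a y"
      then obtain g where "g \<in> kernel_aut" "g x = y" using orbits by blast
      then show "s x = s y" using s_inv xy by metis
    qed
    then obtain a where a: "a \<in> density_algebra" "\<And>x. x \<in> space M \<Longrightarrow> \<bar>s x - a x\<bar> < e" by blast
    have aB: "a \<in> bounded_meas" using a density_algebra_kernel_poly kernel_poly_bounded_meas by blast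
    have "(\<integral>x. s x * s x \<partial>M) = (\<integral>x. s x * s x \<partial>M) - (\<integral>x. s x * a x \<partial>M)" using s_orth[OF a(1)] by simp
    also have "\<dots> = (\<integral>x. s x * (s x - a x) \<partial>M)"
      using sB aB by (simp add: right_diff_distrib bounded_meas_integrable bounded_meas_mult)
    also have "\<dots> \<le> (\<integral>x. e * \<bar>s x\<bar> \<partial>M)"
    proof (rule integral_mono)
      show "integrable M (\<lambda>x. s x * (s x - a x))"
        using bounded_meas_integrable[OF bounded_meas_mult[OF sB bounded_meas_lin[OF sB aB, of "-1"]]] by simp
      show "integrable M (\<lambda>x. e * \<bar>s x\<bar>)" using bounded_meas_integrable[OF sB] by simp
      fix x assume "x \<in> space M"
      then have "\<bar>s x\<bar> * \<bar>s x - a x\<bar> \<le> \<bar>s x\<bar> * e" using a(2)[of x] by (intro mult_left_mono) auto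
      then show "s x * (s x - a x) \<le> e * \<bar>s x\<bar>" by (simp add: abs_mult[symmetric] mult.commute abs_le_iff)
    qed
    also have "\<dots> = e * S" by (simp add: S_def)
    also have "\<dots> < e * (S + 1)" using e by simp
    also have "\<dots> = (\<integral>x. s x * s x \<partial>M)" using S0 by (simp add: e_def)
    finally show False by simp
  qed
  then have "s x = 0" if "x \<in> space M" for x using kernel_poly_square_zero[OF sS _ that] by simp
  then have "(\<integral>x. s x * r x \<partial>M) = 0"
    using Bochner_Integration.integral_cong[of M M "\<lambda>x. s x * r x" "\<lambda>_. 0"] by simp
  \<comment> \<open>Paired with \<open>r\<close>, the function \<open>T r\<close> gives a sum of
    squares, one for each generator. So \<open>r\<close> is orthogonal to every generator, and
    thereby to itself, as it lies in their span.\<close>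
  then have "(\<Sum>\<phi>\<leftarrow>\<phi>s. (\<integral>y. \<phi> y * r y \<partial>M) * (\<integral>y. \<phi> y * r y \<partial>M)) = 0"
    unfolding s_def T_ip[OF rB rB] .
  then have "\<forall>\<phi>\<in>set \<phi>s. (\<integral>y. \<phi> y * r y \<partial>M) = 0"
    by (subst (asm) sum_list_nonneg_eq_0_iff) auto
  then have "(\<integral>y. u y * r y \<partial>M) = 0" if "u \<in> list_span \<phi>s" for u
    using that \<phi>B
  proof (induction \<phi>s arbitrary: u)
    case (Cons \<phi> \<phi>s)
    then obtain c v where u: "u = (\<lambda>x. c * \<phi> x + v x)" "v \<in> list_span \<phi>s" by auto
    have "set \<phi>s \<subseteq> bounded_meas \<Longrightarrow> v \<in> list_span \<phi>s \<Longrightarrow> v \<in> bounded_meas" for \<phi>s v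
      by (induction \<phi>s arbitrary: v) (auto intro!: bounded_meas_const bounded_meas_add bounded_meas_cmult)
    then have "v \<in> bounded_meas" using u Cons by auto
    then have "(\<integral>y. u y * r y \<partial>M) = c * (\<integral>y. \<phi> y * r y \<partial>M) + (\<integral>y. v y * r y \<partial>M)"
      using Cons.prems rB by (simp add: u distrib_right mult.assoc bounded_meas_integrable bounded_meas_mult)
    then show ?case using Cons u by simp
  qed simp
  then have "(\<integral>y. r y * r y \<partial>M) = 0" using r\<phi> .
  then have "r x = 0" if "x \<in> space M" for x using kernel_poly_square_zero[OF rS _ that] by simp
  then have "\<forall>x\<in>space M. p x = q x" by (simp add: r_def)
  then show ?thesis using q by blast
qed

end

section \<open>Orbits\<close>

text \<open>The two consequences of standardness used to prove measurability: inner approximation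
  through any injective measurable coordinates, and completeness of the measure. The first is
  \<open>standard_injective_inner\<close>.\<close>

locale standard_kernel = finite_rank_kernel +
  assumes std: "\<And>(X :: 'a \<Rightarrow> nat \<Rightarrow> real) A. X \<in> borel_measurable M \<Longrightarrow> inj_on X (space M) \<Longrightarrow> A \<in> sets M \<Longrightarrow>
      \<exists>B\<in>sets borel. {x \<in> space M. X x \<in> B} \<subseteq> A \<and> emeasure M {x \<in> space M. X x \<in> B} = emeasure M A"
    and complete: "\<And>A B. A \<subseteq> B \<Longrightarrow> B \<in> null_sets M \<Longrightarrow> A \<in> sets M"

section \<open>Tuples with the same labeled densities\<close>

context finite_rank_kernel
begin

text \<open>Elements of \<open>multi_dens\<close> carry no set of labels; being labeled within
  \<open>S\<close> is expressed by ignoring all other nodes.\<close>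

definition depends_only :: "nat set \<Rightarrow> ((nat \<Rightarrow> 'a) \<Rightarrow> real) \<Rightarrow> bool" where
  "depends_only S P \<longleftrightarrow> (\<forall>\<eta> \<eta>'. (\<forall>i\<in>S. \<eta> i = \<eta>' i) \<longrightarrow> P \<eta> = P \<eta>')"

definition matched :: "nat set \<Rightarrow> (nat \<Rightarrow> 'a) \<Rightarrow> (nat \<Rightarrow> 'a) \<Rightarrow> bool" where
  "matched S \<eta> \<eta>' \<longleftrightarrow> (\<forall>P\<in>multi_dens. depends_only S P \<longrightarrow> P \<eta> = P \<eta>')"

lemma matched_sym: "matched S \<eta> \<eta>' \<Longrightarrow> matched S \<eta>' \<eta>"
  unfolding matched_def by metis

lemma depends_only_edge: "i \<in> S \<Longrightarrow> j \<in> S \<Longrightarrow> depends_only S (\<lambda>\<eta>. w (\<eta> i) (\<eta> j))"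
  by (simp add: depends_only_def)

lemma depends_only_integral_at:
  assumes "depends_only (insert j S) P" shows "depends_only S (integral_at j P)"
  unfolding depends_only_def integral_at_def
proof (intro allI impI Bochner_Integration.integral_cong[OF refl])
  fix \<eta> \<eta>' :: "nat \<Rightarrow> 'a" and y assume "\<forall>i\<in>S. \<eta> i = \<eta>' i"
  then have "\<forall>i\<in>insert j S. (\<eta>(j := y)) i = (\<eta>'(j := y)) i" by (auto simp: fun_upd_apply)
  then show "P (\<eta>(j := y)) = P (\<eta>'(j := y))" using assms unfolding depends_only_def by blast
qed

lemma matched_edge: "matched S \<eta> \<eta>' \<Longrightarrow> i \<in> S \<Longrightarrow> j \<in> S \<Longrightarrow> i \<noteq> j \<Longrightarrow> w (\<eta> i) (\<eta> j) = w (\<eta>' i) (\<eta>' j)"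
  using multi_dens.edge[of i j] depends_only_edge[of i S j] by (auto simp: matched_def)

text \<open>Moment comparison: a nonnegative function bounded by \<open>a\<close> cannot share all
  its moments with one that reaches \<open>b\<close> on a set of mass \<open>d\<close>.\<close>

lemma power_mass_contradiction:
  fixes a b d :: real
  assumes "0 \<le> a" "a < b" "0 < d" "\<And>N. b ^ N * d \<le> a ^ N"
  shows False
proof -
  have "a / b < 1" using assms by simp
  then obtain N where N: "(a / b) ^ N < d" using real_arch_pow_inv[OF \<open>0 < d\<close>] by blast
  then have "a ^ N < d * b ^ N" using assms by (simp add: power_divide pos_divide_less_eq)
  then show False using assms(4)[of N] by (simp add: mult.commute)
qed

text \<open>The function \<open>p\<close> vanishes at \<open>u\<close> and is bounded away from zero on the other side, but by
  the equivalence it has the same moments on both sides.\<close>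

lemma matched_extend_finite:
  assumes matched: "matched S \<eta> \<eta>'" and u: "u \<in> space M" and Q: "finite Q" "Q \<subseteq> multi_dens" "\<And>P. P \<in> Q \<Longrightarrow> depends_only (insert n S) P"
  shows "\<exists>v\<in>space M. \<forall>P\<in>Q. P (\<eta>'(n := v)) = P (\<eta>(n := u))"
proof (rule ccontr)
  assume contra: "\<not> ?thesis"
  \<comment> \<open>A sum of squares merges the finitely many conditions into one; the squares are
    multigraph densities even when the \<open>P\<close> come from simple graphs.\<close>
  define p where "p = (\<lambda>\<zeta>. \<Sum>P\<in>Q. (P \<zeta> + (- P (\<eta>(n := u))))\<^sup>2)"
  have pR: "p \<in> multi_dens" unfolding p_def by (intro multi_dens_sum multi_dens_power multi_dens.add multi_dens.const) (use Q in auto)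
  have pdep: "depends_only (insert n S) p"
    unfolding depends_only_def p_def
  proof (intro allI impI sum.cong refl)
    fix \<zeta> \<zeta>' :: "nat \<Rightarrow> 'a" and P assume "\<forall>i\<in>insert n S. \<zeta> i = \<zeta>' i" "P \<in> Q"
    then have "P \<zeta> = P \<zeta>'" using Q(3) unfolding depends_only_def by blast
    then show "(P \<zeta> + - P (\<eta>(n := u)))\<^sup>2 = (P \<zeta>' + - P (\<eta>(n := u)))\<^sup>2" by simp
  qed
  have p0: "p (\<eta>(n := u)) = 0" by (simp add: p_def)
  have ppos: "p (\<eta>'(n := v)) > 0" if v: "v \<in> space M" for v
  proof -
    obtain P where P: "P \<in> Q" "P (\<eta>'(n := v)) \<noteq> P (\<eta>(n := u))" using contra v by blast
    then have "0 < (P (\<eta>'(n := v)) + - P (\<eta>(n := u)))\<^sup>2" by simp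
    also have "\<dots> \<le> p (\<eta>'(n := v))" unfolding p_def by (rule member_le_sum) (use P Q in auto)
    finally show ?thesis .
  qed
  obtain q where q: "q \<in> polyfun" "\<And>x. p (\<eta>(n := x)) = q (F x)" using point_poly_slice[OF multi_dens_point_poly[OF pR]] by blast
  obtain q' where q': "q' \<in> polyfun" "\<And>x. p (\<eta>'(n := x)) = q' (F x)" using point_poly_slice[OF multi_dens_point_poly[OF pR]] by blast
  define X where "X = F ` space M"
  have X: "compact X" "X \<noteq> {}" using compact_F u by (auto simp: X_def)
  obtain x0 where x0: "x0 \<in> X" "\<And>\<xi>. \<xi> \<in> X \<Longrightarrow> q' x0 \<le> q' \<xi>"
    using continuous_attains_inf[OF X polyfun_continuous[OF q'(1)]] by blast
  define e where "e = q' x0"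
  have e: "e > 0" using x0 ppos q' by (auto simp: X_def e_def)
  have q'e: "q' (F x) \<ge> e" if "x \<in> space M" for x using x0 that by (simp add: X_def e_def)
  obtain x1 where x1: "\<And>\<xi>. \<xi> \<in> X \<Longrightarrow> q \<xi> \<le> q x1"
    using continuous_attains_sup[OF X polyfun_continuous[OF q(1)]] by blast
  obtain x2 where x2: "\<And>\<xi>. \<xi> \<in> X \<Longrightarrow> q' \<xi> \<le> q' x2"
    using continuous_attains_sup[OF X polyfun_continuous[OF q'(1)]] by blast
  \<comment> \<open>A common upper bound for both sides, so that the differences from
    \<open>C\<close> are nonnegative and their powers monotone.\<close>
  define C where "C = max (q x1) (q' x2)"
  have C: "q (F x) \<le> C" "q' (F x) \<le> C" if "x \<in> space M" for x
    using x1[of "F x"] x2[of "F x"] that by (auto simp: X_def C_def)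
  have eC: "e \<le> C" using q'e[OF u] C[OF u] by simp
  define d where "d = measure M {x \<in> space M. F x \<in> {\<xi>. q \<xi> < e / 2}}"
  have op: "open {\<xi>. q \<xi> < e / 2}" by (intro open_Collect_less polyfun_continuous q continuous_on_const)
  have d: "d > 0" unfolding d_def
    by (rule supp_F[OF op u]) (use q(2)[of u] p0 e in simp)
  have "(C - e / 2) ^ N * d \<le> (C - e) ^ N" for N
  proof -
    \<comment> \<open>Once node \<open>n\<close> is integrated out, this power is a density labeled
      within \<open>S\<close>, on which the two tuples agree. On the first side it is at least
      \<open>(C - e/2)^N\<close> on a set of mass \<open>d\<close>, on the second it never exceeds
      \<open>(C - e)^N\<close>.\<close>
    define Z where "Z = (\<lambda>\<zeta>. (C + (-1) * p \<zeta>) ^ N)"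
    have ZR: "Z \<in> multi_dens" unfolding Z_def by (intro multi_dens_power multi_dens.add multi_dens_cmult multi_dens.const pR)
    have "depends_only (insert n S) Z" using pdep unfolding depends_only_def Z_def by metis
    then have "integral_at n Z \<eta> = integral_at n Z \<eta>'" using matched multi_dens.int[OF ZR] depends_only_integral_at unfolding matched_def by blast
    then have eq: "(\<integral>x. (C - q (F x)) ^ N \<partial>M) = (\<integral>x. (C - q' (F x)) ^ N \<partial>M)"
      by (simp add: integral_at_def Z_def q q')
    have int: "integrable M (\<lambda>x. (C - q (F x)) ^ N)" "integrable M (\<lambda>x. (C - q' (F x)) ^ N)"
      using bounded_meas_integrable[OF point_poly_section[OF multi_dens_point_poly[OF ZR], of \<eta> n]] bounded_meas_integrable[OF point_poly_section[OF multi_dens_point_poly[OF ZR], of \<eta>' n]]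
      by (simp_all add: Z_def q q')
    have Am[measurable]: "{x \<in> space M. F x \<in> {\<xi>. q \<xi> < e / 2}} \<in> sets M"
      using measurable_sets[OF F_meas borel_open[OF op]] by (simp add: vimage_def Int_def conj_commute)
    have "(C - e / 2) ^ N * d = (\<integral>x. (C - e / 2) ^ N * indicator {x \<in> space M. F x \<in> {\<xi>. q \<xi> < e / 2}} x \<partial>M)"
      using Am by (simp add: d_def)
    also have "\<dots> \<le> (\<integral>x. (C - q (F x)) ^ N \<partial>M)"
    proof (rule integral_mono[OF _ int(1)])
      show "integrable M (\<lambda>x. (C - e / 2) ^ N * indicator {x \<in> space M. F x \<in> {\<xi>. q \<xi> < e / 2}} x)"
        using Am by (intro integrable_mult_right integrable_real_indicator) (auto simp: less_top[symmetric])
      fix x assume x: "x \<in> space M"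
      show "(C - e / 2) ^ N * indicator {x \<in> space M. F x \<in> {\<xi>. q \<xi> < e / 2}} x \<le> (C - q (F x)) ^ N"
        using C(1)[OF x] eC e by (auto simp: indicator_def intro!: power_mono)
    qed
    also have "\<dots> \<le> (\<integral>x. (C - e) ^ N \<partial>M)"
      unfolding eq using int q'e C by (intro integral_mono power_mono) auto
    finally show ?thesis by (simp add: prob_space)
  qed
  then show False using power_mass_contradiction[of "C - e" "C - e / 2" d] d e eC by simp
qed

text \<open>Each density gives a closed condition on the coordinates of the new point, finitely many
  of them can be met at once, and the image of the space is compact.\<close>

lemma matched_extend:
  assumes matched: "matched S \<eta> \<eta>'" and u: "u \<in> space M"
  obtains v where "v \<in> space M" "matched (insert n S) (\<eta>(n := u)) (\<eta>'(n := v))"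
proof -
  define PP where "PP = {P \<in> multi_dens. depends_only (insert n S) P}"
  have "\<forall>P\<in>multi_dens. \<exists>q. q \<in> polyfun \<and> (\<forall>x. P (\<eta>'(n := x)) = q (F x))"
    using point_poly_slice[OF multi_dens_point_poly] by blast
  then obtain sl where sl: "\<And>P. P \<in> multi_dens \<Longrightarrow> sl P \<in> polyfun" "\<And>P x. P \<in> multi_dens \<Longrightarrow> P (\<eta>'(n := x)) = sl P (F x)"
    by metis
  define Z where "Z = (\<lambda>P. {\<xi>. sl P \<xi> = P (\<eta>(n := u))})"
  have "F ` space M \<inter> \<Inter>(Z ` PP) \<noteq> {}"
  proof (rule compact_imp_fip_image[OF compact_F])
    show "closed (Z P)" if "P \<in> PP" for P
      unfolding Z_def using that sl by (intro closed_Collect_eq polyfun_continuous continuous_on_const) (auto simp: PP_def)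
    fix Q assume Q: "finite Q" "Q \<subseteq> PP"
    have "\<exists>v\<in>space M. \<forall>P\<in>Q. P (\<eta>'(n := v)) = P (\<eta>(n := u))"
      by (rule matched_extend_finite[OF matched u Q(1)]) (use Q in \<open>auto simp: PP_def\<close>)
    then obtain v where v: "v \<in> space M" "\<And>P. P \<in> Q \<Longrightarrow> P (\<eta>'(n := v)) = P (\<eta>(n := u))" by blast
    have "F v \<in> Z P" if "P \<in> Q" for P
      using v(2)[OF that] sl(2)[of P v] Q that by (auto simp: Z_def PP_def)
    then show "F ` space M \<inter> \<Inter>(Z ` Q) \<noteq> {}" using v by blast
  qed
  then obtain v where v: "v \<in> space M" "\<And>P. P \<in> PP \<Longrightarrow> F v \<in> Z P" by blast
  have "matched (insert n S) (\<eta>(n := u)) (\<eta>'(n := v))"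
    unfolding matched_def
  proof (intro ballI impI)
    fix P assume "P \<in> multi_dens" "depends_only (insert n S) P"
    then show "P (\<eta>(n := u)) = P (\<eta>'(n := v))" using v(2)[of P] sl(2)[of P v] by (auto simp: PP_def Z_def)
  qed
  then show ?thesis using v that by blast
qed

text \<open>Node 1 holds the base point, the \<open>m\<close> further points occupy the nodes 2 to
  \<open>m+1\<close> and are matched in this order.\<close>

lemma matched_extend_many:
  assumes "matched {1} \<eta> (\<lambda>_. y)" "y \<in> space M" "\<And>i. \<eta> i \<in> space M"
  shows "\<exists>\<eta>'. (\<forall>i. \<eta>' i \<in> space M) \<and> \<eta>' 1 = y \<and> matched (insert 1 {2..<m+2}) \<eta> \<eta>'"
proof (induction m)
  case 0
  then show ?case using assms by (intro exI[of _ "\<lambda>_. y"]) auto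
next
  case (Suc m)
  then obtain \<eta>' where \<eta>': "\<And>i. \<eta>' i \<in> space M" "\<eta>' 1 = y" "matched (insert 1 {2..<m+2}) \<eta> \<eta>'" by blast
  obtain v where v: "v \<in> space M"
    "matched (insert (m+2) (insert 1 {2..<m+2})) (\<eta>(m+2 := \<eta> (m+2))) (\<eta>'(m+2 := v))"
    using matched_extend[OF \<eta>'(3) assms(3)] by blast
  have *: "insert (m+2) (insert 1 {2..<m+2}) = insert 1 {2..<Suc m+2}" by auto
  show ?case
  proof (intro exI[of _ "\<eta>'(m+2 := v)"] conjI allI)
    show "(\<eta>'(m+2 := v)) i \<in> space M" for i using \<eta>' v by (simp add: fun_upd_apply)
    show "(\<eta>'(m+2 := v)) 1 = y" using \<eta>'(2) by (simp add: fun_upd_apply)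
    show "matched (insert 1 {2..<Suc m+2}) \<eta> (\<eta>'(m+2 := v))" using v(2) unfolding * fun_upd_triv .
  qed
qed

lemma w_eigen: "k < t \<Longrightarrow> (\<integral>y. w x y * f k y \<partial>M) = l k * f k x"
proof -
  assume k: "k < t"
  have "(\<integral>y. w x y * f k y \<partial>M) = (\<integral>y. (\<Sum>i<t. l i * f i x * (f i y * f k y)) \<partial>M)"
    by (simp add: w_def sum_distrib_right mult.assoc)
  also have "\<dots> = (\<Sum>i<t. l i * f i x * (\<integral>y. f i y * f k y \<partial>M))"
    by (simp add: bounded_meas_integrable bounded_meas_mult f_bounded_meas)
  also have "\<dots> = l k * f k x"
    using k by (simp add: f_orth if_distrib[of "\<lambda>x. _ * x"] sum.delta cong: if_cong)
  finally show ?thesis .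
qed

lemma w_bounded_meas: "(\<lambda>x. w x y) \<in> bounded_meas" "(\<lambda>y. w x y) \<in> bounded_meas"
proof -
  have "(\<lambda>y. w x y) \<in> bounded_meas" for x unfolding w_def by (intro bounded_meas_sum bounded_meas_cmult f_bounded_meas)
  then show "(\<lambda>x. w x y) \<in> bounded_meas" "(\<lambda>y. w x y) \<in> bounded_meas" by (simp_all add: w_sym[of _ y])
qed

lemma F_eqI: "(\<And>k. k < t \<Longrightarrow> f k x = f k y) \<Longrightarrow> F x = F y"
  unfolding F_def fun_eq_iff using f_zero by (metis not_le)

text \<open>Integrating a section of \<open>w\<close> against \<open>f k\<close> returns
  \<open>l k * f k\<close>, so a section determines all coordinates of its point.\<close>

lemma w_separates:
  assumes "x \<in> space M" "y \<in> space M" "\<And>z. z \<in> space M \<Longrightarrow> w x z = w y z"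
  shows "x = y"
proof -
  have "f k x = f k y" if "k < t" for k
  proof -
    have "l k * f k x = l k * f k y"
      unfolding w_eigen[OF that, symmetric] using assms(3) by (intro Bochner_Integration.integral_cong) auto
    then show ?thesis using l_nz[OF that] by simp
  qed
  then show ?thesis using F_eqI inj_F assms by (meson inj_onD)
qed

text \<open>The vectors of eigenfunction values at points span the whole coordinate space: a
  functional vanishing on all of them would be a linear relation between orthonormal functions.
  Hence finitely many points carry a dual basis, and combining the sections of \<open>w\<close> at
  these points isolates each \<open>f k\<close>.\<close>

lemma spanning_points:
  assumes "space M \<noteq> {}"
  shows "\<exists>n u \<beta>. (\<forall>i. u i \<in> space M) \<and> (\<forall>k<t. \<forall>z. f k z = (\<Sum>i<n::nat. \<beta> k i * w z (u i)))"
proof -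
  define V where "V = {\<lambda>k. \<Sum>p\<in>A. \<alpha> p * f k p | A \<alpha>. finite A \<and> A \<subseteq> space M}"
  have ev: "(\<lambda>j. f j p) \<in> V" if "p \<in> space M" for p
    unfolding V_def using that by (intro CollectI exI[of _ "{p}"] exI[of _ "\<lambda>_. 1"]) auto
  have lin: "(\<lambda>i. g i + a * h i) \<in> V" if gh: "g \<in> V" "h \<in> V" for g h a
  proof -
    obtain A \<alpha> B \<beta> where A: "finite A" "A \<subseteq> space M" "g = (\<lambda>k. \<Sum>p\<in>A. \<alpha> p * f k p)"
      and B: "finite B" "B \<subseteq> space M" "h = (\<lambda>k. \<Sum>p\<in>B. \<beta> p * f k p)" using gh unfolding V_def by blast
    define \<gamma> where "\<gamma> = (\<lambda>p. (if p \<in> A then \<alpha> p else 0) + a * (if p \<in> B then \<beta> p else 0))"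
    have "(\<Sum>p\<in>A \<union> B. \<gamma> p * f k p) = g k + a * h k" for k
    proof -
      have "(\<Sum>p\<in>A \<union> B. \<gamma> p * f k p) = (\<Sum>p\<in>A \<union> B. (if p \<in> A then \<alpha> p * f k p else 0) + a * (if p \<in> B then \<beta> p * f k p else 0))"
        by (intro sum.cong) (auto simp: \<gamma>_def algebra_simps)
      also have "\<dots> = (\<Sum>p\<in>A \<union> B. (if p \<in> A then \<alpha> p * f k p else 0)) + a * (\<Sum>p\<in>A \<union> B. (if p \<in> B then \<beta> p * f k p else 0))"
        by (simp add: sum.distrib sum_distrib_left)
      also have "(\<Sum>p\<in>A \<union> B. (if p \<in> A then \<alpha> p * f k p else 0)) = g k"
        using A B by (simp add: sum.inter_restrict[symmetric] Int_absorb1)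
      also have "(\<Sum>p\<in>A \<union> B. (if p \<in> B then \<beta> p * f k p else 0)) = h k"
        using A B by (simp add: sum.inter_restrict[symmetric] Int_absorb1)
      finally show ?thesis .
    qed
    then show ?thesis unfolding V_def using A B
      by (intro CollectI exI[of _ "A \<union> B"] exI[of _ \<gamma>]) auto
  qed
  have dual: "\<exists>g\<in>V. \<forall>j<t. g j = (if j = k then 1 else 0)" if k: "k < t" for k
  proof (rule ccontr)
    assume "\<not> ?thesis"
    then obtain c where c: "\<And>g. g \<in> V \<Longrightarrow> (\<Sum>j<t. c j * g j) = 0" "(\<Sum>j<t. c j * (if j = k then 1 else 0)) \<noteq> 0"
      using subspace_separation[of V t "\<lambda>j. if j = k then 1 else 0"] lin ev assms by blast
    have ck: "c k \<noteq> 0" using c(2) k by (simp add: if_distrib[of "\<lambda>x. _ * x"] sum.delta cong: if_cong)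
    have "0 = (\<integral>p. (\<Sum>j<t. c j * f j p) * f k p \<partial>M)"
      using c(1)[OF ev] Bochner_Integration.integral_cong[of M M "\<lambda>p. (\<Sum>j<t. c j * f j p) * f k p" "\<lambda>_. 0"] by simp
    also have "\<dots> = (\<integral>p. (\<Sum>j<t. c j * (f j p * f k p)) \<partial>M)"
      by (simp add: sum_distrib_right mult.assoc)
    also have "\<dots> = (\<Sum>j<t. c j * (\<integral>p. f j p * f k p \<partial>M))"
      by (simp add: bounded_meas_integrable bounded_meas_mult f_bounded_meas)
    also have "\<dots> = c k"
      using k by (simp add: f_orth if_distrib[of "\<lambda>x. _ * x"] sum.delta cong: if_cong)
    finally show False using ck by simp
  qed
  have "\<forall>k\<in>{..<t}. \<exists>A \<alpha>. finite A \<and> A \<subseteq> space M \<and> (\<forall>j<t. (\<Sum>p\<in>A. \<alpha> p * f j p) = (if j = k then 1 else 0))"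
  proof
    fix k assume "k \<in> {..<t}"
    then obtain g where g: "g \<in> V" "\<forall>j<t. g j = (if j = k then 1 else 0)" using dual[of k] by auto
    from g(1) obtain A \<alpha> where "finite A" "A \<subseteq> space M" "g = (\<lambda>k. \<Sum>p\<in>A. \<alpha> p * f k p)"
      unfolding V_def by auto
    then show "\<exists>A \<alpha>. finite A \<and> A \<subseteq> space M \<and> (\<forall>j<t. (\<Sum>p\<in>A. \<alpha> p * f j p) = (if j = k then 1 else 0))"
      using g(2) by (intro exI[of _ A] exI[of _ \<alpha>]) simp
  qed
  from bchoice[OF this] obtain A where A0: "\<forall>k\<in>{..<t}. \<exists>\<alpha>. finite (A k) \<and> A k \<subseteq> space M \<and> (\<forall>j<t. (\<Sum>p\<in>A k. \<alpha> p * f j p) = (if j = k then 1 else 0))"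
    by blast
  from bchoice[OF this] obtain \<alpha> where
    "\<forall>k\<in>{..<t}. finite (A k) \<and> A k \<subseteq> space M \<and> (\<forall>j<t. (\<Sum>p\<in>A k. \<alpha> k p * f j p) = (if j = k then 1 else 0))"
    by blast
  then have A: "\<And>k. k < t \<Longrightarrow> finite (A k)" "\<And>k. k < t \<Longrightarrow> A k \<subseteq> space M"
    "\<And>k j. k < t \<Longrightarrow> j < t \<Longrightarrow> (\<Sum>p\<in>A k. \<alpha> k p * f j p) = (if j = k then 1 else 0)"
    by auto
  define AA where "AA = (\<Union>k<t. A k)"
  have AA: "finite AA" "AA \<subseteq> space M" using A by (auto simp: AA_def)
  obtain u0 where u0: "bij_betw u0 {0..<card AA} AA" using ex_bij_betw_nat_finite[OF AA(1)] by blast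
  obtain x0 where x0: "x0 \<in> space M" using assms by blast
  define u where "u = (\<lambda>i. if i < card AA then u0 i else x0)"
  \<comment> \<open>The dual combination of sections yields \<open>l k * f k\<close>, hence the
    division by \<open>l k\<close>.\<close>
  define \<beta> where "\<beta> = (\<lambda>k i. (if u i \<in> A k then \<alpha> k (u i) else 0) / l k)"
  have bij: "bij_betw u {..<card AA} AA"
    using u0 by (subst bij_betw_cong[of _ u u0]) (auto simp: u_def atLeast0LessThan)
  have us: "u i \<in> space M" for i
    using bij_betwE[OF bij] AA x0 by (cases "i < card AA") (auto simp: u_def)
  have "f k z = (\<Sum>i<card AA. \<beta> k i * w z (u i))" if k: "k < t" for k z
  proof -
    have "(\<Sum>i<card AA. \<beta> k i * w z (u i)) = (\<Sum>p\<in>AA. (if p \<in> A k then \<alpha> k p else 0) / l k * w z p)"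
      unfolding \<beta>_def by (rule sum.reindex_bij_betw[OF bij])
    also have "\<dots> = (\<Sum>p\<in>AA. if p \<in> A k then \<alpha> k p * w z p / l k else 0)"
      by (intro sum.cong) auto
    also have "\<dots> = (\<Sum>p\<in>A k. \<alpha> k p * w z p / l k)"
      using AA k by (subst sum.inter_restrict[symmetric]) (auto simp: AA_def intro!: sum.cong)
    also have "\<dots> = (\<Sum>p\<in>A k. \<Sum>j<t. l j * f j z * (\<alpha> k p * f j p)) / l k"
      by (simp add: w_def sum_distrib_left sum_divide_distrib mult_ac)
    also have "(\<Sum>p\<in>A k. \<Sum>j<t. l j * f j z * (\<alpha> k p * f j p)) = (\<Sum>j<t. l j * f j z * (\<Sum>p\<in>A k. \<alpha> k p * f j p))"
      by (subst sum.swap) (simp add: sum_distrib_left)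
    also have "\<dots> = l k * f k z"
      using k by (simp add: A(3) if_distrib[of "\<lambda>x. _ * x"] sum.delta cong: if_cong)
    finally show ?thesis using l_nz[OF k] by simp
  qed
  then show ?thesis using us by blast
qed

end

section \<open>Construction of an automorphism between points with equal densities\<close>

context standard_kernel
begin

text \<open>The points \<open>u i\<close> matched to \<open>v i\<close> provide two coordinate
  systems: \<open>f k\<close> expressed through sections at the \<open>u i\<close>, and
  \<open>f' k\<close> by the same formula at the \<open>v i\<close>. The automorphism sends
  \<open>z\<close> to the point whose new coordinates are the old coordinates of \<open>z\<close>;
  matching further points in both directions shows that it exists and is onto.\<close>

lemma orbit:
  assumes x: "x \<in> space M" and y: "y \<in> space M" and xy: "\<forall>a\<in>density_algebra. a x = a y"
  shows "\<exists>g\<in>kernel_aut. g x = y"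
proof -
  obtain n u \<beta> where u: "\<And>i. u i \<in> space M" and fu: "\<And>k z. k < t \<Longrightarrow> f k z = (\<Sum>i<n::nat. \<beta> k i * w z (u i))"
    using spanning_points x by (metis empty_iff)
  \<comment> \<open>The point \<open>x\<close> sits at node 1 and also fills all nodes outside 2 to
    \<open>n+1\<close>, so that every node carries a point of the space.\<close>
  define \<eta> where "\<eta> = (\<lambda>i::nat. if 2 \<le> i \<and> i < n + 2 then u (i - 2) else x)"
  have \<eta>J: "\<eta> i \<in> space M" for i using u x by (simp add: \<eta>_def)
  have \<eta>1: "\<eta> 1 = x" by (simp add: \<eta>_def)
  have \<eta>u: "\<eta> (i + 2) = u i" if "i < n" for i using that by (simp add: \<eta>_def)
  have "matched {1} \<eta> (\<lambda>_. y)"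
    unfolding matched_def
  proof (intro ballI impI)
    fix P assume P: "P \<in> multi_dens" "depends_only {1} P"
    have c: "P \<zeta> = P (\<lambda>_. \<zeta> 1)" for \<zeta> using P(2)[unfolded depends_only_def, rule_format, of \<zeta> "\<lambda>_. \<zeta> 1"] by simp
    have "(\<lambda>\<zeta>. P (\<lambda>_. \<zeta> 1)) = P" using c by auto
    then have "(\<lambda>x. P (\<lambda>_. x)) \<in> density_algebra" using P by (simp add: density_algebra_def)
    from bspec[OF xy this] have "P (\<lambda>_. x) = P (\<lambda>_. y)" .
    then show "P \<eta> = P (\<lambda>_. y)" using c[of \<eta>] \<eta>1 by simp
  qed
  from matched_extend_many[OF this y \<eta>J, of n] obtain \<eta>' where \<eta>'J: "\<And>i. \<eta>' i \<in> space M" and \<eta>'1: "\<eta>' 1 = y"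
    and eq: "matched (insert 1 {2..<n+2}) \<eta> \<eta>'" by blast
  define S where "S = insert 1 {2..<n+2}"
  have eqS: "matched S \<eta> \<eta>'" using eq by (simp add: S_def)
  define v where "v = (\<lambda>i. \<eta>' (i + 2))"
  define f' where "f' = (\<lambda>k z. \<Sum>i<n. \<beta> k i * w z (v i))"
  have f'integral_at: "f k z = f' k z'" if "k < t" "\<And>i. i < n \<Longrightarrow> w z (u i) = w z' (v i)" for k z z'
    using that by (simp add: fu f'_def)
  have f'_xy: "f k x = f' k y" if "k < t" for k
  proof (rule f'integral_at[OF that])
    fix i assume i: "i < n"
    have "w (\<eta> 1) (\<eta> (i + 2)) = w (\<eta>' 1) (\<eta>' (i + 2))"
      by (rule matched_edge[OF eqS]) (use i in \<open>auto simp: S_def\<close>)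
    then show "w x (u i) = w y (v i)" unfolding \<eta>1 \<eta>'1 \<eta>u[OF i] v_def .
  qed
  define n2 where "n2 = n + 2"
  define n3 where "n3 = n + 3"
  have n23: "n2 \<notin> S" "n3 \<notin> S" "n3 \<noteq> n2" "n2 \<noteq> n3" by (auto simp: S_def n2_def n3_def)
  have iS: "i + 2 \<in> S" if "i < n" for i using that by (auto simp: S_def)
  \<comment> \<open>Matching is symmetric, so points on the second side can be pulled back; this
    yields surjectivity and transports the kernel formula to the new coordinates.\<close>
  have backward: "\<exists>z\<in>space M. matched (insert n2 S) (\<eta>(n2 := z)) (\<eta>'(n2 := z'))" if "z' \<in> space M" for z'
  proof -
    from matched_extend[OF matched_sym[OF eqS] that, of n2] obtain z
      where z: "z \<in> space M" "matched (insert n2 S) (\<eta>'(n2 := z')) (\<eta>(n2 := z))" .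
    from matched_sym[OF z(2)] z(1) show ?thesis by (rule bexI)
  qed
  have forth: "\<exists>z'\<in>space M. matched (insert n2 S) (\<eta>(n2 := z)) (\<eta>'(n2 := z'))" if "z \<in> space M" for z
  proof -
    from matched_extend[OF eqS that, of n2] obtain z'
      where "z' \<in> space M" "matched (insert n2 S) (\<eta>(n2 := z)) (\<eta>'(n2 := z'))" .
    then show ?thesis by (intro bexI)
  qed
  have match: "f k z = f' k z'" if k: "k < t" and e: "matched (insert n2 S) (\<eta>(n2 := z)) (\<eta>'(n2 := z'))" for k z z'
  proof (rule f'integral_at[OF k])
    fix i assume i: "i < n"
    then have ne: "i + 2 \<noteq> n2" by (auto simp: n2_def)
    have "w ((\<eta>(n2 := z)) n2) ((\<eta>(n2 := z)) (i + 2)) = w ((\<eta>'(n2 := z')) n2) ((\<eta>'(n2 := z')) (i + 2))"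
      by (rule matched_edge[OF e]) (use iS[OF i] ne in auto)
    then show "w z (u i) = w z' (v i)"
      by (simp only: fun_upd_same fun_upd_other[OF ne] \<eta>u[OF i] v_def)
  qed
  \<comment> \<open>Two points are matched successively at the fresh nodes \<open>n2\<close> and
    \<open>n3\<close>, so that the edge between them is compared as well and not only their edges to
    the base points.\<close>
  have wf': "w z' s' = (\<Sum>k<t. l k * f' k z' * f' k s')" if z': "z' \<in> space M" and s': "s' \<in> space M" for z' s'
  proof -
    obtain z where z: "z \<in> space M" "matched (insert n2 S) (\<eta>(n2 := z)) (\<eta>'(n2 := z'))" using backward[OF z'] by blast
    from matched_extend[OF matched_sym[OF z(2)] s', of n3] obtain s
      where s1: "s \<in> space M" "matched (insert n3 (insert n2 S)) (\<eta>'(n2 := z', n3 := s')) (\<eta>(n2 := z, n3 := s))" .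
    note s = s1(1) matched_sym[OF s1(2)]
    have "w ((\<eta>(n2 := z, n3 := s)) n2) ((\<eta>(n2 := z, n3 := s)) n3) = w ((\<eta>'(n2 := z', n3 := s')) n2) ((\<eta>'(n2 := z', n3 := s')) n3)"
      by (rule matched_edge[OF s(2)]) (use n23 in auto)
    then have "w z' s' = w z s" using n23 by simp
    moreover have "f k s = f' k s'" if k: "k < t" for k
    proof (rule f'integral_at[OF k])
      fix i assume i: "i < n"
      then have ne: "i + 2 \<noteq> n2" "i + 2 \<noteq> n3" by (auto simp: n2_def n3_def)
      have "w ((\<eta>(n2 := z, n3 := s)) n3) ((\<eta>(n2 := z, n3 := s)) (i + 2)) = w ((\<eta>'(n2 := z', n3 := s')) n3) ((\<eta>'(n2 := z', n3 := s')) (i + 2))"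
        by (rule matched_edge[OF s(2)]) (use iS[OF i] ne in auto)
      then show "w s (u i) = w s' (v i)"
        by (simp only: fun_upd_same fun_upd_other[OF ne(1)] fun_upd_other[OF ne(2)] \<eta>u[OF i] v_def)
    qed
    moreover have "f k z = f' k z'" if "k < t" for k using match[OF that z(2)] .
    ultimately show ?thesis by (simp add: w_def)
  qed
  have sep': "z = z'" if z: "z \<in> space M" "z' \<in> space M" and e: "\<And>k. k < t \<Longrightarrow> f' k z = f' k z'" for z z'
    by (rule w_separates[OF z]) (simp add: wf' z e)
  have ex: "\<exists>z'. z' \<in> space M \<and> (\<forall>k<t. f' k z' = f k z)" if "z \<in> space M" for z
    using forth[OF that] match by metis
  define g where "g = (\<lambda>z. SOME z'. z' \<in> space M \<and> (\<forall>k<t. f' k z' = f k z))"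
  have g: "g z \<in> space M" "\<And>k. k < t \<Longrightarrow> f' k (g z) = f k z" if "z \<in> space M" for z
    using someI_ex[OF ex[OF that]] unfolding g_def by blast+
  have gx: "g x = y" by (rule sep') (use g[OF x] y f'_xy in auto)
  have wg: "w (g z) (g s) = w z s" if "z \<in> space M" "s \<in> space M" for z s
    using wf'[OF g(1)[OF that(1)] g(1)[OF that(2)]] g that by (simp add: w_def)
  have inj_g: "inj_on g (space M)"
  proof (rule inj_onI)
    fix a b assume ab: "a \<in> space M" "b \<in> space M" "g a = g b"
    then have "F a = F b" using g by (intro F_eqI) metis
    then show "a = b" using inj_F ab by (meson inj_onD)
  qed
  have surj_g: "g ` space M = space M"
  proof
    show "g ` space M \<subseteq> space M" using g by auto
    show "space M \<subseteq> g ` space M"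
    proof
      fix z' assume z': "z' \<in> space M"
      obtain z where z: "z \<in> space M" "matched (insert n2 S) (\<eta>(n2 := z)) (\<eta>'(n2 := z'))" using backward[OF z'] by blast
      have "g z = z'" by (rule sep') (use g[OF z(1)] z' match[OF _ z(2)] in auto)
      then show "z' \<in> g ` space M" using z by blast
    qed
  qed
  have bij: "bij_betw g (space M) (space M)" using inj_g surj_g by (simp add: bij_betw_def)
  define F' where "F' = (\<lambda>z k. if k < t then f' k z else 0)"
  have F'g: "F' (g z) = F z" if "z \<in> space M" for z
    using g(2)[OF that] f_zero by (auto simp: F'_def F_def fun_eq_iff)
  have F'im: "F' z \<in> F ` space M" if "z \<in> space M" for z
    using that surj_g F'g by (metis imageE imageI)
  have F'm[measurable]: "F' \<in> borel_measurable M"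
  proof -
    have "f' k \<in> bounded_meas" for k unfolding f'_def by (intro bounded_meas_sum bounded_meas_cmult w_bounded_meas)
    then have "(\<lambda>z. F' z k) \<in> borel_measurable M" for k by (cases "k < t") (auto simp: F'_def bounded_meas_def)
    then show ?thesis by (rule measurable_coordinatewise_then_product)
  qed
  have inj_F': "inj_on F' (space M)"
  proof (rule inj_onI)
    fix a b assume ab: "a \<in> space M" "b \<in> space M" "F' a = F' b"
    have "f' k a = f' k b" if "k < t" for k using fun_cong[OF ab(3), of k] that by (simp add: F'_def)
    then show "a = b" using sep' ab by blast
  qed
  \<comment> \<open>Every polynomial in the old coordinates of \<open>z\<close> is a labeled density
    evaluated at the first tuple, and the same density at the second tuple is that polynomial in the
    new coordinates. Integrating over \<open>z\<close> makes all joint moments of \<open>F\<close>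
    and \<open>F'\<close> equal.\<close>
  have slice: "\<exists>P\<in>multi_dens. depends_only (insert n2 S) P \<and> (\<forall>z. P (\<eta>(n2 := z)) = q (F z)) \<and> (\<forall>z. P (\<eta>'(n2 := z)) = q (F' z))"
    if "q \<in> polyfun" for q
    using that
  proof induction
    case (const c)
    show ?case by (rule bexI[OF _ multi_dens.const[of c]]) (auto simp: depends_only_def)
  next
    case (coord k)
    show ?case
    proof (cases "k < t")
      case True
      have ne: "n2 \<noteq> i + 2" if "i < n" for i using that by (auto simp: n2_def)
      have up: "(\<zeta>(n2 := z)) (i + 2) = \<zeta> (i + 2)" if "i < n" for i z and \<zeta> :: "nat \<Rightarrow> 'a"
        using ne[OF that] by (rule fun_upd_other[OF not_sym])
      define P where "P = (\<lambda>\<zeta>. \<Sum>i<n. \<beta> k i * w (\<zeta> n2) (\<zeta> (i + 2)))"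
      have "P \<in> multi_dens" unfolding P_def by (intro multi_dens_sum multi_dens_cmult multi_dens.edge) (use ne in auto)
      moreover have "depends_only (insert n2 S) P"
        unfolding depends_only_def P_def using iS by (auto intro!: sum.cong)
      moreover have "P (\<eta>(n2 := z)) = F z k" for z
        unfolding P_def F_def fu[OF True] fun_upd_same
        by (intro sum.cong refl) (simp only: lessThan_iff up \<eta>u)
      moreover have "P (\<eta>'(n2 := z)) = F' z k" for z
        unfolding P_def F'_def f'_def v_def fun_upd_same if_P[OF True]
        by (intro sum.cong refl) (simp only: lessThan_iff up)
      ultimately show ?thesis by blast
    next
      case False
      then show ?thesis
        by (intro bexI[OF _ multi_dens.const[of 0]]) (auto simp: depends_only_def F_def F'_def f_zero)
    qed
  next
    case (add p q)
    from add.IH(1) obtain P where P: "P \<in> multi_dens" "depends_only (insert n2 S) P" "\<And>z. P (\<eta>(n2 := z)) = p (F z)" "\<And>z. P (\<eta>'(n2 := z)) = p (F' z)" by blast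
    from add.IH(2) obtain Q where Q: "Q \<in> multi_dens" "depends_only (insert n2 S) Q" "\<And>z. Q (\<eta>(n2 := z)) = q (F z)" "\<And>z. Q (\<eta>'(n2 := z)) = q (F' z)" by blast
    have "depends_only (insert n2 S) (\<lambda>\<zeta>. P \<zeta> + Q \<zeta>)" using P(2) Q(2) unfolding depends_only_def by metis
    then show ?case using P Q by (intro bexI[OF _ multi_dens.add[OF P(1) Q(1)]]) auto
  next
    case (mult p q)
    from mult.IH(1) obtain P where P: "P \<in> multi_dens" "depends_only (insert n2 S) P" "\<And>z. P (\<eta>(n2 := z)) = p (F z)" "\<And>z. P (\<eta>'(n2 := z)) = p (F' z)" by blast
    from mult.IH(2) obtain Q where Q: "Q \<in> multi_dens" "depends_only (insert n2 S) Q" "\<And>z. Q (\<eta>(n2 := z)) = q (F z)" "\<And>z. Q (\<eta>'(n2 := z)) = q (F' z)" by blast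
    have "depends_only (insert n2 S) (\<lambda>\<zeta>. P \<zeta> * Q \<zeta>)" using P(2) Q(2) unfolding depends_only_def by metis
    then show ?case using P Q by (intro bexI[OF _ multi_dens.mult[OF P(1) Q(1)]]) auto
  qed
  have law: "distr M borel F = distr M borel F'"
  proof (rule distr_eq_of_moments[OF prob_space_axioms F_meas F'm compact_F])
    fix q assume "q \<in> polyfun"
    from slice[OF this] obtain P where P: "P \<in> multi_dens" "depends_only (insert n2 S) P" "\<And>z. P (\<eta>(n2 := z)) = q (F z)" "\<And>z. P (\<eta>'(n2 := z)) = q (F' z)" by blast
    have "integral_at n2 P \<eta> = integral_at n2 P \<eta>'" using eqS multi_dens.int[OF P(1)] depends_only_integral_at[OF P(2)] unfolding matched_def by blast
    then show "(\<integral>z. q (F z) \<partial>M) = (\<integral>z. q (F' z) \<partial>M)" by (simp add: integral_at_def P)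
  qed (use F'im in auto)
  have cyl: "{z \<in> space M. F z \<in> B} \<in> sets M" "{z \<in> space M. F' z \<in> B} \<in> sets M"
    "emeasure M {z \<in> space M. F z \<in> B} = emeasure M {z \<in> space M. F' z \<in> B}" if "B \<in> sets borel" for B
  proof -
    have e: "{z \<in> space M. X z \<in> B} = X -` B \<inter> space M" for X :: "'a \<Rightarrow> nat \<Rightarrow> real" by auto
    show "{z \<in> space M. F z \<in> B} \<in> sets M" "{z \<in> space M. F' z \<in> B} \<in> sets M"
      unfolding e using measurable_sets[OF F_meas that] measurable_sets[OF F'm that] .
    have "emeasure (distr M borel F) B = emeasure (distr M borel F') B" using law by simp
    then show "emeasure M {z \<in> space M. F z \<in> B} = emeasure M {z \<in> space M. F' z \<in> B}"
      unfolding e using that by (simp add: emeasure_distr)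
  qed
  \<comment> \<open>\<open>g\<close> carries preimages under \<open>F\<close> to preimages under
    \<open>F'\<close>. Inner approximations of \<open>A\<close> and of its complement by preimages
    under \<open>F'\<close> therefore pull back to sets enclosing the preimage of \<open>A\<close>;
    equality of the laws makes the gap null, and completeness makes the preimage measurable.\<close>
  have pre: "g -` A \<inter> space M \<in> sets M \<and> emeasure M (g -` A \<inter> space M) = emeasure M A" if A: "A \<in> sets M" for A
  proof -
    obtain B1 where B1: "B1 \<in> sets borel" "{z \<in> space M. F' z \<in> B1} \<subseteq> A" "emeasure M {z \<in> space M. F' z \<in> B1} = emeasure M A"
      using std[OF F'm inj_F' A] by blast
    have compl: "space M - A \<in> sets M" using A by auto
    obtain B2 where B2: "B2 \<in> sets borel" "{z \<in> space M. F' z \<in> B2} \<subseteq> space M - A"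
      "emeasure M {z \<in> space M. F' z \<in> B2} = emeasure M (space M - A)"
      using std[OF F'm inj_F' compl] by blast
    define L where "L = {z \<in> space M. F z \<in> B1}"
    define K where "K = {z \<in> space M. F z \<in> B2}"
    define G where "G = g -` A \<inter> space M"
    have L: "L \<in> sets M" "emeasure M L = emeasure M A" using cyl[OF B1(1)] B1(3) by (auto simp: L_def)
    have K: "K \<in> sets M" "emeasure M K = emeasure M (space M - A)" using cyl[OF B2(1)] B2(3) by (auto simp: K_def)
    have LG: "L \<subseteq> G"
    proof
      fix z assume "z \<in> L"
      then have z: "z \<in> space M" "F z \<in> B1" by (auto simp: L_def)
      then have "g z \<in> {z \<in> space M. F' z \<in> B1}" using g(1) F'g by simp
      then show "z \<in> G" using B1(2) z by (auto simp: G_def)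
    qed
    have GK: "G \<subseteq> space M - K"
    proof
      fix z assume "z \<in> G"
      then have z: "z \<in> space M" "g z \<in> A" by (auto simp: G_def)
      have "z \<notin> K"
      proof
        assume "z \<in> K"
        then have "g z \<in> {z \<in> space M. F' z \<in> B2}" using g(1) F'g z by (simp add: K_def)
        then show False using B2(2) z by auto
      qed
      then show "z \<in> space M - K" using z by simp
    qed
    have "measure M L = measure M A" "measure M K = 1 - measure M A"
      using L K prob_compl[OF A] by (simp_all add: measure_def)
    then have "measure M ((space M - K) - L) = 0"
      using L K LG GK finite_measure_Diff[of "space M - K" L] prob_compl[OF K(1)] by auto
    then have null: "(space M - K) - L \<in> null_sets M"
      using L K by (auto simp: null_sets_def emeasure_eq_measure)
    have GL: "G - L \<in> sets M" by (rule complete[OF _ null]) (use GK in auto)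
    have GL0: "G - L \<in> null_sets M" by (rule null_sets_subset[OF null GL]) (use GK in auto)
    have GU: "G = L \<union> (G - L)" using LG by auto
    have "G \<in> sets M" using GL L GU by (metis sets.Un)
    moreover have "emeasure M G = emeasure M L"
      by (subst GU, rule emeasure_Un_null_set[OF L(1) GL0])
    ultimately show ?thesis using L by (simp add: G_def)
  qed
  have gm: "g \<in> measurable M M" using g(1) pre by (intro measurableI) auto
  have "distr M M g = M"
    by (rule measure_eqI) (use pre gm in \<open>auto simp: emeasure_distr\<close>)
  then show ?thesis using gm wg bij gx by (auto simp: kernel_aut_def)
qed

end

section \<open>Simple graph densities\<close>

context finite_rank_kernel
begin

definition edge_val :: "(nat \<Rightarrow> 'a) \<Rightarrow> nat set \<Rightarrow> real" where
  "edge_val \<eta> e = w (\<eta> (Min e)) (\<eta> (Max e))"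

definition edge_prod :: "nat set set \<Rightarrow> (nat \<Rightarrow> 'a) \<Rightarrow> real" where
  "edge_prod E \<eta> = (\<Prod>e\<in>E. edge_val \<eta> e)"

text \<open>Unlabeling is an iterated integral in the order of a list; the product measure enters
  only in \<open>integrals_at_PiM\<close>.\<close>

definition integrals_at :: "nat list \<Rightarrow> ((nat \<Rightarrow> 'a) \<Rightarrow> real) \<Rightarrow> (nat \<Rightarrow> 'a) \<Rightarrow> real" where
  "integrals_at js P = foldr integral_at js P"

lemma integrals_at_simps[simp]: "integrals_at [] P = P" "integrals_at (j # js) P = integral_at j (integrals_at js P)"
  "integrals_at (js @ js') P = integrals_at js (integrals_at js' P)"
  by (simp_all add: integrals_at_def)

lemma edge_val_pair: "a \<noteq> b \<Longrightarrow> edge_val \<eta> {a, b} = w (\<eta> a) (\<eta> b)"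
  by (cases "a < b") (auto simp: edge_val_def min_def max_def w_sym)

lemma point_poly_edge_prod: "edge_prod E \<in> point_poly"
  unfolding edge_prod_def[abs_def] edge_val_def by (intro point_poly_prod point_poly_w)

lemma point_poly_integrals_at: "P \<in> point_poly \<Longrightarrow> integrals_at js P \<in> point_poly"
  by (induction js) (auto intro: point_poly_integral_at)

lemma indep_integral_at: assumes "indep_of i P \<or> i = j" shows "indep_of i (integral_at j P)"
proof (cases "i = j")
  case True
  then show ?thesis by (simp add: indep_of_def integral_at_def)
next
  case False
  then have "(\<eta>(i := y))(j := z) = (\<eta>(j := z))(i := y)" for \<eta> :: "nat \<Rightarrow> 'a" and y z by (rule fun_upd_twist)
  then show ?thesis using assms False by (simp add: indep_of_def integral_at_def)
qed

lemma indep_integrals_at: "indep_of i P \<or> i \<in> set js \<Longrightarrow> indep_of i (integrals_at js P)"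
  by (induction js) (auto intro: indep_integral_at)

lemma indep_edge_prod: assumes "\<And>e. e \<in> E \<Longrightarrow> card e = 2 \<and> i \<notin> e" shows "indep_of i (edge_prod E)"
proof -
  have "edge_val (\<eta>(i := y)) e = edge_val \<eta> e" if e: "e \<in> E" for \<eta> y e
  proof -
    obtain a b where "e = {a, b}" "a \<noteq> b" using assms[OF e] by (meson card_2_iff)
    then show ?thesis using assms[OF e] by (auto simp: edge_val_pair)
  qed
  then show ?thesis by (simp add: indep_of_def edge_prod_def)
qed

lemma integrals_at_mult_right:
  "(\<And>j. j \<in> set js \<Longrightarrow> indep_of j Q) \<Longrightarrow> integrals_at js (\<lambda>\<eta>. P \<eta> * Q \<eta>) = (\<lambda>\<eta>. integrals_at js P \<eta> * Q \<eta>)"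
  by (induction js) (auto simp: integral_at_indep_mult)

lemma integrals_at_mult_left:
  "(\<And>j. j \<in> set js \<Longrightarrow> indep_of j P) \<Longrightarrow> integrals_at js (\<lambda>\<eta>. P \<eta> * Q \<eta>) = (\<lambda>\<eta>. P \<eta> * integrals_at js Q \<eta>)"
  by (induction js) (auto simp: integral_at_indep_mult)

lemma integrals_at_cmult: "integrals_at js (\<lambda>\<eta>. c * P \<eta>) = (\<lambda>\<eta>. c * integrals_at js P \<eta>)"
  by (induction js) (auto simp: integral_at_cmult)

lemma integral_at_reindex:
  assumes "inj \<sigma>" shows "integral_at (\<sigma> j) (\<lambda>\<eta>. P (\<eta> \<circ> \<sigma>)) \<eta> = integral_at j P (\<eta> \<circ> \<sigma>)"
proof -
  have "(\<eta> \<circ> \<sigma>)(j := y) = (\<eta>(\<sigma> j := y)) \<circ> \<sigma>" for y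
    using assms by (auto simp: fun_eq_iff inj_eq fun_upd_apply)
  then show ?thesis by (simp add: integral_at_def)
qed

lemma integrals_at_reindex:
  assumes "inj \<sigma>" "\<And>j. j \<in> set js \<Longrightarrow> \<sigma> j = j"
  shows "integrals_at js (\<lambda>\<eta>. P (\<eta> \<circ> \<sigma>)) = (\<lambda>\<eta>. integrals_at js P (\<eta> \<circ> \<sigma>))"
  using assms(2)
proof (induction js)
  case (Cons j js)
  have IH: "integrals_at js (\<lambda>\<eta>. P (\<eta> \<circ> \<sigma>)) = (\<lambda>\<eta>. integrals_at js P (\<eta> \<circ> \<sigma>))"
    by (rule Cons.IH) (use Cons.prems in auto)
  have sj: "\<sigma> j = j" using Cons.prems by simp
  have "integral_at j (\<lambda>\<eta>. integrals_at js P (\<eta> \<circ> \<sigma>)) \<zeta> = integral_at j (integrals_at js P) (\<zeta> \<circ> \<sigma>)" for \<zeta>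
    using integral_at_reindex[OF assms(1), of j "integrals_at js P" \<zeta>] unfolding sj .
  then show ?case unfolding integrals_at_simps IH by (rule ext)
qed simp

lemma edge_prod_reindex:
  assumes "inj \<sigma>" "\<And>e. e \<in> E \<Longrightarrow> card e = 2"
  shows "edge_prod E (\<eta> \<circ> \<sigma>) = edge_prod ((`) \<sigma> ` E) \<eta>"
proof -
  have "inj_on ((`) \<sigma>) E" using assms(1) by (auto simp: inj_on_def inj_image_eq_iff)
  then have "edge_prod ((`) \<sigma> ` E) \<eta> = (\<Prod>e\<in>E. edge_val \<eta> (\<sigma> ` e))" by (simp add: edge_prod_def prod.reindex)
  also have "\<dots> = edge_prod E (\<eta> \<circ> \<sigma>)"
    unfolding edge_prod_def
  proof (rule prod.cong[OF refl])
    fix e assume "e \<in> E"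
    then obtain a b where "e = {a, b}" "a \<noteq> b" using assms(2) by (meson card_2_iff)
    then show "edge_val \<eta> (\<sigma> ` e) = edge_val (\<eta> \<circ> \<sigma>) e"
      using assms(1) by (simp add: edge_val_pair inj_eq)
  qed
  finally show ?thesis by simp
qed

text \<open>Renaming of a bound variable to a node on which the function does not depend. It keeps
  labeled and unlabeled nodes in separate ranges.\<close>

lemma integral_at_rename:
  assumes "indep_of N P" "j \<noteq> N"
  shows "integral_at j P = integral_at N (\<lambda>\<eta>. P (\<eta> \<circ> Transposition.transpose j N))"
proof
  fix \<eta> :: "nat \<Rightarrow> 'a"
  have "(\<eta>(N := y)) \<circ> Transposition.transpose j N = (\<eta>(j := y))(N := \<eta> j)" for y
    using assms(2) by (auto simp: fun_eq_iff fun_upd_apply Transposition.transpose_def)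
  then show "integral_at j P \<eta> = integral_at N (\<lambda>\<eta>. P (\<eta> \<circ> Transposition.transpose j N)) \<eta>"
    using assms(1) by (simp add: integral_at_def indep_of_def)
qed

text \<open>Simple graph densities with labeled nodes below \<open>k\<close> and unlabeled nodes in \<open>{A..<B}\<close>, without
  edges between labeled nodes: such graphs can be glued without creating multiple edges.\<close>

inductive_set simple_dens :: "nat \<Rightarrow> nat \<Rightarrow> nat \<Rightarrow> ((nat \<Rightarrow> 'a) \<Rightarrow> real) set" for k A B where
  base: "distinct js \<Longrightarrow> set js \<subseteq> {A..<B} \<Longrightarrow> finite E \<Longrightarrow>
    (\<And>e. e \<in> E \<Longrightarrow> card e = 2 \<and> e \<subseteq> {..<k} \<union> set js \<and> e \<inter> set js \<noteq> {}) \<Longrightarrow>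
    (\<lambda>\<eta>. c * integrals_at js (edge_prod E) \<eta>) \<in> simple_dens k A B"
| add: "P \<in> simple_dens k A B \<Longrightarrow> Q \<in> simple_dens k A B \<Longrightarrow> (\<lambda>\<eta>. P \<eta> + Q \<eta>) \<in> simple_dens k A B"

lemma simple_dens_const: "(\<lambda>_. c) \<in> simple_dens k A B"
  using simple_dens.base[of "[]" A B "{}" k c] by (simp add: edge_prod_def)

lemma simple_dens_mono:
  assumes "k \<le> k'" "C \<le> A" "B \<le> D"
  shows "P \<in> simple_dens k A B \<Longrightarrow> P \<in> simple_dens k' C D"
proof (induction rule: simple_dens.induct)
  case (base js E c)
  show ?case
  proof (rule simple_dens.base)
    show "set js \<subseteq> {C..<D}" using base(2) assms by auto
    have "{..<k} \<union> set js \<subseteq> {..<k'} \<union> set js" using assms by auto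
    then show "card e = 2 \<and> e \<subseteq> {..<k'} \<union> set js \<and> e \<inter> set js \<noteq> {}" if "e \<in> E" for e
      using base(4)[OF that] by (meson subset_trans)
  qed (use base in auto)
qed (auto intro: simple_dens.add)

lemma simple_dens_point_poly: "P \<in> simple_dens k A B \<Longrightarrow> P \<in> point_poly"
  by (induction rule: simple_dens.induct) (intro point_poly.add point_poly.mult point_poly.const point_poly_integrals_at point_poly_edge_prod; assumption)+

lemma simple_dens_sum: "(\<And>i. i \<in> S \<Longrightarrow> P i \<in> simple_dens k A B) \<Longrightarrow> (\<lambda>\<eta>. \<Sum>i\<in>S. P i \<eta>) \<in> simple_dens k A B"
  by (induction S rule: infinite_finite_induct) (auto intro: simple_dens.add simple_dens_const)

text \<open>The unlabeled nodes of the two graphs lie in disjoint intervals and every edge has an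
  unlabeled end. So no edge is shared, and the product of the two edge products belongs to the
  union, which is again simple.\<close>

lemma simple_dens_mult:
  assumes P: "P \<in> simple_dens k A B" and Q: "Q \<in> simple_dens k C D" and kA: "k \<le> A" "A \<le> C" "B \<le> C"
  shows "(\<lambda>\<eta>. P \<eta> * Q \<eta>) \<in> simple_dens k A (max B D)"
  using P
proof (induction rule: simple_dens.induct)
  case (base js E c)
  note b1 = base
  from Q show ?case
  proof (induction rule: simple_dens.induct)
    case (base js' E' c')
    have disj: "set js \<inter> set js' = {}" using b1(2) base(2) kA by fastforce
    have EE: "E \<inter> E' = {}"
    proof (rule ccontr)
      assume "E \<inter> E' \<noteq> {}"
      then obtain e where e: "e \<in> E" "e \<in> E'" by blast
      then obtain i where i: "i \<in> e" "i \<in> set js'" using base(4) by blast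
      then have "i \<in> {..<k} \<union> set js" using b1(4)[OF e(1)] by blast
      then show False using i(2) disj base(2) kA by fastforce
    qed
    have i1: "indep_of j (edge_prod E)" if "j \<in> set js'" for j
    proof (rule indep_edge_prod)
      fix e assume "e \<in> E"
      then have "card e = 2" "e \<subseteq> {..<k} \<union> set js" using b1(4) by blast+
      moreover have "j \<notin> {..<k} \<union> set js" using that disj base(2) kA by fastforce
      ultimately show "card e = 2 \<and> j \<notin> e" by blast
    qed
    have i2: "indep_of j (edge_prod E')" if "j \<in> set js" for j
    proof (rule indep_edge_prod)
      fix e assume "e \<in> E'"
      then have "card e = 2" "e \<subseteq> {..<k} \<union> set js'" using base(4) by blast+
      moreover have "j \<notin> {..<k} \<union> set js'" using that disj b1(2) kA by fastforce
      ultimately show "card e = 2 \<and> j \<notin> e" by blast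
    qed
    have "integrals_at (js @ js') (edge_prod (E \<union> E')) = integrals_at js (integrals_at js' (\<lambda>\<eta>. edge_prod E \<eta> * edge_prod E' \<eta>))"
      using EE b1(3) base(3) by (simp add: edge_prod_def[abs_def] prod.union_disjoint)
    also have "\<dots> = integrals_at js (\<lambda>\<eta>. edge_prod E \<eta> * integrals_at js' (edge_prod E') \<eta>)"
      using integrals_at_mult_left[OF i1] by simp
    also have "\<dots> = (\<lambda>\<eta>. integrals_at js (edge_prod E) \<eta> * integrals_at js' (edge_prod E') \<eta>)"
      using integrals_at_mult_right[of js "integrals_at js' (edge_prod E')"] i2 indep_integrals_at by blast
    finally have eq: "(\<lambda>\<eta>. c * integrals_at js (edge_prod E) \<eta> * (c' * integrals_at js' (edge_prod E') \<eta>)) = (\<lambda>\<eta>. (c * c') * integrals_at (js @ js') (edge_prod (E \<union> E')) \<eta>)"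
      by (simp add: mult_ac)
    show ?case
      unfolding eq
    proof (rule simple_dens.base)
      show "distinct (js @ js')" using b1(1) base(1) disj by simp
      show "set (js @ js') \<subseteq> {A..<max B D}" using b1(2) base(2) kA by fastforce
      show "card e = 2 \<and> e \<subseteq> {..<k} \<union> set (js @ js') \<and> e \<inter> set (js @ js') \<noteq> {}" if "e \<in> E \<union> E'" for e
        using that b1(4)[of e] base(4)[of e] unfolding set_append by blast
    qed (use b1 base in auto)
  next
    case (add Q Q')
    then show ?case using simple_dens.add by (simp add: distrib_left)
  qed
next
  case (add P P')
  then show ?case using simple_dens.add by (simp add: distrib_right)
qed

text \<open>The formerly labeled node \<open>j\<close> lies below \<open>k\<close>, outside the
  range of unlabeled nodes, and must be moved there. Starting the interval at \<open>Suc N\<close>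
  leaves the slot \<open>N\<close> free for it.\<close>

lemma simple_dens_int:
  assumes P: "P \<in> simple_dens k (Suc N) B" and j: "j < k" "k \<le> N"
  shows "integral_at j P \<in> simple_dens k N (max B (Suc N))"
  using P
proof (induction rule: simple_dens.induct)
  case (base js E c)
  define \<sigma> where "\<sigma> = Transposition.transpose j N"
  have inj: "inj \<sigma>" by (simp add: \<sigma>_def)
  have js: "\<sigma> i = i" if "i \<in> set js" for i
    using that base(2) j by (auto simp: \<sigma>_def Transposition.transpose_def)
  have N: "N \<notin> {..<k} \<union> set js" using base(2) j by auto
  have "indep_of N (edge_prod E)" by (rule indep_edge_prod) (use base(4) N in blast)
  then have "indep_of N (integrals_at js (edge_prod E))" by (intro indep_integrals_at) auto
  then have "integral_at j (integrals_at js (edge_prod E)) = integral_at N (\<lambda>\<eta>. integrals_at js (edge_prod E) (\<eta> \<circ> \<sigma>))"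
    unfolding \<sigma>_def using j by (intro integral_at_rename) auto
  also have "(\<lambda>\<eta>. integrals_at js (edge_prod E) (\<eta> \<circ> \<sigma>)) = integrals_at js (\<lambda>\<eta>. edge_prod E (\<eta> \<circ> \<sigma>))"
    using integrals_at_reindex[OF inj js] by simp
  also have "(\<lambda>\<eta>. edge_prod E (\<eta> \<circ> \<sigma>)) = edge_prod ((`) \<sigma> ` E)" using edge_prod_reindex[OF inj] base(4) by blast
  finally have eq: "integral_at j (\<lambda>\<eta>. c * integrals_at js (edge_prod E) \<eta>) = (\<lambda>\<eta>. c * integrals_at (N # js) (edge_prod ((`) \<sigma> ` E)) \<eta>)"
    by (simp add: integral_at_cmult)
  show ?case
    unfolding eq
  proof (rule simple_dens.base)
    show "distinct (N # js)" using base(1) N by auto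
    show "set (N # js) \<subseteq> {N..<max B (Suc N)}" using base(2) by fastforce
    show "finite ((`) \<sigma> ` E)" using base(3) by simp
    fix e' assume "e' \<in> (`) \<sigma> ` E"
    then obtain e where e: "e \<in> E" "e' = \<sigma> ` e" by blast
    have "card e' = 2" using e base(4)[OF e(1)] inj card_image[of \<sigma> e] by (simp add: inj_on_subset)
    moreover have "\<sigma> i \<in> {..<k} \<union> set (N # js)" if "i \<in> {..<k} \<union> set js" for i
    proof (cases "i \<in> set js")
      case True
      then show ?thesis using js by simp
    next
      case False
      then show ?thesis using that j by (auto simp: \<sigma>_def Transposition.transpose_def)
    qed
    moreover obtain i where "i \<in> e" "i \<in> set js" using base(4)[OF e(1)] by blast
    moreover have "i \<in> e'"
    proof -
      have "\<sigma> i \<in> e'" using e(2) \<open>i \<in> e\<close> by simp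
      then show ?thesis using js[OF \<open>i \<in> set js\<close>] by simp
    qed
    moreover have "e \<subseteq> {..<k} \<union> set js" using base(4)[OF e(1)] by blast
    ultimately have 1: "card e' = 2" and 2: "e' \<subseteq> {..<k} \<union> set (N # js)" and 3: "i \<in> e'" "i \<in> set (N # js)"
      using e(2) by (simp, blast, simp, simp)
    then show "card e' = 2 \<and> e' \<subseteq> {..<k} \<union> set (N # js) \<and> e' \<inter> set (N # js) \<noteq> {}" by blast
  qed
next
  case (add P Q)
  then show ?case using simple_dens.add by (simp add: integral_at_add simple_dens_point_poly)
qed

text \<open>The kernel of the power \<open>Suc m\<close> of the operator, that is, the density of a
  path with \<open>m\<close> inner nodes between two labeled ends.\<close>

definition path_kernel :: "nat \<Rightarrow> 'a \<Rightarrow> 'a \<Rightarrow> real" where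
  "path_kernel m x y = (\<Sum>i<t. l i ^ Suc m * f i x * f i y)"

lemma path_kernel_0: "path_kernel 0 = w" by (simp add: path_kernel_def w_def fun_eq_iff)

lemma path_kernel_Suc: "(\<integral>z. w x z * path_kernel m z y \<partial>M) = path_kernel (Suc m) x y"
proof -
  have "(\<integral>z. w x z * path_kernel m z y \<partial>M) = (\<integral>z. (\<Sum>i<t. \<Sum>j<t. (l i * l j ^ Suc m * f i x * f j y) * (f i z * f j z)) \<partial>M)"
    by (simp add: w_def path_kernel_def sum_product mult_ac)
  also have "\<dots> = (\<Sum>i<t. \<Sum>j<t. (l i * l j ^ Suc m * f i x * f j y) * (\<integral>z. f i z * f j z \<partial>M))"
    by (simp add: bounded_meas_integrable bounded_meas_mult f_bounded_meas)
  also have "\<dots> = (\<Sum>i<t. l i * l i ^ Suc m * f i x * f i y)"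
    by (intro sum.cong refl)
      (simp add: f_orth if_distrib[of "\<lambda>x. _ * x"] sum.delta cong: if_cong)
  finally show ?thesis by (simp add: path_kernel_def)
qed

fun path_edges :: "nat \<Rightarrow> nat \<Rightarrow> nat \<Rightarrow> nat \<Rightarrow> nat set set" where
  "path_edges i 0 N j = {{i, j}}"
| "path_edges i (Suc m) N j = insert {i, N} (path_edges N m (Suc N) j)"

text \<open>All claims are proved together by removing the first edge. The requirement of an inner
  node excludes the single edge, which joins two labeled nodes and could become a double edge in a
  product.\<close>

lemma path_edges:
  assumes "i \<noteq> j" "i < N" "j < N"
  shows "finite (path_edges i m N j)"
    and "e \<in> path_edges i m N j \<Longrightarrow> card e = 2 \<and> e \<subseteq> {i, j} \<union> {N..<N+m}"
    and "m > 0 \<Longrightarrow> e \<in> path_edges i m N j \<Longrightarrow> e \<inter> {N..<N+m} \<noteq> {}"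
    and "integrals_at [N..<N+m] (edge_prod (path_edges i m N j)) = (\<lambda>\<eta>. path_kernel m (\<eta> i) (\<eta> j))"
proof -
  have "finite (path_edges i m N j) \<and>
    (\<forall>e\<in>path_edges i m N j. card e = 2 \<and> e \<subseteq> {i, j} \<union> {N..<N+m} \<and> (m > 0 \<longrightarrow> e \<inter> {N..<N+m} \<noteq> {})) \<and>
    integrals_at [N..<N+m] (edge_prod (path_edges i m N j)) = (\<lambda>\<eta>. path_kernel m (\<eta> i) (\<eta> j))"
    using assms
  proof (induction m arbitrary: i N)
    case 0
    then show ?case by (auto simp: edge_prod_def[abs_def] edge_val_pair path_kernel_0)
  next
    case (Suc m)
    let ?E = "path_edges N m (Suc N) j"
    have IH: "finite ?E" "\<And>e. e \<in> ?E \<Longrightarrow> card e = 2 \<and> e \<subseteq> {N, j} \<union> {Suc N..<Suc N+m} \<and> (m > 0 \<longrightarrow> e \<inter> {Suc N..<Suc N+m} \<noteq> {})"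
      "integrals_at [Suc N..<Suc N+m] (edge_prod ?E) = (\<lambda>\<eta>. path_kernel m (\<eta> N) (\<eta> j))"
      using Suc.IH[of N "Suc N"] Suc.prems by auto
    have "i \<notin> {N, j} \<union> {Suc N..<Suc N+m}" using Suc.prems by auto
    then have notin: "{i, N} \<notin> ?E" using IH(2) by blast
    have one: "{i, N} \<inter> {N..<N+Suc m} \<noteq> {}" "{i, N} \<subseteq> {i, j} \<union> {N..<N+Suc m}" by auto
    have touch: "e \<inter> {N..<N+Suc m} \<noteq> {} \<and> e \<subseteq> {i, j} \<union> {N..<N+Suc m}" if "e \<in> ?E" for e
    proof (cases m)
      case 0
      then show ?thesis using that by auto
    next
      case (Suc m')
      have "{Suc N..<Suc N+m} \<subseteq> {N..<N+Suc m}" "N \<in> {N..<N+Suc m}" by auto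
      then show ?thesis using IH(2)[OF that] Suc by blast
    qed
    have EPi: "edge_prod (insert {i, N} ?E) = (\<lambda>\<eta>. w (\<eta> i) (\<eta> N) * edge_prod ?E \<eta>)"
      using IH(1) notin Suc.prems by (auto simp: edge_prod_def[abs_def] edge_val_pair)
    have "indep_of j' (\<lambda>\<eta>. w (\<eta> i) (\<eta> N))" if "j' \<in> set [Suc N..<Suc N+m]" for j'
      using that Suc.prems by (auto simp: indep_of_def)
    then have "integrals_at [Suc N..<Suc N+m] (edge_prod (insert {i, N} ?E)) = (\<lambda>\<eta>. w (\<eta> i) (\<eta> N) * path_kernel m (\<eta> N) (\<eta> j))"
      unfolding EPi by (subst integrals_at_mult_left) (auto simp: IH(3)[simplified])
    moreover have "[N..<N + Suc m] = N # [Suc N..<Suc N+m]" by (simp add: upt_conv_Cons)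
    ultimately have "integrals_at [N..<N + Suc m] (edge_prod (path_edges i (Suc m) N j)) = integral_at N (\<lambda>\<eta>. w (\<eta> i) (\<eta> N) * path_kernel m (\<eta> N) (\<eta> j))"
      by simp
    also have "\<dots> = (\<lambda>\<eta>. path_kernel (Suc m) (\<eta> i) (\<eta> j))"
      using Suc.prems by (simp add: integral_at_def path_kernel_Suc)
    finally show ?case using IH(1,2) one touch Suc.prems by (simp add: card_insert_if)
  qed
  then show "finite (path_edges i m N j)"
    and "e \<in> path_edges i m N j \<Longrightarrow> card e = 2 \<and> e \<subseteq> {i, j} \<union> {N..<N+m}"
    and "m > 0 \<Longrightarrow> e \<in> path_edges i m N j \<Longrightarrow> e \<inter> {N..<N+m} \<noteq> {}"
    and "integrals_at [N..<N+m] (edge_prod (path_edges i m N j)) = (\<lambda>\<eta>. path_kernel m (\<eta> i) (\<eta> j))"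
    by blast+
qed

text \<open>Interpolating \<open>1/s\<close> at the eigenvalues expresses an edge by paths of length at least two, which
  is how multiple edges are replaced by simple graphs.\<close>

lemma w_paths: "\<exists>n c. \<forall>x y. w x y = (\<Sum>m<n. c m * path_kernel (Suc m) x y)"
proof -
  \<comment> \<open>The shortest path used has two edges and weight \<open>l i\<close> squared;
    multiplying this by \<open>1 / l i\<close> gives back the weight \<open>l i\<close> of an
    edge.\<close>
  obtain n c where c: "\<And>a. a \<in> l ` {..<t} \<Longrightarrow> (\<Sum>m<n. c m * a ^ m) = 1 / a"
    using poly_interpolation[of "l ` {..<t}" "\<lambda>a. 1 / a"] by auto
  have "w x y = (\<Sum>m<n. c m * path_kernel (Suc m) x y)" for x y
  proof -
    have "(\<Sum>m<n. c m * path_kernel (Suc m) x y) = (\<Sum>i<t. \<Sum>m<n. c m * (l i ^ Suc (Suc m) * f i x * f i y))"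
      unfolding path_kernel_def sum_distrib_left by (rule sum.swap)
    also have "\<dots> = (\<Sum>i<t. (l i)\<^sup>2 * (\<Sum>m<n. c m * l i ^ m) * f i x * f i y)"
      by (simp add: sum_distrib_left sum_distrib_right power2_eq_square mult_ac)
    also have "\<dots> = w x y"
      unfolding w_def using c l_nz by (intro sum.cong refl) (simp add: power2_eq_square)
    finally show ?thesis by simp
  qed
  then show ?thesis by blast
qed

text \<open>The start \<open>N\<close> of the unlabeled nodes is left free, with only their end
  existential. In a product the second factor is then placed beyond the nodes of the first; in an
  integral one slot is reserved below.\<close>

lemma multi_dens_simple_dens: "P \<in> multi_dens \<Longrightarrow> \<exists>k. \<forall>N\<ge>k. \<exists>B. P \<in> simple_dens k N B"
proof (induction rule: multi_dens.induct)
  case (const c)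
  show ?case using simple_dens_const by blast
next
  case (edge i j)
  obtain n c where c: "\<And>x y. w x y = (\<Sum>m<n. c m * path_kernel (Suc m) x y)" using w_paths by blast
  define k where "k = Suc (max i j)"
  have "(\<lambda>\<eta>. w (\<eta> i) (\<eta> j)) \<in> simple_dens k N (N + n)" if N: "N \<ge> k" for N
    unfolding c
  proof (rule simple_dens_sum)
    fix m assume m: "m \<in> {..<n}"
    have ij: "i \<noteq> j" "i < N" "j < N" using edge N by (auto simp: k_def)
    have "(\<lambda>\<eta>. c m * integrals_at [N..<N + Suc m] (edge_prod (path_edges i (Suc m) N j)) \<eta>) \<in> simple_dens k N (N + n)"
    proof (rule simple_dens.base)
      show "set [N..<N + Suc m] \<subseteq> {N..<N + n}" using m by auto
      show "card e = 2 \<and> e \<subseteq> {..<k} \<union> set [N..<N + Suc m] \<and> e \<inter> set [N..<N + Suc m] \<noteq> {}"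
        if "e \<in> path_edges i (Suc m) N j" for e
      proof -
        have "{i, j} \<subseteq> {..<k}" by (auto simp: k_def)
        then show ?thesis using path_edges(2,3)[OF ij, where e = e and m = "Suc m"] that unfolding set_upt by blast
      qed
      show "finite (path_edges i (Suc m) N j)" by (rule path_edges(1)[OF ij])
    qed (rule distinct_upt)
    then show "(\<lambda>\<eta>. c m * path_kernel (Suc m) (\<eta> i) (\<eta> j)) \<in> simple_dens k N (N + n)"
      unfolding path_edges(4)[OF ij] .
  qed
  then show ?case by blast
next
  case (add P Q)
  then obtain k k' where k: "\<forall>N\<ge>k. \<exists>B. P \<in> simple_dens k N B" "\<forall>N\<ge>k'. \<exists>B. Q \<in> simple_dens k' N B" by blast
  have "\<exists>B. (\<lambda>\<eta>. P \<eta> + Q \<eta>) \<in> simple_dens (max k k') N B" if N: "N \<ge> max k k'" for N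
  proof -
    obtain B B' where "P \<in> simple_dens k N B" "Q \<in> simple_dens k' N B'" using k N by (meson max.boundedE)
    then have "P \<in> simple_dens (max k k') N (max B B')" "Q \<in> simple_dens (max k k') N (max B B')"
      by (auto intro: simple_dens_mono[rotated -1])
    then show ?thesis using simple_dens.add by blast
  qed
  then show ?case by blast
next
  case (mult P Q)
  then obtain k k' where k: "\<forall>N\<ge>k. \<exists>B. P \<in> simple_dens k N B" "\<forall>N\<ge>k'. \<exists>B. Q \<in> simple_dens k' N B" by blast
  have "\<exists>B. (\<lambda>\<eta>. P \<eta> * Q \<eta>) \<in> simple_dens (max k k') N B" if N: "N \<ge> max k k'" for N
  proof -
    obtain B where B: "P \<in> simple_dens k N B" using k N by (meson max.boundedE)
    have "max N B \<ge> k'" using N by (simp add: le_max_iff_disj)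
    then obtain D where D: "Q \<in> simple_dens k' (max N B) D" using k by blast
    have "P \<in> simple_dens (max k k') N B" "Q \<in> simple_dens (max k k') (max N B) D"
      using B D by (auto intro: simple_dens_mono[rotated -1])
    then have "(\<lambda>\<eta>. P \<eta> * Q \<eta>) \<in> simple_dens (max k k') N (max B D)"
      using N by (intro simple_dens_mult) auto
    then show ?thesis by blast
  qed
  then show ?case by blast
next
  case (int P j)
  then obtain k where k: "\<forall>N\<ge>k. \<exists>B. P \<in> simple_dens k N B" by blast
  have "\<exists>B. integral_at j P \<in> simple_dens (max k (Suc j)) N B" if N: "N \<ge> max k (Suc j)" for N
  proof -
    have "Suc N \<ge> k" using N by simp
    then obtain B where "P \<in> simple_dens k (Suc N) B" using k by blast
    then have "P \<in> simple_dens (max k (Suc j)) (Suc N) B" by (auto intro: simple_dens_mono[rotated -1])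
    then show ?thesis using simple_dens_int N by (metis less_Suc_eq_le max.cobounded2 max.orderE max_def not_less)
  qed
  then show ?case by blast
qed

definition one_label_dens :: "('a \<Rightarrow> real) set" where
  "one_label_dens = {\<lambda>x. integrals_at js (edge_prod E) (\<lambda>_. x) | js V E.
     one_labeled_graph V E \<and> distinct js \<and> set js = V - {1}}"

text \<open>The simple graphs obtained still have several labeled nodes, although the sum depends on
  node 1 only. Integrating out all other labels leaves the sum unchanged and makes every summand a
  one-labeled density.\<close>

lemma density_algebra_one_label_dens:
  assumes "a \<in> density_algebra"
  shows "\<exists>n c \<phi>. (\<forall>i<n. \<phi> i \<in> one_label_dens) \<and> (\<forall>x. a x = (\<Sum>i<n::nat. c i * \<phi> i x))"
proof -
  obtain k where k: "\<forall>N\<ge>k. \<exists>B. (\<lambda>\<eta>. a (\<eta> 1)) \<in> simple_dens k N B"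
    using multi_dens_simple_dens assms unfolding density_algebra_def by blast
  \<comment> \<open>At least 2, so that node 1 counts among the labeled nodes.\<close>
  define k' where "k' = max k 2"
  have "k' \<ge> k" by (simp add: k'_def)
  then obtain B where "(\<lambda>\<eta>. a (\<eta> 1)) \<in> simple_dens k k' B" using k by blast
  then have aG: "(\<lambda>\<eta>. a (\<eta> 1)) \<in> simple_dens k' k' B" using \<open>k' \<ge> k\<close> by (auto intro: simple_dens_mono[rotated -1])
  define js0 where "js0 = 0 # [2..<k']"
  have js0: "distinct js0" "set js0 = {..<k'} - {1}" by (auto simp: js0_def k'_def)
  have "\<exists>n c \<phi>. (\<forall>i<n. \<phi> i \<in> one_label_dens) \<and> (\<forall>x. integrals_at js0 P (\<lambda>_. x) = (\<Sum>i<n::nat. c i * \<phi> i x))"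
    if "P \<in> simple_dens k' k' B" for P
    using that
  proof induction
    case (base js E c)
    define V where "V = {..<k'} \<union> set js"
    have "one_labeled_graph V E"
      unfolding one_labeled_graph_def using base by (auto simp: V_def k'_def)
    moreover have ge: "x \<ge> k'" if "x \<in> set js" for x using base(2) that by auto
    moreover have "distinct (js0 @ js)" using base(1) js0 ge by fastforce
    moreover have "set (js0 @ js) = V - {1}"
    proof -
      have "2 \<le> k'" by (simp add: k'_def)
      then have "1 \<notin> set js" using ge[of 1] by auto
      then show ?thesis using js0 by (auto simp: V_def)
    qed
    ultimately have "(\<lambda>x. integrals_at (js0 @ js) (edge_prod E) (\<lambda>_. x)) \<in> one_label_dens" unfolding one_label_dens_def by blast
    then show ?case
      by (intro exI[of _ 1] exI[of _ "\<lambda>_. c"] exI[of _ "\<lambda>_ x. integrals_at (js0 @ js) (edge_prod E) (\<lambda>_. x)"]) (simp add: integrals_at_cmult)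
  next
    case (add P Q)
    from add.IH(1) obtain n c \<phi> where 1: "\<And>i. i < n \<Longrightarrow> \<phi> i \<in> one_label_dens" "\<And>x. integrals_at js0 P (\<lambda>_. x) = (\<Sum>i<n::nat. c i * \<phi> i x)" by blast
    from add.IH(2) obtain m d \<psi> where 2: "\<And>i. i < m \<Longrightarrow> \<psi> i \<in> one_label_dens" "\<And>x. integrals_at js0 Q (\<lambda>_. x) = (\<Sum>i<m::nat. d i * \<psi> i x)" by blast
    have dist: "integrals_at js (\<lambda>\<eta>. P \<eta> + Q \<eta>) = (\<lambda>\<eta>. integrals_at js P \<eta> + integrals_at js Q \<eta>)" for js
      by (induction js) (auto simp: integral_at_add point_poly_integrals_at simple_dens_point_poly[OF add.hyps(1)] simple_dens_point_poly[OF add.hyps(2)])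
    define e where "e = (\<lambda>i. if i < n then c i else d (i - n))"
    define \<theta> where "\<theta> = (\<lambda>i. if i < n then \<phi> i else \<psi> (i - n))"
    have "(\<Sum>i<n+m. e i * \<theta> i x) = (\<Sum>i<n. c i * \<phi> i x) + (\<Sum>i<m. d i * \<psi> i x)" for x
    proof -
      have "(\<Sum>i<n+m. e i * \<theta> i x) = (\<Sum>i<n. e i * \<theta> i x) + (\<Sum>i=n..<n+m. e i * \<theta> i x)"
        by (metis atLeast0LessThan le0 le_add1 sum.atLeastLessThan_concat)
      also have "(\<Sum>i=n..<n+m. e i * \<theta> i x) = (\<Sum>i<m. d i * \<psi> i x)"
        using sum.shift_bounds_nat_ivl[of "\<lambda>i. e i * \<theta> i x" 0 n m]
        by (simp add: e_def \<theta>_def atLeast0LessThan add.commute)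
      finally show ?thesis by (simp add: e_def \<theta>_def)
    qed
    moreover have "\<theta> i \<in> one_label_dens" if "i < n + m" for i using 1(1) 2(1) that by (auto simp: \<theta>_def)
    ultimately show ?case using 1(2) 2(2)
      by (intro exI[of _ "n + m"] exI[of _ e] exI[of _ \<theta>]) (simp add: dist)
  qed
  from this[OF aG] obtain n c \<phi> where *: "\<forall>i<n. \<phi> i \<in> one_label_dens"
    "\<forall>x. integrals_at js0 (\<lambda>\<eta>. a (\<eta> 1)) (\<lambda>_. x) = (\<Sum>i<n::nat. c i * \<phi> i x)" by blast
  have "integrals_at js (\<lambda>\<eta>. a (\<eta> 1)) = (\<lambda>\<eta>. a (\<eta> 1))" if "1 \<notin> set js" for js
    using that by (induction js) (auto simp: integral_at_indep indep_of_def)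
  from this[of js0] have "integrals_at js0 (\<lambda>\<eta>. a (\<eta> 1)) = (\<lambda>\<eta>. a (\<eta> 1))" using js0 by simp
  then show ?thesis using * by metis
qed

lemma point_poly_override_measurable:
  assumes "P \<in> point_poly" "finite K"
  shows "(\<lambda>\<zeta>. P (\<lambda>i. if i \<in> K then \<zeta> i else \<eta> i)) \<in> borel_measurable (Pi\<^sub>M K (\<lambda>_. M)) \<and>
    (\<exists>C. \<forall>\<zeta>\<in>space (Pi\<^sub>M K (\<lambda>_. M)). \<bar>P (\<lambda>i. if i \<in> K then \<zeta> i else \<eta> i)\<bar> \<le> C)"
  using assms(1)
proof induction
  case (const c)
  then show ?case by auto
next
  case (f i j)
  obtain C where C: "\<And>x. x \<in> space M \<Longrightarrow> \<bar>f i x\<bar> \<le> C" using f_bounded_meas[of i] by (auto simp: bounded_meas_def)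
  show ?case
  proof (cases "j \<in> K")
    case True
    then have [measurable]: "(\<lambda>\<zeta>. \<zeta> j) \<in> measurable (Pi\<^sub>M K (\<lambda>_. M)) M" by simp
    have "(\<lambda>\<zeta>. f i (\<zeta> j)) \<in> borel_measurable (Pi\<^sub>M K (\<lambda>_. M))" by measurable
    moreover have "\<forall>\<zeta>\<in>space (Pi\<^sub>M K (\<lambda>_. M)). \<bar>f i (\<zeta> j)\<bar> \<le> C"
      using C True by (auto simp: space_PiM PiE_def Pi_def)
    ultimately show ?thesis using True by auto
  qed auto
next
  case (add P Q)
  from add.IH obtain C D where CD:
    "\<And>\<zeta>. \<zeta> \<in> space (Pi\<^sub>M K (\<lambda>_. M)) \<Longrightarrow> \<bar>P (\<lambda>i. if i \<in> K then \<zeta> i else \<eta> i)\<bar> \<le> C"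
    "\<And>\<zeta>. \<zeta> \<in> space (Pi\<^sub>M K (\<lambda>_. M)) \<Longrightarrow> \<bar>Q (\<lambda>i. if i \<in> K then \<zeta> i else \<eta> i)\<bar> \<le> D" by blast
  have "\<bar>P (\<lambda>i. if i \<in> K then \<zeta> i else \<eta> i) + Q (\<lambda>i. if i \<in> K then \<zeta> i else \<eta> i)\<bar> \<le> C + D"
    if "\<zeta> \<in> space (Pi\<^sub>M K (\<lambda>_. M))" for \<zeta>
    using CD[OF that] by linarith
  then show ?case using add.IH by (intro conjI borel_measurable_add exI[of _ "C + D"]) auto
next
  case (mult P Q)
  from mult.IH obtain C D where CD:
    "\<And>\<zeta>. \<zeta> \<in> space (Pi\<^sub>M K (\<lambda>_. M)) \<Longrightarrow> \<bar>P (\<lambda>i. if i \<in> K then \<zeta> i else \<eta> i)\<bar> \<le> C"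
    "\<And>\<zeta>. \<zeta> \<in> space (Pi\<^sub>M K (\<lambda>_. M)) \<Longrightarrow> \<bar>Q (\<lambda>i. if i \<in> K then \<zeta> i else \<eta> i)\<bar> \<le> D" by blast
  have "\<bar>P (\<lambda>i. if i \<in> K then \<zeta> i else \<eta> i) * Q (\<lambda>i. if i \<in> K then \<zeta> i else \<eta> i)\<bar> \<le> C * D"
    if "\<zeta> \<in> space (Pi\<^sub>M K (\<lambda>_. M))" for \<zeta>
    unfolding abs_mult using CD[OF that] by (intro mult_mono) auto
  then show ?case using mult.IH by (intro conjI borel_measurable_times exI[of _ "C * D"]) auto
qed

text \<open>Fubini's theorem one node at a time. The last node of the list is integrated innermost,
  hence induction from the end.\<close>

lemma integrals_at_PiM:
  assumes "P \<in> point_poly" "distinct js"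
  shows "integrals_at js P \<eta> = (\<integral>\<zeta>. P (\<lambda>i. if i \<in> set js then \<zeta> i else \<eta> i) \<partial>Pi\<^sub>M (set js) (\<lambda>_. M))"
  using assms
proof (induction js arbitrary: P rule: rev_induct)
  case Nil
  interpret P: prob_space "Pi\<^sub>M {} (\<lambda>_. M)" by (intro prob_space_PiM prob_space_axioms)
  show ?case by (simp add: P.prob_space)
next
  case (snoc j js)
  interpret PS: product_sigma_finite "\<lambda>_. M" by standard
  interpret P: prob_space "Pi\<^sub>M (set (js @ [j])) (\<lambda>_. M)" by (intro prob_space_PiM prob_space_axioms)
  define h where "h = (\<lambda>\<zeta>. P (\<lambda>i. if i \<in> set (js @ [j]) then \<zeta> i else \<eta> i))"
  obtain C where hm: "h \<in> borel_measurable (Pi\<^sub>M (set (js @ [j])) (\<lambda>_. M))"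
    and C: "\<And>\<zeta>. \<zeta> \<in> space (Pi\<^sub>M (set (js @ [j])) (\<lambda>_. M)) \<Longrightarrow> \<bar>h \<zeta>\<bar> \<le> C"
    using point_poly_override_measurable[OF snoc.prems(1), of "set (js @ [j])" \<eta>] unfolding h_def by auto
  have "integrable (Pi\<^sub>M (set (js @ [j])) (\<lambda>_. M)) h"
    using hm C by (intro P.integrable_const_bound[where B = C]) auto
  moreover have ins: "set (js @ [j]) = insert j (set js)" by auto
  ultimately have "(\<integral>\<zeta>. h \<zeta> \<partial>Pi\<^sub>M (set (js @ [j])) (\<lambda>_. M)) = (\<integral>\<zeta>. \<integral>y. h (\<zeta>(j := y)) \<partial>M \<partial>Pi\<^sub>M (set js) (\<lambda>_. M))"
    using PS.product_integral_insert[of "set js" j h] snoc.prems(2) by simp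
  also have "\<dots> = (\<integral>\<zeta>. integral_at j P (\<lambda>i. if i \<in> set js then \<zeta> i else \<eta> i) \<partial>Pi\<^sub>M (set js) (\<lambda>_. M))"
  proof -
    have "(\<lambda>i. if i \<in> set (js @ [j]) then (\<zeta>(j := y)) i else \<eta> i) = (\<lambda>i. if i \<in> set js then \<zeta> i else \<eta> i)(j := y)" for \<zeta> y
      using snoc.prems(2) by (auto simp: fun_eq_iff fun_upd_apply)
    then show ?thesis unfolding h_def integral_at_def by simp
  qed
  also have "\<dots> = integrals_at js (integral_at j P) \<eta>"
    using snoc.IH[of "integral_at j P"] snoc.prems point_poly_integral_at by simp
  finally show ?case by (simp add: h_def)
qed

end

section \<open>The spectral decomposition\<close>

context prob_space
begin

lemma indicator_bounded_meas: "A \<in> sets M \<Longrightarrow> indicator A \<in> bounded_meas"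
  by (auto simp: bounded_meas_def indicator_def intro!: exI[of _ 1])

lemma AE_eq_square_zero:
  assumes "a \<in> bounded_meas" "(\<integral>x. a x * a x \<partial>M) = 0" shows "AE x in M. a x = 0"
proof -
  have "integrable M (\<lambda>x. a x * a x)" using assms by (intro bounded_meas_integrable bounded_meas_mult)
  then have "AE x in M. a x * a x = 0"
    using assms(2) by (subst integral_nonneg_eq_0_iff_AE[symmetric]) auto
  then show ?thesis by simp
qed

lemma square_integrable_imp_integrable:
  assumes that: "square_integrable M a" shows "integrable M a"
proof -
  have "integrable M (\<lambda>x. 1 + (a x)\<^sup>2)" using that by (simp add: square_integrable_def)
  then show ?thesis
  proof (rule Bochner_Integration.integrable_bound)
    have "\<bar>s\<bar> \<le> 1 + s\<^sup>2" for s :: real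
    proof -
      have "0 \<le> (\<bar>s\<bar> - 1)\<^sup>2" "0 \<le> s\<^sup>2" by simp_all
      then show ?thesis by (simp add: power2_eq_square algebra_simps abs_mult_self_eq)
    qed
    then show "AE x in M. norm (a x) \<le> norm (1 + (a x)\<^sup>2)" by simp
  qed (use that in \<open>simp add: square_integrable_def\<close>)
qed

text \<open>Dependence is meant almost everywhere: a function whose remainder has norm zero
  contributes no new vector.\<close>

lemma gram_schmidt:
  fixes g :: "nat \<Rightarrow> 'a \<Rightarrow> real"
  assumes "\<And>i. i < n \<Longrightarrow> g i \<in> bounded_meas"
  shows "\<exists>m e. (\<forall>j. e j \<in> bounded_meas) \<and> (\<forall>j<m. \<forall>k<m. (\<integral>x. e j x * e k x \<partial>M) = (if j = k then 1 else 0)) \<and>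
    (\<forall>i<n. \<exists>c. AE x in M. g i x = (\<Sum>j<m::nat. c j * e j x))"
  using assms
proof (induction n)
  case 0
  show ?case by (intro exI[of _ 0] exI[of _ "\<lambda>_ _. 0"]) (auto intro: bounded_meas_const)
next
  case (Suc n)
  have "\<And>i. i < n \<Longrightarrow> g i \<in> bounded_meas" using Suc.prems by simp
  from Suc.IH[OF this] obtain m e where e: "\<And>j. e j \<in> bounded_meas"
    and on: "\<And>j k. j < m \<Longrightarrow> k < m \<Longrightarrow> (\<integral>x. e j x * e k x \<partial>M) = (if j = k then 1 else 0)"
    and sp: "\<And>i. i < n \<Longrightarrow> \<exists>c. AE x in M. g i x = (\<Sum>j<m::nat. c j * e j x)" by blast
  have gn: "g n \<in> bounded_meas" using Suc by simp
  define d where "d = (\<lambda>j. \<integral>x. g n x * e j x \<partial>M)"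
  define h where "h = (\<lambda>x. g n x + (-1) * (\<Sum>j<m. d j * e j x))"
  have h: "h \<in> bounded_meas" unfolding h_def by (intro bounded_meas_lin bounded_meas_sum bounded_meas_cmult gn e)
  have he: "(\<integral>x. h x * e k x \<partial>M) = 0" if k: "k < m" for k
  proof -
    have "(\<integral>x. h x * e k x \<partial>M) = (\<integral>x. g n x * e k x - (\<Sum>j<m. d j * (e j x * e k x)) \<partial>M)"
      by (simp add: h_def left_diff_distrib sum_distrib_right mult.assoc)
    also have "\<dots> = d k - (\<Sum>j<m. d j * (\<integral>x. e j x * e k x \<partial>M))"
      by (simp add: bounded_meas_integrable bounded_meas_mult gn e d_def)
    also have "\<dots> = 0" using k by (simp add: on if_distrib[of "\<lambda>x. _ * x"] sum.delta cong: if_cong)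
    finally show ?thesis .
  qed
  show ?case
  proof (cases "(\<integral>x. h x * h x \<partial>M) = 0")
    case True
    have "AE x in M. g n x = (\<Sum>j<m. d j * e j x)"
      using AE_eq_square_zero[OF h True] by eventually_elim (simp add: h_def)
    then have "\<exists>c. AE x in M. g i x = (\<Sum>j<m. c j * e j x)" if "i < Suc n" for i
      using sp that by (auto simp: less_Suc_eq)
    then show ?thesis using e on by (intro exI[of _ m] exI[of _ e]) simp
  next
    case False
    have "(\<integral>x. h x * h x \<partial>M) \<ge> 0" by (rule Bochner_Integration.integral_nonneg) simp
    then have pos: "(\<integral>x. h x * h x \<partial>M) > 0" using False by linarith
    define r where "r = sqrt (\<integral>x. h x * h x \<partial>M)"
    have r: "r > 0" "r * r = (\<integral>x. h x * h x \<partial>M)" using pos by (auto simp: r_def)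
    define e' where "e' = e(m := (\<lambda>x. (1 / r) * h x))"
    have e'B: "e' j \<in> bounded_meas" for j using e bounded_meas_cmult[OF h, of "1 / r"] by (simp add: e'_def fun_upd_apply)
    have hh: "(\<integral>x. ((1 / r) * h x) * ((1 / r) * h x) \<partial>M) = 1"
    proof -
      have "(\<integral>x. ((1 / r) * h x) * ((1 / r) * h x) \<partial>M) = (\<integral>x. (1 / (r * r)) * (h x * h x) \<partial>M)"
        by (simp add: field_simps)
      also have "\<dots> = (1 / (r * r)) * (r * r)" by (simp only: integral_mult_right_zero r(2))
      also have "\<dots> = 1" using r(1) by simp
      finally show ?thesis .
    qed
    have he': "(\<integral>x. ((1 / r) * h x) * e k x \<partial>M) = 0" "(\<integral>x. e k x * ((1 / r) * h x) \<partial>M) = 0" if "k < m" for k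
      using he[OF that] by (simp_all add: mult.commute)
    have on': "(\<integral>x. e' j x * e' k x \<partial>M) = (if j = k then 1 else 0)" if jk: "j < Suc m" "k < Suc m" for j k
    proof -
      consider "j < m" "k < m" | "j = m" "k < m" | "j < m" "k = m" | "j = m" "k = m" using jk by linarith
      then show ?thesis
        by cases (use on he' hh in \<open>auto simp: e'_def fun_upd_apply\<close>)
    qed
    have "\<exists>c. AE x in M. g i x = (\<Sum>j<Suc m. c j * e' j x)" if "i < Suc n" for i
    proof (cases "i < n")
      case True
      then obtain c where "AE x in M. g i x = (\<Sum>j<m. c j * e j x)" using sp by blast
      then show ?thesis by (intro exI[of _ "c(m := 0)"]) (auto simp: e'_def fun_upd_apply)
    next
      case False
      then have i: "i = n" using that by simp
      have "g n x = (\<Sum>j<Suc m. (d(m := r)) j * e' j x)" for x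
        using r(1) by (simp add: e'_def fun_upd_apply h_def)
      then show ?thesis unfolding i by (intro exI[of _ "d(m := r)"]) simp
    qed
    then show ?thesis using e'B on' by (intro exI[of _ "Suc m"] exI[of _ e']) auto
  qed
qed

text \<open>Vanishing on rectangles extends to all measurable sets by the pi-lambda argument; it is
  then applied to the sets where \<open>D\<close> is positive and where it is negative.\<close>

lemma zero_kernel:
  fixes D :: "'a \<times> 'a \<Rightarrow> real"
  assumes D: "integrable (M \<Otimes>\<^sub>M M) D"
    and z: "\<And>A B. A \<in> sets M \<Longrightarrow> B \<in> sets M \<Longrightarrow> (\<integral>z. indicator (A \<times> B) z * D z \<partial>(M \<Otimes>\<^sub>M M)) = 0"
  shows "AE z in M \<Otimes>\<^sub>M M. D z = 0"
proof -
  interpret MM: pair_prob_space M M ..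
  let ?M = "M \<Otimes>\<^sub>M M"
  have int: "integrable ?M (\<lambda>z. indicator Z z * D z)" if "Z \<in> sets ?M" for Z
    using integrable_mult_indicator[OF that D] by simp
  have zero: "(\<integral>z. indicator Z z * D z \<partial>?M) = 0" if "Z \<in> sets ?M" for Z
  proof -
    have "Z \<in> sigma_sets (space M \<times> space M) {a \<times> b |a b. a \<in> sets M \<and> b \<in> sets M}"
      using that by (simp add: sets_pair_measure)
    from Int_stable_pair_measure_generator pair_measure_closed this show ?thesis
    proof (induction rule: sigma_sets_induct_disjoint)
      case (basic A)
      then show ?case using z by auto
    next
      case empty
      show ?case by simp
    next
      case (compl A)
      have A: "A \<in> sets ?M" using compl(1) by (simp add: sets_pair_measure)
      have sp: "space M \<times> space M \<in> sets ?M" using sets.top[of ?M] by (simp add: space_pair_measure)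
      have sub: "A \<subseteq> space M \<times> space M" using sets.sets_into_space[OF A] by (simp add: space_pair_measure)
      have "(\<integral>z. indicator (space M \<times> space M - A) z * D z \<partial>?M) =
          (\<integral>z. indicator (space M \<times> space M) z * D z - indicator A z * D z \<partial>?M)"
        using sub by (intro Bochner_Integration.integral_cong) (auto simp: indicator_def)
      also have "\<dots> = 0" using int[OF sp] int[OF A] compl(2) z by simp
      finally show ?case .
    next
      case (union A)
      have A: "\<And>i. A i \<in> sets ?M" using union(2) by (auto simp: sets_pair_measure)
      have U: "(\<Union>i. A i) \<in> sets ?M" using A by blast
      have "(LINT z:(\<Union>i. A i)|?M. D z) = (\<Sum>i. (LINT z:A i|?M. D z))"
        using A union(1) integrable_mult_indicator[OF U D]
        by (intro lebesgue_integral_countable_add) (auto simp: disjoint_family_on_def set_integrable_def)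
      also have "\<dots> = 0" using union(3) by (simp add: set_lebesgue_integral_def)
      finally show ?case by (simp add: set_lebesgue_integral_def)
    qed
  qed
  have Dm[measurable]: "D \<in> borel_measurable ?M" using D by simp
  have "{z \<in> space ?M. D z > 0} \<in> sets ?M" "{z \<in> space ?M. D z < 0} \<in> sets ?M" by measurable
  note S = this
  have "AE z in ?M. indicator {z \<in> space ?M. D z > 0} z * D z = 0"
    using zero[OF S(1)] int[OF S(1)] by (subst integral_nonneg_eq_0_iff_AE[symmetric]) (auto simp: indicator_def)
  moreover have "AE z in ?M. indicator {z \<in> space ?M. D z < 0} z * (- D z) = 0"
    using zero[OF S(2)] int[OF S(2)] by (subst integral_nonneg_eq_0_iff_AE[symmetric]) (auto simp: indicator_def)
  ultimately show ?thesis
    using AE_space by eventually_elim (auto simp: indicator_def split: if_splits)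
qed

end

section \<open>The integral operator of a bounded kernel\<close>

locale complete_prob_space = prob_space +
  assumes complete: "\<And>A B. A \<subseteq> B \<Longrightarrow> B \<in> null_sets M \<Longrightarrow> A \<in> sets M"
begin

lemma AE_eq_measurable:
  fixes a b :: "'a \<Rightarrow> real"
  assumes a: "a \<in> borel_measurable M" and eq: "AE x in M. a x = b x"
  shows "b \<in> borel_measurable M"
proof (rule measurableI)
  fix B :: "real set" assume B: "B \<in> sets borel"
  obtain N where N: "{x \<in> space M. a x \<noteq> b x} \<subseteq> N" "N \<in> null_sets M"
    using eq by (auto elim: AE_E simp: null_sets_def)
  have "b -` B \<inter> space M = (a -` B \<inter> space M - N) \<union> (b -` B \<inter> space M \<inter> N)" using N(1) by auto
  moreover have "a -` B \<inter> space M - N \<in> sets M" using a B N(2) measurable_sets by blast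
  moreover have "b -` B \<inter> space M \<inter> N \<in> sets M" by (rule complete[OF _ N(2)]) auto
  ultimately show "b -` B \<inter> space M \<in> sets M" by (metis sets.Un)
qed simp

end

locale bounded_kernel = complete_prob_space M for M :: "'a measure" +
  fixes W :: "'a \<Rightarrow> 'a \<Rightarrow> real"
  assumes W_meas: "(\<lambda>(x, y). W x y) \<in> borel_measurable (completion (M \<Otimes>\<^sub>M M))"
    and W_section: "x \<in> space M \<Longrightarrow> W x \<in> borel_measurable M"
    and W_sym: "x \<in> space M \<Longrightarrow> y \<in> space M \<Longrightarrow> W x y = W y x"
    and W_bdd: "x \<in> space M \<Longrightarrow> y \<in> space M \<Longrightarrow> 0 \<le> W x y \<and> W x y \<le> 1"
begin

sublocale MM: pair_prob_space M M ..

lemma W_bounded_meas: "x \<in> space M \<Longrightarrow> W x \<in> bounded_meas"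
  using W_section W_bdd by (auto simp: bounded_meas_def intro!: exI[of _ 1])

text \<open>\<open>W\<close> is measurable only for the completed product. Iterated integrals are
  taken with a version measurable for the plain product, cut off to the unit interval so as to be
  bounded everywhere.\<close>

lemma W_version:
  "\<exists>W'. (\<lambda>(x, y). W' x y) \<in> borel_measurable (M \<Otimes>\<^sub>M M) \<and> (\<forall>x y. \<bar>W' x y\<bar> \<le> (1::real)) \<and>
    (AE z in M \<Otimes>\<^sub>M M. W (fst z) (snd z) = W' (fst z) (snd z)) \<and>
    (AE x in M. AE y in M. W x y = W' x y)"
proof -
  obtain g where g[measurable]: "g \<in> borel_measurable (M \<Otimes>\<^sub>M M)"
    and eq: "AE z in M \<Otimes>\<^sub>M M. (\<lambda>(x, y). W x y) z = g z"
    using completion_ex_borel_measurable_real[OF W_meas] by blast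
  define W' where "W' = (\<lambda>x y. max 0 (min 1 (g (x, y))))"
  have "(\<lambda>z. max 0 (min 1 (g z))) \<in> borel_measurable (M \<Otimes>\<^sub>M M)" by measurable
  then have 1: "(\<lambda>(x, y). W' x y) \<in> borel_measurable (M \<Otimes>\<^sub>M M)" by (simp add: W'_def case_prod_beta')
  have 2: "AE z in M \<Otimes>\<^sub>M M. W (fst z) (snd z) = W' (fst z) (snd z)"
    using eq AE_space
  proof eventually_elim
    case (elim z)
    then have "0 \<le> W (fst z) (snd z) \<and> W (fst z) (snd z) \<le> 1"
      by (intro W_bdd) (auto simp: space_pair_measure)
    then show ?case using elim by (simp add: W'_def case_prod_beta')
  qed
  have "AE x in M. AE y in M. W x y = W' x y" using MM.AE_pair[OF 2] by simp
  then show ?thesis using 1 2 by (intro exI[of _ W']) (auto simp: W'_def)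
qed

definition T :: "('a \<Rightarrow> real) \<Rightarrow> 'a \<Rightarrow> real" where "T = kernel_op M W"

lemma T_bound:
  assumes "integrable M a" "x \<in> space M" shows "\<bar>T a x\<bar> \<le> (\<integral>y. \<bar>a y\<bar> \<partial>M)"
proof -
  have "\<bar>T a x\<bar> \<le> (\<integral>y. \<bar>W x y * a y\<bar> \<partial>M)" unfolding T_def kernel_op_def by (rule integral_abs_bound)
  also have "\<dots> \<le> (\<integral>y. \<bar>a y\<bar> \<partial>M)"
  proof (rule integral_mono')
    show "\<bar>W x y * a y\<bar> \<le> \<bar>a y\<bar>" if "y \<in> space M" for y
      unfolding abs_mult using W_bdd[OF assms(2) that] by (intro mult_left_le_one_le) auto
  qed (use assms in auto)
  finally show ?thesis .
qed

text \<open>The integral of the version against \<open>a\<close> is measurable in \<open>x\<close>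
  and agrees with \<open>T a\<close> almost everywhere; completeness of the measure transfers
  measurability.\<close>

lemma T_bounded_meas: assumes a: "integrable M a" shows "T a \<in> bounded_meas"
proof -
  obtain W' where W'[measurable]: "(\<lambda>(x, y). W' x y) \<in> borel_measurable (M \<Otimes>\<^sub>M M)"
    and eq: "AE x in M. AE y in M. W x y = W' x y" using W_version by blast
  have [measurable]: "a \<in> borel_measurable M" using a by simp
  have [measurable]: "(\<lambda>z. W' (fst z) (snd z)) \<in> borel_measurable (M \<Otimes>\<^sub>M M)"
    using W' by (simp add: case_prod_beta')
  have "(\<lambda>z. W' (fst z) (snd z) * a (snd z)) \<in> borel_measurable (M \<Otimes>\<^sub>M M)" by measurable
  then have m: "(\<lambda>x. \<integral>y. W' x y * a y \<partial>M) \<in> borel_measurable M"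
    by (intro borel_measurable_lebesgue_integral) (simp add: case_prod_beta')
  have "AE x in M. (\<integral>y. W' x y * a y \<partial>M) = T a x"
    using eq AE_space
  proof eventually_elim
    case (elim x)
    have [measurable]: "W x \<in> borel_measurable M" using W_section elim by simp
    have [measurable]: "W' x \<in> borel_measurable M" using elim measurable_compose[OF measurable_Pair1' W'] by simp
    have "AE y in M. W' x y * a y = W x y * a y" using elim(1) by eventually_elim simp
    then show ?case unfolding T_def kernel_op_def by (intro integral_cong_AE) measurable
  qed
  then have "T a \<in> borel_measurable M" by (rule AE_eq_measurable[OF m])
  then show ?thesis using T_bound[OF a] by (auto simp: bounded_meas_def)
qed

text \<open>Both sides are double integrals of one product-measurable version, whose symmetry holds
  almost everywhere by exchanging coordinates. The second claim records the double integral for any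
  such version, for comparison with the finite-rank kernel.\<close>

lemma T_sym:
  assumes a: "a \<in> bounded_meas" and b: "b \<in> bounded_meas"
  shows "(\<integral>x. T a x * b x \<partial>M) = (\<integral>x. a x * T b x \<partial>M)"
    and "W'_int": "\<And>W'. (\<lambda>(x, y). W' x y) \<in> borel_measurable (M \<Otimes>\<^sub>M M) \<Longrightarrow> (\<And>x y. \<bar>W' x y\<bar> \<le> (1::real)) \<Longrightarrow>
     AE x in M. AE y in M. W x y = W' x y \<Longrightarrow>
     integrable (M \<Otimes>\<^sub>M M) (\<lambda>z. b (fst z) * a (snd z) * W' (fst z) (snd z)) \<and>
     (\<integral>z. b (fst z) * a (snd z) * W' (fst z) (snd z) \<partial>(M \<Otimes>\<^sub>M M)) = (\<integral>x. T a x * b x \<partial>M)"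
proof -
  have key: "integrable (M \<Otimes>\<^sub>M M) (\<lambda>z. b (fst z) * a (snd z) * W' (fst z) (snd z)) \<and>
     (\<integral>z. b (fst z) * a (snd z) * W' (fst z) (snd z) \<partial>(M \<Otimes>\<^sub>M M)) = (\<integral>x. T a x * b x \<partial>M)"
    if W': "(\<lambda>(x, y). W' x y) \<in> borel_measurable (M \<Otimes>\<^sub>M M)" "\<And>x y. \<bar>W' x y\<bar> \<le> (1::real)"
      "AE x in M. AE y in M. W x y = W' x y" and a: "a \<in> bounded_meas" and b: "b \<in> bounded_meas" for W' a b
  proof -
    have [measurable]: "(\<lambda>z. W' (fst z) (snd z)) \<in> borel_measurable (M \<Otimes>\<^sub>M M)"
      using W'(1) by (simp add: case_prod_beta')
    have [measurable]: "a \<in> borel_measurable M" "b \<in> borel_measurable M" using a b by (auto simp: bounded_meas_def)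
    obtain A B where AB: "\<And>x. x \<in> space M \<Longrightarrow> \<bar>a x\<bar> \<le> A" "\<And>x. x \<in> space M \<Longrightarrow> \<bar>b x\<bar> \<le> B"
      using a b by (auto simp: bounded_meas_def)
    have m: "(\<lambda>z. b (fst z) * a (snd z) * W' (fst z) (snd z)) \<in> borel_measurable (M \<Otimes>\<^sub>M M)"
      by measurable
    have bnd: "\<bar>b (fst z) * a (snd z) * W' (fst z) (snd z)\<bar> \<le> B * A * 1" if "z \<in> space (M \<Otimes>\<^sub>M M)" for z
    proof -
      have z: "fst z \<in> space M" "snd z \<in> space M" using that by (auto simp: space_pair_measure)
      then show ?thesis unfolding abs_mult
        using AB(1)[OF z(2)] AB(2)[OF z(1)] W'(2)[of "fst z" "snd z"]
        by (intro mult_mono) auto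
    qed
    have int: "integrable (M \<Otimes>\<^sub>M M) (\<lambda>z. b (fst z) * a (snd z) * W' (fst z) (snd z))"
      using bnd by (intro MM.P.integrable_const_bound[where B = "B * A * 1"] AE_I2 m) auto
    then have "(\<integral>z. b (fst z) * a (snd z) * W' (fst z) (snd z) \<partial>(M \<Otimes>\<^sub>M M)) = (\<integral>x. \<integral>y. b x * a y * W' x y \<partial>M \<partial>M)"
      by (simp add: MM.integral_fst'[symmetric])
    also have "\<dots> = (\<integral>x. T a x * b x \<partial>M)"
    proof (rule integral_cong_AE)
      show "(\<lambda>x. \<integral>y. b x * a y * W' x y \<partial>M) \<in> borel_measurable M"
        using m by (intro borel_measurable_lebesgue_integral) (simp add: case_prod_beta')
      show "(\<lambda>x. T a x * b x) \<in> borel_measurable M"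
        using bounded_meas_mult[OF T_bounded_meas[OF bounded_meas_integrable[OF a]] b] by (simp add: bounded_meas_def)
      show "AE x in M. (\<integral>y. b x * a y * W' x y \<partial>M) = T a x * b x"
        using W'(3) AE_space
      proof eventually_elim
        case (elim x)
        have [measurable]: "W x \<in> borel_measurable M" using W_section elim by simp
        have [measurable]: "W' x \<in> borel_measurable M" using elim measurable_compose[OF measurable_Pair1' W'(1)] by simp
        have "AE y in M. b x * a y * W' x y = b x * (W x y * a y)"
          using elim(1) by eventually_elim simp
        then have "(\<integral>y. b x * a y * W' x y \<partial>M) = (\<integral>y. b x * (W x y * a y) \<partial>M)"
          by (intro integral_cong_AE) measurable
        then show ?case by (simp add: T_def kernel_op_def)
      qed
    qed
    finally show ?thesis using int by blast
  qed
  then show "integrable (M \<Otimes>\<^sub>M M) (\<lambda>z. b (fst z) * a (snd z) * W' (fst z) (snd z)) \<and>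
     (\<integral>z. b (fst z) * a (snd z) * W' (fst z) (snd z) \<partial>(M \<Otimes>\<^sub>M M)) = (\<integral>x. T a x * b x \<partial>M)"
    if "(\<lambda>(x, y). W' x y) \<in> borel_measurable (M \<Otimes>\<^sub>M M)" "\<And>x y. \<bar>W' x y\<bar> \<le> (1::real)"
      "AE x in M. AE y in M. W x y = W' x y" for W' using that a b by blast
  obtain W' where W': "(\<lambda>(x, y). W' x y) \<in> borel_measurable (M \<Otimes>\<^sub>M M)" "\<And>x y. \<bar>W' x y\<bar> \<le> 1"
    "AE z in M \<Otimes>\<^sub>M M. W (fst z) (snd z) = W' (fst z) (snd z)"
    "AE x in M. AE y in M. W x y = W' x y" using W_version by blast
  have swap: "AE z in M \<Otimes>\<^sub>M M. W' (fst z) (snd z) = W' (snd z) (fst z)"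
  proof -
    have "AE z in M \<Otimes>\<^sub>M M. W (snd z) (fst z) = W' (snd z) (fst z)"
    proof -
      have "AE z in distr (M \<Otimes>\<^sub>M M) (M \<Otimes>\<^sub>M M) (\<lambda>(x, y). (y, x)). W (fst z) (snd z) = W' (fst z) (snd z)"
        using W'(3) by (simp only: MM.distr_pair_swap[symmetric])
      from AE_distrD[OF measurable_pair_swap' this] show ?thesis by (simp add: case_prod_beta')
    qed
    with W'(3) AE_space show ?thesis
    proof eventually_elim
      case (elim z)
      then show ?case using W_sym[of "fst z" "snd z"] by (simp add: space_pair_measure mem_Times_iff)
    qed
  qed
  have k1: "(\<integral>z. b (fst z) * a (snd z) * W' (fst z) (snd z) \<partial>(M \<Otimes>\<^sub>M M)) = (\<integral>x. T a x * b x \<partial>M)"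
    using key[OF W'(1,2,4) a b] by blast
  have k2: "(\<integral>z. a (fst z) * b (snd z) * W' (fst z) (snd z) \<partial>(M \<Otimes>\<^sub>M M)) = (\<integral>x. T b x * a x \<partial>M)"
    using key[OF W'(1,2,4) b a] by blast
  have i1: "(\<lambda>z. b (fst z) * a (snd z) * W' (fst z) (snd z)) \<in> borel_measurable (M \<Otimes>\<^sub>M M)"
    using key[OF W'(1,2,4) a b] by blast
  have i2: "(\<lambda>z. a (fst z) * b (snd z) * W' (fst z) (snd z)) \<in> borel_measurable (M \<Otimes>\<^sub>M M)"
    using key[OF W'(1,2,4) b a] by blast
  have i3: "(\<lambda>z. b (fst z) * a (snd z) * W' (snd z) (fst z)) \<in> borel_measurable (M \<Otimes>\<^sub>M M)"
    using measurable_compose[OF measurable_pair_swap' i2] by (simp add: case_prod_beta' mult.commute)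
  have "(\<integral>z. b (fst z) * a (snd z) * W' (fst z) (snd z) \<partial>(M \<Otimes>\<^sub>M M)) = (\<integral>z. b (fst z) * a (snd z) * W' (snd z) (fst z) \<partial>(M \<Otimes>\<^sub>M M))"
    using swap by (intro integral_cong_AE i1 i3) auto
  also have "\<dots> = (\<integral>z. a (fst z) * b (snd z) * W' (fst z) (snd z) \<partial>(M \<Otimes>\<^sub>M M))"
    using MM.integral_product_swap[OF i2] by (simp add: case_prod_beta' mult.commute)
  finally show "(\<integral>x. T a x * b x \<partial>M) = (\<integral>x. a x * T b x \<partial>M)" unfolding k1 k2 by (simp add: mult.commute)
qed

text \<open>The eigenvalue equation is required at every point, the expansion of \<open>W\<close>
  only almost everywhere. Purity removes this last exception in
  \<open>W_eq_spectral_kernel\<close>.\<close>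

definition spectral_data :: "nat \<Rightarrow> (nat \<Rightarrow> 'a \<Rightarrow> real) \<Rightarrow> (nat \<Rightarrow> real) \<Rightarrow> bool" where
  "spectral_data t f l \<longleftrightarrow> (\<forall>i. f i \<in> bounded_meas) \<and> (\<forall>i x. t \<le> i \<longrightarrow> f i x = 0) \<and>
    (\<forall>i<t. \<forall>j<t. (\<integral>x. f i x * f j x \<partial>M) = (if i = j then 1 else 0)) \<and>
    (\<forall>i<t. l i \<noteq> 0) \<and> (\<forall>i<t. \<forall>x\<in>space M. T (f i) x = l i * f i x) \<and>
    (AE x in M. AE y in M. W x y = (\<Sum>i<t. l i * f i x * f i y))"

text \<open>Everything is reduced to a finite symmetric matrix. An orthonormal system spanning the
  range represents the operator by its matrix \<open>C\<close>; the kernel built from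
  \<open>C\<close> and \<open>W\<close> have equal integrals over rectangles, hence agree;
  diagonalising \<open>C\<close> rotates the system into eigenfunctions.\<close>

lemma spectral_decomposition:
  assumes "finite_rank M W"
  shows "\<exists>t f l. spectral_data t f l"
proof -
  obtain n h where h: "\<And>i. i < n \<Longrightarrow> square_integrable M (h i)"
    and rank: "\<And>a. square_integrable M a \<Longrightarrow> \<exists>c. AE x in M. T a x = (\<Sum>i<n::nat. c i * T (h i) x)"
    using assms unfolding finite_rank_def T_def by blast
  have sqB: "square_integrable M a" if "a \<in> bounded_meas" for a
    using that bounded_meas_integrable[OF bounded_meas_mult[OF that that]] by (simp add: square_integrable_def bounded_meas_def power2_eq_square)
  have "\<And>i. i < n \<Longrightarrow> T (h i) \<in> bounded_meas" using T_bounded_meas square_integrable_imp_integrable h by blast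
  from gram_schmidt[of n "\<lambda>i. T (h i)", OF this] obtain m e where e: "\<And>j. e j \<in> bounded_meas"
    and on: "\<And>j k. j < m \<Longrightarrow> k < m \<Longrightarrow> (\<integral>x. e j x * e k x \<partial>M) = (if j = k then 1 else 0)"
    and sp: "\<And>i. i < n \<Longrightarrow> \<exists>c. AE x in M. T (h i) x = (\<Sum>j<m::nat. c j * e j x)" by blast
  have TB: "T a \<in> bounded_meas" if "a \<in> bounded_meas" for a using T_bounded_meas bounded_meas_integrable that by blast
  have Te: "AE x in M. T a x = (\<Sum>j<m. (\<integral>y. T a y * e j y \<partial>M) * e j x)" if a: "a \<in> bounded_meas" for a
  proof -
    obtain c where c: "AE x in M. T a x = (\<Sum>i<n. c i * T (h i) x)" using rank[OF sqB[OF a]] by blast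
    have "\<forall>i\<in>{..<n}. \<exists>b. AE x in M. T (h i) x = (\<Sum>j<m. b j * e j x)" using sp by blast
    from bchoice[OF this] obtain b where b: "\<forall>i\<in>{..<n}. AE x in M. T (h i) x = (\<Sum>j<m. b i j * e j x)" by blast
    then have b': "AE x in M. \<forall>i\<in>{..<n}. T (h i) x = (\<Sum>j<m. b i j * e j x)"
      by (simp add: AE_finite_all)
    define d where "d = (\<lambda>j. \<Sum>i<n. c i * b i j)"
    have d: "AE x in M. T a x = (\<Sum>j<m. d j * e j x)"
      using c b'
    proof eventually_elim
      case (elim x)
      then have "T a x = (\<Sum>i<n. \<Sum>j<m. c i * b i j * e j x)" by (simp add: sum_distrib_left mult.assoc)
      also have "\<dots> = (\<Sum>j<m. d j * e j x)" by (subst sum.swap) (simp add: d_def sum_distrib_right)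
      finally show ?case .
    qed
    have "(\<integral>y. T a y * e k y \<partial>M) = d k" if k: "k < m" for k
    proof -
      have "(\<integral>y. T a y * e k y \<partial>M) = (\<integral>y. (\<Sum>j<m. d j * (e j y * e k y)) \<partial>M)"
      proof (rule integral_cong_AE)
        show "(\<lambda>y. T a y * e k y) \<in> borel_measurable M" using bounded_meas_mult[OF TB[OF a] e] by (simp add: bounded_meas_def)
        show "(\<lambda>y. \<Sum>j<m. d j * (e j y * e k y)) \<in> borel_measurable M"
          by (intro bounded_meas_meas bounded_meas_sum bounded_meas_cmult bounded_meas_mult e)
        show "AE y in M. T a y * e k y = (\<Sum>j<m. d j * (e j y * e k y))"
          using d by eventually_elim (simp add: sum_distrib_right mult.assoc)
      qed
      also have "\<dots> = (\<Sum>j<m. d j * (\<integral>y. e j y * e k y \<partial>M))" by (simp add: bounded_meas_integrable bounded_meas_mult e)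
      also have "\<dots> = d k" using k by (simp add: on if_distrib[of "\<lambda>x. _ * x"] sum.delta cong: if_cong)
      finally show ?thesis .
    qed
    then show ?thesis using d by simp
  qed
  define C where "C = (\<lambda>j k. \<integral>y. T (e k) y * e j y \<partial>M)"
  have Csym: "C j k = C k j" for j k
    using T_sym(1)[OF e e, of k j] by (simp add: C_def mult.commute)
  \<comment> \<open>The range lies in the span of the \<open>e j\<close>; by symmetry the form sees
    \<open>a\<close> as well only through its components along them.\<close>
  have Tab: "(\<integral>x. T a x * b x \<partial>M) = (\<Sum>j<m. \<Sum>k<m. C j k * (\<integral>y. a y * e k y \<partial>M) * (\<integral>y. e j y * b y \<partial>M))"
    if a: "a \<in> bounded_meas" and b: "b \<in> bounded_meas" for a b
  proof -
    have exp: "(\<integral>x. T u x * v x \<partial>M) = (\<Sum>j<m. (\<integral>y. T u y * e j y \<partial>M) * (\<integral>y. e j y * v y \<partial>M))" if u: "u \<in> bounded_meas" and v: "v \<in> bounded_meas" for u v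
    proof -
      have "(\<integral>x. T u x * v x \<partial>M) = (\<integral>x. (\<Sum>j<m. (\<integral>y. T u y * e j y \<partial>M) * (e j x * v x)) \<partial>M)"
      proof (rule integral_cong_AE)
        show "(\<lambda>y. T u y * v y) \<in> borel_measurable M" using bounded_meas_mult[OF TB[OF u] v] by (simp add: bounded_meas_def)
        show "(\<lambda>x. \<Sum>j<m. (\<integral>y. T u y * e j y \<partial>M) * (e j x * v x)) \<in> borel_measurable M"
          by (intro bounded_meas_meas bounded_meas_sum bounded_meas_cmult bounded_meas_mult e v)
        show "AE x in M. T u x * v x = (\<Sum>j<m. (\<integral>y. T u y * e j y \<partial>M) * (e j x * v x))"
          using Te[OF u] by eventually_elim (simp add: sum_distrib_right mult.assoc)
      qed
      also have "\<dots> = (\<Sum>j<m. (\<integral>y. T u y * e j y \<partial>M) * (\<integral>y. e j y * v y \<partial>M))"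
        by (simp add: bounded_meas_integrable bounded_meas_mult e v)
      finally show ?thesis .
    qed
    have "(\<integral>y. T a y * e j y \<partial>M) = (\<Sum>k<m. C j k * (\<integral>y. a y * e k y \<partial>M))" for j
    proof -
      have "(\<integral>y. T a y * e j y \<partial>M) = (\<integral>y. T (e j) y * a y \<partial>M)"
        using T_sym(1)[OF a e, of j] by (simp add: mult.commute)
      also have "\<dots> = (\<Sum>k<m. (\<integral>y. T (e j) y * e k y \<partial>M) * (\<integral>y. e k y * a y \<partial>M))" by (rule exp[OF e a])
      also have "\<dots> = (\<Sum>k<m. C j k * (\<integral>y. a y * e k y \<partial>M))"
      proof (intro sum.cong refl)
        fix k
        have "(\<integral>y. T (e j) y * e k y \<partial>M) = C j k" using Csym[of j k] by (simp add: C_def)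
        then show "(\<integral>y. T (e j) y * e k y \<partial>M) * (\<integral>y. e k y * a y \<partial>M) = C j k * (\<integral>y. a y * e k y \<partial>M)"
          by (simp add: mult.commute)
      qed
      finally show ?thesis .
    qed
    then show ?thesis unfolding exp[OF a b] by (simp add: sum_distrib_right)
  qed
  obtain W' where W': "(\<lambda>(x, y). W' x y) \<in> borel_measurable (M \<Otimes>\<^sub>M M)" "\<And>x y. \<bar>W' x y\<bar> \<le> 1"
    "AE z in M \<Otimes>\<^sub>M M. W (fst z) (snd z) = W' (fst z) (snd z)"
    "AE x in M. AE y in M. W x y = W' x y" using W_version by blast
  define G where "G = (\<lambda>z. \<Sum>j<m. \<Sum>k<m. C j k * (e j (fst z) * e k (snd z)))"
  have prod_int: "integrable (M \<Otimes>\<^sub>M M) (\<lambda>z. u (fst z) * v (snd z)) \<and>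
     (\<integral>z. u (fst z) * v (snd z) \<partial>(M \<Otimes>\<^sub>M M)) = (\<integral>x. u x \<partial>M) * (\<integral>x. v x \<partial>M)" if u: "u \<in> bounded_meas" and v: "v \<in> bounded_meas" for u v
  proof -
    have [measurable]: "u \<in> borel_measurable M" "v \<in> borel_measurable M" using u v by (auto simp: bounded_meas_def)
    obtain A B where AB: "\<And>x. x \<in> space M \<Longrightarrow> \<bar>u x\<bar> \<le> A" "\<And>x. x \<in> space M \<Longrightarrow> \<bar>v x\<bar> \<le> B"
      using u v by (auto simp: bounded_meas_def)
    have "\<bar>u (fst z) * v (snd z)\<bar> \<le> A * B" if "z \<in> space (M \<Otimes>\<^sub>M M)" for z
    proof -
      have z: "fst z \<in> space M" "snd z \<in> space M" using that by (auto simp: space_pair_measure)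
      then show ?thesis unfolding abs_mult
        using AB(1)[OF z(1)] AB(2)[OF z(2)] by (intro mult_mono) auto
    qed
    then have int: "integrable (M \<Otimes>\<^sub>M M) (\<lambda>z. u (fst z) * v (snd z))"
      by (intro MM.P.integrable_const_bound[where B = "A * B"] AE_I2) auto
    then have "(\<integral>z. u (fst z) * v (snd z) \<partial>(M \<Otimes>\<^sub>M M)) = (\<integral>x. \<integral>y. u x * v y \<partial>M \<partial>M)"
      by (simp add: MM.integral_fst'[symmetric])
    then show ?thesis using int by simp
  qed
  have "AE z in M \<Otimes>\<^sub>M M. W' (fst z) (snd z) - G z = 0"
  proof (rule zero_kernel)
    have iW: "integrable (M \<Otimes>\<^sub>M M) (\<lambda>z. b (fst z) * a (snd z) * W' (fst z) (snd z))"
      "(\<integral>z. b (fst z) * a (snd z) * W' (fst z) (snd z) \<partial>(M \<Otimes>\<^sub>M M)) = (\<integral>x. T a x * b x \<partial>M)"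
      if "a \<in> bounded_meas" "b \<in> bounded_meas" for a b using W'_int[OF that W'(1,2,4)] by auto
    have iG: "integrable (M \<Otimes>\<^sub>M M) (\<lambda>z. b (fst z) * a (snd z) * G z)"
      "(\<integral>z. b (fst z) * a (snd z) * G z \<partial>(M \<Otimes>\<^sub>M M)) = (\<integral>x. T a x * b x \<partial>M)"
      if a: "a \<in> bounded_meas" and b: "b \<in> bounded_meas" for a b
    proof -
      have eq: "(\<lambda>z. b (fst z) * a (snd z) * G z) = (\<lambda>z. \<Sum>j<m. \<Sum>k<m. C j k * ((\<lambda>x. e j x * b x) (fst z) * (\<lambda>y. a y * e k y) (snd z)))"
        by (auto simp: G_def sum_distrib_left mult_ac)
      have ii: "integrable (M \<Otimes>\<^sub>M M) (\<lambda>z. C j k * ((\<lambda>x. e j x * b x) (fst z) * (\<lambda>y. a y * e k y) (snd z)))" for j k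
        using prod_int[OF bounded_meas_mult[OF e b] bounded_meas_mult[OF a e]] by (intro integrable_mult_right) blast
      show "integrable (M \<Otimes>\<^sub>M M) (\<lambda>z. b (fst z) * a (snd z) * G z)"
        unfolding eq by (intro Bochner_Integration.integrable_sum ii)
      have pi: "(\<integral>z. (\<lambda>x. e j x * b x) (fst z) * (\<lambda>y. a y * e k y) (snd z) \<partial>(M \<Otimes>\<^sub>M M)) = (\<integral>y. e j y * b y \<partial>M) * (\<integral>y. a y * e k y \<partial>M)" for j k
        using prod_int[OF bounded_meas_mult[OF e b] bounded_meas_mult[OF a e]] by blast
      show "(\<integral>z. b (fst z) * a (snd z) * G z \<partial>(M \<Otimes>\<^sub>M M)) = (\<integral>x. T a x * b x \<partial>M)"
        unfolding eq Tab[OF a b]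
        by (subst Bochner_Integration.integral_sum, intro Bochner_Integration.integrable_sum ii,
            subst Bochner_Integration.integral_sum, rule ii)
          (simp only: integral_mult_right_zero pi, simp only: mult_ac)
    qed
    show "integrable (M \<Otimes>\<^sub>M M) (\<lambda>z. W' (fst z) (snd z) - G z)"
      using iW(1)[OF bounded_meas_const[of 1] bounded_meas_const[of 1]] iG(1)[OF bounded_meas_const[of 1] bounded_meas_const[of 1]] by simp
    fix A B assume AB: "A \<in> sets M" "B \<in> sets M"
    note iA = indicator_bounded_meas[OF AB(1)] and iB = indicator_bounded_meas[OF AB(2)]
    have "(\<integral>z. indicator (A \<times> B) z * (W' (fst z) (snd z) - G z) \<partial>(M \<Otimes>\<^sub>M M)) =
      (\<integral>z. indicator A (fst z) * indicator B (snd z) * W' (fst z) (snd z) - indicator A (fst z) * indicator B (snd z) * G z \<partial>(M \<Otimes>\<^sub>M M))"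
      by (intro Bochner_Integration.integral_cong) (auto simp: indicator_def)
    also have "\<dots> = 0" using iW[OF iB iA] iG[OF iB iA] by simp
    finally show "(\<integral>z. indicator (A \<times> B) z * (W' (fst z) (snd z) - G z) \<partial>(M \<Otimes>\<^sub>M M)) = 0" .
  qed
  then have "AE z in M \<Otimes>\<^sub>M M. W (fst z) (snd z) = G z" using W'(3) by eventually_elim simp
  from MM.AE_pair[OF this] have WG: "AE x in M. AE y in M. W x y = (\<Sum>j<m. \<Sum>k<m. C j k * (e j x * e k y))"
    by (simp add: G_def)
  have "\<exists>(t::nat) v l. (\<forall>a<t. \<forall>b<t. (\<Sum>i<m. v a i * v b i) = (if a = b then 1 else 0 :: real)) \<and>
      (\<forall>a<t. l a \<noteq> (0::real)) \<and> (\<forall>i<m. \<forall>j<m. C i j = (\<Sum>a<t. l a * v a i * v a j))"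
    by (rule symmetric_spectral_decomposition) (rule Csym)
  then obtain t v l where v: "\<And>a b. a < t \<Longrightarrow> b < t \<Longrightarrow> (\<Sum>i<m. v a i * v b i) = (if a = b then 1 else 0 :: real)"
    and l: "\<And>a. a < t \<Longrightarrow> l a \<noteq> (0::real)"
    and Cv: "\<And>i j. i < m \<Longrightarrow> j < m \<Longrightarrow> C i j = (\<Sum>a<t::nat. l a * v a i * v a j)" by blast
  define \<psi> where "\<psi> = (\<lambda>a x. \<Sum>j<m. v a j * e j x)"
  have \<psi>B: "\<psi> a \<in> bounded_meas" for a unfolding \<psi>_def by (intro bounded_meas_sum bounded_meas_cmult e)
  have W\<psi>: "AE x in M. AE y in M. W x y = (\<Sum>a<t. l a * \<psi> a x * \<psi> a y)"
  proof -
    have "(\<Sum>j<m. \<Sum>k<m. C j k * (e j x * e k y)) = (\<Sum>a<t. l a * \<psi> a x * \<psi> a y)" for x y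
    proof -
      have "(\<Sum>j<m. \<Sum>k<m. C j k * (e j x * e k y)) = (\<Sum>j<m. \<Sum>k<m. \<Sum>a<t. l a * v a j * v a k * (e j x * e k y))"
        by (intro sum.cong refl) (simp add: Cv sum_distrib_right)
      also have "\<dots> = (\<Sum>j<m. \<Sum>a<t. \<Sum>k<m. l a * v a j * v a k * (e j x * e k y))"
        by (intro sum.cong refl sum.swap)
      also have "\<dots> = (\<Sum>a<t. \<Sum>j<m. \<Sum>k<m. l a * v a j * v a k * (e j x * e k y))" by (rule sum.swap)
      also have "\<dots> = (\<Sum>a<t. l a * \<psi> a x * \<psi> a y)"
        by (simp add: \<psi>_def sum_product sum_distrib_left mult_ac)
      finally show ?thesis .
    qed
    then show ?thesis using WG by simp
  qed
  have \<psi>on: "(\<integral>x. \<psi> a x * \<psi> b x \<partial>M) = (if a = b then 1 else 0)" if "a < t" "b < t" for a b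
  proof -
    have "(\<integral>x. \<psi> a x * \<psi> b x \<partial>M) = (\<integral>x. (\<Sum>j<m. \<Sum>k<m. v a j * v b k * (e j x * e k x)) \<partial>M)"
      by (simp add: \<psi>_def sum_product mult_ac)
    also have "\<dots> = (\<Sum>j<m. \<Sum>k<m. v a j * v b k * (\<integral>x. e j x * e k x \<partial>M))"
      by (simp add: bounded_meas_integrable bounded_meas_mult e)
    also have "\<dots> = (\<Sum>j<m. v a j * v b j)"
      by (intro sum.cong refl) (simp add: on if_distrib[of "\<lambda>x. _ * x"] sum.delta cong: if_cong)
    finally show ?thesis using v that by simp
  qed
  \<comment> \<open>The functions \<open>\<psi> a\<close> satisfy the eigenvalue equation only
    almost everywhere. Applying the operator once and dividing by the eigenvalue changes them on a
    null set and yields the equation at every point.\<close>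
  define f where "f = (\<lambda>a x. if a < t then T (\<psi> a) x / l a else 0)"
  have fB: "f a \<in> bounded_meas" for a
    using bounded_meas_cmult[OF TB[OF \<psi>B], of "1 / l a" a] bounded_meas_const[of 0] by (cases "a < t") (simp_all add: f_def)
  have f\<psi>: "AE x in M. f a x = \<psi> a x" if a: "a < t" for a
    using W\<psi> AE_space
  proof eventually_elim
    case (elim x)
    have "T (\<psi> a) x = (\<integral>y. (\<Sum>b<t. l b * \<psi> b x * (\<psi> b y * \<psi> a y)) \<partial>M)"
      unfolding T_def kernel_op_def
    proof (rule integral_cong_AE)
      show "(\<lambda>y. W x y * \<psi> a y) \<in> borel_measurable M" using bounded_meas_mult[OF W_bounded_meas \<psi>B] elim by (simp add: bounded_meas_def)
      show "(\<lambda>y. \<Sum>b<t. l b * \<psi> b x * (\<psi> b y * \<psi> a y)) \<in> borel_measurable M"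
        by (intro bounded_meas_meas bounded_meas_sum bounded_meas_cmult bounded_meas_mult \<psi>B)
      show "AE y in M. W x y * \<psi> a y = (\<Sum>b<t. l b * \<psi> b x * (\<psi> b y * \<psi> a y))"
        using elim(1) by eventually_elim (simp add: sum_distrib_right mult.assoc)
    qed
    also have "\<dots> = (\<Sum>b<t. l b * \<psi> b x * (\<integral>y. \<psi> b y * \<psi> a y \<partial>M))"
      by (simp add: bounded_meas_integrable bounded_meas_mult \<psi>B)
    also have "\<dots> = l a * \<psi> a x"
      using a by (simp add: \<psi>on if_distrib[of "\<lambda>x. _ * x"] sum.delta cong: if_cong)
    finally show ?case using a l[OF a] by (simp add: f_def)
  qed
  show ?thesis
    unfolding spectral_data_def
  proof (intro exI[of _ t] exI[of _ f] exI[of _ l] conjI allI impI ballI)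
    show "(\<integral>x. f i x * f j x \<partial>M) = (if i = j then 1 else 0)" if ij: "i < t" "j < t" for i j
    proof -
      have "(\<integral>x. f i x * f j x \<partial>M) = (\<integral>x. \<psi> i x * \<psi> j x \<partial>M)"
        using bounded_meas_mult[OF fB fB] bounded_meas_mult[OF \<psi>B \<psi>B] f\<psi>[OF ij(1)] f\<psi>[OF ij(2)]
        by (intro integral_cong_AE) (auto simp: bounded_meas_def)
      then show ?thesis using \<psi>on ij by simp
    qed
    show "T (f i) x = l i * f i x" if i: "i < t" and x: "x \<in> space M" for i x
    proof -
      have "T (f i) x = T (\<psi> i) x"
        unfolding T_def kernel_op_def
        using bounded_meas_mult[OF W_bounded_meas[OF x] fB] bounded_meas_mult[OF W_bounded_meas[OF x] \<psi>B] f\<psi>[OF i]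
        by (intro integral_cong_AE) (auto simp: bounded_meas_def)
      then show ?thesis using i l by (simp add: f_def)
    qed
    have "AE x in M. \<forall>a\<in>{..<t}. f a x = \<psi> a x" using f\<psi> by (simp add: AE_finite_all)
    note all = this
    show "AE x in M. AE y in M. W x y = (\<Sum>i<t. l i * f i x * f i y)"
      using W\<psi> all
    proof eventually_elim
      case (elim x)
      from elim(1) all show ?case
      proof eventually_elim
        case (elim y)
        then show ?case using \<open>\<forall>a\<in>{..<t}. f a x = \<psi> a x\<close> by simp
      qed
    qed
  qed (use fB l in \<open>auto simp: f_def\<close>)
qed

end

section \<open>Pure graphons of finite rank\<close>

locale pure_finite_rank_graphon =
  fixes M :: "'a measure" and W :: "'a \<Rightarrow> 'a \<Rightarrow> real"
  assumes pure: "pure_graphon M W" and rank: "finite_rank M W"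
begin

lemma standard: "standard_prob_space M"
  using pure by (simp add: pure_graphon_def graphon_def)

sublocale bounded_kernel M W
proof -
  obtain X N where "prob_space N" and MN: "M = completion N"
    using standard unfolding standard_prob_space_def by blast
  interpret N: prob_space N by fact
  interpret prob_space M
    by (rule prob_spaceI) (simp add: MN N.emeasure_space_1)
  show "bounded_kernel M W"
  proof
    fix A B assume "A \<subseteq> B" "B \<in> null_sets M"
    then show "A \<in> sets M" unfolding MN using null_sets_completion_subset by blast
  qed (use pure in \<open>auto simp: pure_graphon_def graphon_def\<close>)
qed

sublocale metric: Metric_space "space M" "nbhd_dist M W"
  using pure by (simp add: pure_graphon_def)

lemma open_positive:
  "openin metric.mtopology U \<Longrightarrow> x \<in> U \<Longrightarrow> emeasure M U > 0"
  using pure by (auto simp: pure_graphon_def)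

end

section \<open>Eigenfunction coordinates and the neighbourhood distance\<close>

locale decomposed_graphon = pure_finite_rank_graphon +
  fixes t :: nat and f :: "nat \<Rightarrow> 'a \<Rightarrow> real" and l :: "nat \<Rightarrow> real"
  assumes spectral: "spectral_data t f l"
begin

lemma fB: "f i \<in> bounded_meas" and f0: "t \<le> i \<Longrightarrow> f i x = 0"
  and f_on: "i < t \<Longrightarrow> j < t \<Longrightarrow> (\<integral>x. f i x * f j x \<partial>M) = (if i = j then 1 else 0)"
  and l0: "i < t \<Longrightarrow> l i \<noteq> 0"
  and eigen: "i < t \<Longrightarrow> x \<in> space M \<Longrightarrow> T (f i) x = l i * f i x"
  and W_AE: "AE x in M. AE y in M. W x y = (\<Sum>i<t. l i * f i x * f i y)"
  using spectral by (simp_all add: spectral_data_def)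

abbreviation d :: "'a \<Rightarrow> 'a \<Rightarrow> real" where "d \<equiv> nbhd_dist M W"

definition spectral_kernel :: "'a \<Rightarrow> 'a \<Rightarrow> real" where "spectral_kernel x y = (\<Sum>i<t. l i * f i x * f i y)"

definition lipschitz :: "nat \<Rightarrow> real" where
  "lipschitz i = (SOME c. c \<ge> 0 \<and> (\<forall>x\<in>space M. \<forall>y\<in>space M. \<bar>f i x - f i y\<bar> \<le> c * d x y))"

lemma d_integrable: "x \<in> space M \<Longrightarrow> y \<in> space M \<Longrightarrow> (\<lambda>z. W x z - W y z) \<in> bounded_meas"
  using bounded_meas_lin[OF W_bounded_meas W_bounded_meas, of x y "-1"] by simp

text \<open>The difference of the eigenvalue equations at \<open>x\<close> and \<open>y\<close> is
  an integral of \<open>W x z - W y z\<close> against a bounded function. The zero functions from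
  \<open>t\<close> on take the constant 0.\<close>

lemma lipschitz: "lipschitz i \<ge> 0" "x \<in> space M \<Longrightarrow> y \<in> space M \<Longrightarrow> \<bar>f i x - f i y\<bar> \<le> lipschitz i * d x y"
proof -
  have "\<exists>c. c \<ge> 0 \<and> (\<forall>x\<in>space M. \<forall>y\<in>space M. \<bar>f i x - f i y\<bar> \<le> c * d x y)"
  proof (cases "i < t")
    case True
    obtain C where C: "\<And>x. x \<in> space M \<Longrightarrow> \<bar>f i x\<bar> \<le> C" using fB[of i] by (auto simp: bounded_meas_def)
    have "\<bar>f i x - f i y\<bar> \<le> \<bar>C\<bar> / \<bar>l i\<bar> * d x y" if xy: "x \<in> space M" "y \<in> space M" for x y
    proof -
      have "l i * (f i x - f i y) = T (f i) x - T (f i) y" using eigen[OF True] xy by (simp add: right_diff_distrib)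
      also have "\<dots> = (\<integral>z. (W x z - W y z) * f i z \<partial>M)"
        unfolding T_def kernel_op_def left_diff_distrib
        using bounded_meas_integrable[OF bounded_meas_mult[OF W_bounded_meas fB]] xy by simp
      finally have "\<bar>l i\<bar> * \<bar>f i x - f i y\<bar> \<le> (\<integral>z. \<bar>(W x z - W y z) * f i z\<bar> \<partial>M)"
        by (metis abs_mult integral_abs_bound)
      also have "\<dots> \<le> (\<integral>z. \<bar>W x z - W y z\<bar> * \<bar>C\<bar> \<partial>M)"
      proof (rule integral_mono)
        show "integrable M (\<lambda>z. \<bar>(W x z - W y z) * f i z\<bar>)"
          using bounded_meas_integrable[OF bounded_meas_mult[OF d_integrable[OF xy] fB]] by simp
        show "integrable M (\<lambda>z. \<bar>W x z - W y z\<bar> * \<bar>C\<bar>)"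
          using bounded_meas_integrable[OF d_integrable[OF xy]] by simp
        fix z assume "z \<in> space M"
        then show "\<bar>(W x z - W y z) * f i z\<bar> \<le> \<bar>W x z - W y z\<bar> * \<bar>C\<bar>"
          using C[of z] unfolding abs_mult by (intro mult_left_mono) auto
      qed
      also have "\<dots> = \<bar>C\<bar> * d x y" by (simp add: nbhd_dist_def)
      finally show ?thesis using l0[OF True] by (simp add: field_simps)
    qed
    then show ?thesis by (intro exI[of _ "\<bar>C\<bar> / \<bar>l i\<bar>"]) auto
  next
    case False
    then show ?thesis by (intro exI[of _ 0]) (auto simp: f0)
  qed
  from someI_ex[OF this] show "lipschitz i \<ge> 0" "x \<in> space M \<Longrightarrow> y \<in> space M \<Longrightarrow> \<bar>f i x - f i y\<bar> \<le> lipschitz i * d x y"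
    unfolding lipschitz_def by blast+
qed

definition mass :: "nat \<Rightarrow> real" where "mass i = \<bar>l i\<bar> * (\<integral>z. \<bar>f i z\<bar> \<partial>M)"

lemma mass_nonneg: "mass i \<ge> 0"
  unfolding mass_def by (intro mult_nonneg_nonneg Bochner_Integration.integral_nonneg) auto

lemma spectral_kernel_bounded_meas: "spectral_kernel x \<in> bounded_meas"
  unfolding spectral_kernel_def[abs_def] by (intro bounded_meas_sum bounded_meas_cmult fB)

lemma spectral_kernel_diff: "(\<integral>z. \<bar>spectral_kernel x z - spectral_kernel y z\<bar> \<partial>M) \<le> (\<Sum>i<t. mass i * \<bar>f i x - f i y\<bar>)"
proof -
  have int: "integrable M (\<lambda>z. \<bar>l i\<bar> * \<bar>f i x - f i y\<bar> * \<bar>f i z\<bar>)" for i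
    using bounded_meas_integrable[OF fB] by simp
  have "(\<integral>z. \<bar>spectral_kernel x z - spectral_kernel y z\<bar> \<partial>M) \<le> (\<integral>z. (\<Sum>i<t. \<bar>l i\<bar> * \<bar>f i x - f i y\<bar> * \<bar>f i z\<bar>) \<partial>M)"
  proof (rule integral_mono)
    show "integrable M (\<lambda>z. \<bar>spectral_kernel x z - spectral_kernel y z\<bar>)"
      using bounded_meas_integrable[OF bounded_meas_lin[OF spectral_kernel_bounded_meas spectral_kernel_bounded_meas, of x "-1" y]] by simp
    show "integrable M (\<lambda>z. \<Sum>i<t. \<bar>l i\<bar> * \<bar>f i x - f i y\<bar> * \<bar>f i z\<bar>)" by (intro Bochner_Integration.integrable_sum int)
    fix z
    have "spectral_kernel x z - spectral_kernel y z = (\<Sum>i<t. l i * (f i x - f i y) * f i z)"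
      by (simp add: spectral_kernel_def sum_subtractf[symmetric] algebra_simps)
    then show "\<bar>spectral_kernel x z - spectral_kernel y z\<bar> \<le> (\<Sum>i<t. \<bar>l i\<bar> * \<bar>f i x - f i y\<bar> * \<bar>f i z\<bar>)"
      using sum_abs[of "\<lambda>i. l i * (f i x - f i y) * f i z" "{..<t}"] by (simp add: abs_mult)
  qed
  also have "\<dots> = (\<Sum>i<t. mass i * \<bar>f i x - f i y\<bar>)"
    using int by (simp add: mass_def mult_ac)
  finally show ?thesis .
qed

lemma positive_meets_AE:
  assumes "AE x in M. P x" "openin metric.mtopology U" "x \<in> U"
  shows "\<exists>y\<in>U. P y"
proof (rule ccontr)
  assume no: "\<not> ?thesis"
  obtain N where N: "{x \<in> space M. \<not> P x} \<subseteq> N" "N \<in> null_sets M"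
    using assms(1) by (auto elim: AE_E simp: null_sets_def)
  have "U \<subseteq> space M" using openin_subset[OF assms(2)] by simp
  then have "U \<subseteq> N" using no N(1) by auto
  then have "emeasure M U \<le> emeasure M N" using N(2) by (intro emeasure_mono) auto
  then show False using open_positive[OF assms(2,3)] N(2) by auto
qed

text \<open>Points with a good section meet every ball around \<open>x\<close>, because balls have
  positive measure. Both kernels have sections that are Lipschitz in L^1 along the distance, so the
  section at \<open>x\<close> is a limit of good ones.\<close>

lemma W_eq_spectral_kernel: assumes x: "x \<in> space M" shows "AE y in M. W x y = spectral_kernel x y"
proof -
  define \<delta> where "\<delta> = (\<integral>y. \<bar>W x y - spectral_kernel x y\<bar> \<partial>M)"
  have B1: "(\<lambda>y. W x y - spectral_kernel x y) \<in> bounded_meas" using bounded_meas_lin[OF W_bounded_meas[OF x] spectral_kernel_bounded_meas, of "-1" x] by simp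
  \<comment> \<open>The summand 1 accounts for the sections of \<open>W\<close>, whose L^1 distance
    is the metric itself; the sum accounts for those of the finite-rank kernel.\<close>
  define L where "L = 1 + (\<Sum>i<t. mass i * lipschitz i)"
  have L: "L > 0" unfolding L_def by (intro add_pos_nonneg sum_nonneg mult_nonneg_nonneg mass_nonneg lipschitz) auto
  have "\<delta> \<le> L * e" if e: "e > 0" for e
  proof -
    have "openin metric.mtopology (metric.mball x e)" by simp
    moreover have "x \<in> metric.mball x e" using x e by simp
    ultimately obtain x' where x': "x' \<in> metric.mball x e" "AE y in M. W x' y = spectral_kernel x' y"
      using positive_meets_AE[OF W_AE[folded spectral_kernel_def]] by blast
    have x'M: "x' \<in> space M" and dx: "d x x' < e" using x' by auto
    have B2: "(\<lambda>y. W x y - W x' y) \<in> bounded_meas" by (rule d_integrable[OF x x'M])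
    have B3: "(\<lambda>y. spectral_kernel x y - spectral_kernel x' y) \<in> bounded_meas" using bounded_meas_lin[OF spectral_kernel_bounded_meas spectral_kernel_bounded_meas, of x "-1" x'] by simp
    have "\<delta> \<le> (\<integral>y. \<bar>W x y - W x' y\<bar> + \<bar>spectral_kernel x y - spectral_kernel x' y\<bar> \<partial>M)"
      unfolding \<delta>_def
    proof (rule integral_mono_AE)
      show "AE y in M. \<bar>W x y - spectral_kernel x y\<bar> \<le> \<bar>W x y - W x' y\<bar> + \<bar>spectral_kernel x y - spectral_kernel x' y\<bar>"
        using x'(2) by eventually_elim linarith
    qed (use bounded_meas_integrable[OF B1] bounded_meas_integrable[OF B2] bounded_meas_integrable[OF B3] in auto)
    also have "\<dots> = d x x' + (\<integral>y. \<bar>spectral_kernel x y - spectral_kernel x' y\<bar> \<partial>M)"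
      using bounded_meas_integrable[OF B2] bounded_meas_integrable[OF B3] by (simp add: nbhd_dist_def)
    also have "\<dots> \<le> d x x' + (\<Sum>i<t. mass i * (lipschitz i * d x x'))"
      using spectral_kernel_diff[of x x'] lipschitz(2)[OF x x'M] mass_nonneg
      by (intro add_left_mono order_trans[OF spectral_kernel_diff] sum_mono mult_left_mono)
    also have "\<dots> = L * d x x'" by (simp add: L_def distrib_right sum_distrib_right mult.assoc)
    also have "\<dots> \<le> L * e" using L dx by simp
    finally show ?thesis .
  qed
  note bnd = this
  have "\<delta> \<le> 0"
  proof (rule ccontr)
    assume "\<not> \<delta> \<le> 0"
    then have pos: "\<delta> > 0" by simp
    have "\<delta> \<le> L * (\<delta> / (2 * L))" using pos L by (intro bnd) simp
    then show False using pos L by simp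
  qed
  moreover have "\<delta> \<ge> 0" unfolding \<delta>_def by (rule Bochner_Integration.integral_nonneg) simp
  ultimately have "\<delta> = 0" by linarith
  then have "(\<integral>y. \<bar>W x y - spectral_kernel x y\<bar> \<partial>M) = 0" unfolding \<delta>_def .
  then have "AE y in M. \<bar>W x y - spectral_kernel x y\<bar> = 0"
    using bounded_meas_integrable[OF B1] by (subst integral_nonneg_eq_0_iff_AE[symmetric]) auto
  then show ?thesis by eventually_elim simp
qed

text \<open>With \<open>lipschitz\<close>, this makes the metric and the coordinates equivalent:
  injectivity and, by completeness, closedness of the image follow.\<close>

lemma d_le:
  assumes "x \<in> space M" "y \<in> space M" shows "d x y \<le> (\<Sum>i<t. mass i * \<bar>f i x - f i y\<bar>)"
proof -
  have "d x y = (\<integral>z. \<bar>spectral_kernel x z - spectral_kernel y z\<bar> \<partial>M)"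
    unfolding nbhd_dist_def
  proof (rule integral_cong_AE)
    show "(\<lambda>z. \<bar>W x z - W y z\<bar>) \<in> borel_measurable M" using bounded_meas_integrable[OF d_integrable[OF assms]] by simp
    show "(\<lambda>z. \<bar>spectral_kernel x z - spectral_kernel y z\<bar>) \<in> borel_measurable M"
      using bounded_meas_integrable[OF bounded_meas_lin[OF spectral_kernel_bounded_meas spectral_kernel_bounded_meas, of x "-1" y]] by simp
    show "AE z in M. \<bar>W x z - W y z\<bar> = \<bar>spectral_kernel x z - spectral_kernel y z\<bar>"
      using W_eq_spectral_kernel[OF assms(1)] W_eq_spectral_kernel[OF assms(2)] by eventually_elim simp
  qed
  then show ?thesis using spectral_kernel_diff by simp
qed

lemma inj_f: "inj_on (\<lambda>x i. f i x) (space M)"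
proof (rule inj_onI)
  fix x y assume xy: "x \<in> space M" "y \<in> space M" "(\<lambda>i. f i x) = (\<lambda>i. f i y)"
  then have "f i x = f i y" for i by metis
  then have "d x y \<le> 0" using d_le[OF xy(1,2)] by simp
  then show "x = y" using metric.zero[OF xy(1,2)] metric.nonneg[of x y] by simp
qed

text \<open>The image lies in a Tychonoff cube, so only closedness is at issue: if the coordinates
  of a sequence converge, the sequence is Cauchy in the metric and converges by
  completeness.\<close>

lemma compact_f: "compact ((\<lambda>x i. f i x) ` space M)"
proof -
  let ?X = "(\<lambda>x i. f i x) ` space M"
  have "\<forall>i. \<exists>C. \<forall>x\<in>space M. \<bar>f i x\<bar> \<le> C" using fB by (auto simp: bounded_meas_def)
  then obtain C where C: "\<And>i x. x \<in> space M \<Longrightarrow> \<bar>f i x\<bar> \<le> C i" by metis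
  have "compact (PiE UNIV (\<lambda>i. {- C i..C i}))"
    using compactin_PiE[of "\<lambda>_. euclidean" UNIV "\<lambda>i. {- C i..C i}"]
    by (simp add: euclidean_product_topology)
  moreover have "?X \<subseteq> PiE UNIV (\<lambda>i. {- C i..C i})"
    using C by (auto simp: PiE_def Pi_def abs_le_iff minus_le_iff)
  moreover have "closed ?X"
    unfolding closed_sequential_limits
  proof (intro allI impI, elim conjE)
    fix s \<xi> assume s: "\<forall>n. s n \<in> ?X" and lim: "s \<longlonglongrightarrow> \<xi>"
    then have "\<forall>n. \<exists>x. x \<in> space M \<and> s n = (\<lambda>i. f i x)" by auto
    then obtain x where x: "\<And>n. x n \<in> space M" "\<And>n. s n = (\<lambda>i. f i (x n))" by metis
    have fl: "(\<lambda>n. f i (x n)) \<longlonglongrightarrow> \<xi> i" for i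
    proof -
      have "(\<lambda>n. s n i) \<longlonglongrightarrow> \<xi> i"
        using continuous_on_tendsto_compose[OF continuous_on_product_coordinates[of i] lim] by simp
      then show ?thesis by (simp add: x)
    qed
    have "metric.MCauchy x"
      unfolding metric.MCauchy_def
    proof (intro conjI allI impI)
      show "range x \<subseteq> space M" using x by auto
      fix e :: real assume e: "e > 0"
      define L where "L = 1 + (\<Sum>i<t. mass i)"
      have L: "L > 0" unfolding L_def by (intro add_pos_nonneg sum_nonneg mass_nonneg) auto
      have "Cauchy (\<lambda>n. f i (x n))" for i using fl by (intro LIMSEQ_imp_Cauchy)
      then have "\<forall>i. \<exists>N. \<forall>m\<ge>N. \<forall>n\<ge>N. \<bar>f i (x m) - f i (x n)\<bar> < e / L"
        using e L by (simp add: Cauchy_def dist_real_def)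
      then obtain N where N: "\<And>i m n. m \<ge> N i \<Longrightarrow> n \<ge> N i \<Longrightarrow> \<bar>f i (x m) - f i (x n)\<bar> < e / L" by metis
      show "\<exists>N. \<forall>n n'. N \<le> n \<longrightarrow> N \<le> n' \<longrightarrow> d (x n) (x n') < e"
      \<comment> \<open>The sum of the thresholds serves as their common upper bound.\<close>
      proof (intro exI[of _ "\<Sum>i<t. N i"] allI impI)
        fix m n assume mn: "(\<Sum>i<t. N i) \<le> m" "(\<Sum>i<t. N i) \<le> n"
        have "d (x m) (x n) \<le> (\<Sum>i<t. mass i * \<bar>f i (x m) - f i (x n)\<bar>)" by (rule d_le) (rule x)+
        also have "\<dots> \<le> (\<Sum>i<t. mass i * (e / L))"
        proof (intro sum_mono mult_left_mono mass_nonneg)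
          fix i assume "i \<in> {..<t}"
          then have "N i \<le> (\<Sum>i<t. N i)" by (intro member_le_sum) auto
          then show "\<bar>f i (x m) - f i (x n)\<bar> \<le> e / L" using N[of i m n] mn by (intro less_imp_le) linarith
        qed
        also have "\<dots> = (L - 1) * (e / L)" unfolding sum_distrib_right[symmetric] by (simp add: L_def)
        also have "\<dots> < e" using e L by (simp add: field_simps)
        finally show "d (x m) (x n) < e" .
      qed
    qed
    then obtain y where y: "limitin metric.mtopology x y sequentially"
      using pure unfolding pure_graphon_def metric.mcomplete_def by blast
    then have yM: "y \<in> space M" by (simp add: metric.limitin_metric)
    have "f i y = \<xi> i" for i
    proof -
      have "(\<lambda>n. f i (x n)) \<longlonglongrightarrow> f i y"
      proof (rule metric_LIMSEQ_I)
        fix e :: real assume e: "e > 0"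
        define e' where "e' = e / (lipschitz i + 1)"
        have e': "e' > 0" using e lipschitz(1)[of i] by (simp add: e'_def)
        from y e' obtain n0 where n0: "\<And>n. n \<ge> n0 \<Longrightarrow> d (x n) y < e'"
          unfolding metric.limitin_metric eventually_sequentially by blast
        have "dist (f i (x n)) (f i y) < e" if "n \<ge> n0" for n
        proof -
          have "dist (f i (x n)) (f i y) \<le> lipschitz i * d (x n) y" using lipschitz(2)[OF x(1) yM] by (simp add: dist_real_def)
          also have "\<dots> \<le> lipschitz i * e'" using n0[OF that] lipschitz(1) by (intro mult_left_mono) auto
          also have "\<dots> < (lipschitz i + 1) * e'" using e' by simp
          also have "\<dots> = e" using lipschitz(1)[of i] by (simp add: e'_def)
          finally show ?thesis .
        qed
        then show "\<exists>no. \<forall>n\<ge>no. dist (f i (x n)) (f i y) < e" by blast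
      qed
      then show ?thesis using fl LIMSEQ_unique by blast
    qed
    then have "\<xi> = (\<lambda>i. f i y)" by auto
    then show "\<xi> \<in> ?X" using yM by auto
  qed
  ultimately have "compact (PiE UNIV (\<lambda>i. {- C i..C i}) \<inter> ?X)" "PiE UNIV (\<lambda>i. {- C i..C i}) \<inter> ?X = ?X"
    by (auto intro: compact_Int_closed)
  then show ?thesis by (simp only:)
qed

text \<open>The coordinates are continuous for the metric, so the preimage of \<open>U\<close> is
  open, and nonempty open sets have positive measure.\<close>

lemma supp_f:
  assumes U: "open U" and x: "x \<in> space M" "(\<lambda>i. f i x) \<in> U"
  shows "measure M {y \<in> space M. (\<lambda>i. f i y) \<in> U} > 0"
proof -
  have coord: "continuous_map metric.mtopology euclidean (f i)" for i
    unfolding continuous_map_def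
  proof (intro conjI allI impI)
    fix V :: "real set" assume "openin euclidean V"
    then have V: "open V" by simp
    have "\<exists>r>0. metric.mball y r \<subseteq> {y \<in> space M. f i y \<in> V}" if y: "y \<in> space M" "f i y \<in> V" for y
    proof -
      obtain e where e: "e > 0" "\<And>s. dist s (f i y) < e \<Longrightarrow> s \<in> V" using V y(2) unfolding open_dist by blast
      define r where "r = e / (lipschitz i + 1)"
      have r: "r > 0" using e lipschitz(1)[of i] by (simp add: r_def)
      have "f i z \<in> V" if z: "z \<in> space M" "d y z < r" for z
      proof (rule e(2))
        have "dist (f i z) (f i y) \<le> lipschitz i * d y z" using lipschitz(2)[OF y(1) z(1), of i] by (simp add: dist_real_def abs_minus_commute)
        also have "\<dots> \<le> lipschitz i * r" using z lipschitz(1) by (intro mult_left_mono) auto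
        also have "\<dots> < (lipschitz i + 1) * r" using r by simp
        also have "\<dots> = e" using lipschitz(1)[of i] by (simp add: r_def)
        finally show "dist (f i z) (f i y) < e" .
      qed
      then show ?thesis using r by (intro exI[of _ r]) auto
    qed
    then show "openin metric.mtopology {y \<in> topspace metric.mtopology. f i y \<in> V}"
      unfolding metric.openin_mtopology by auto
  qed auto
  have "continuous_map metric.mtopology (product_topology (\<lambda>_. euclidean) UNIV) (\<lambda>x i. f i x)"
    using coord by (simp add: continuous_map_componentwise_UNIV)
  then have "continuous_map metric.mtopology euclidean (\<lambda>x i. f i x)"
    by (simp add: euclidean_product_topology)
  then have "openin metric.mtopology {y \<in> topspace metric.mtopology. (\<lambda>i. f i y) \<in> U}"
    using U by (intro openin_continuous_map_preimage) auto
  then have "emeasure M {y \<in> space M. (\<lambda>i. f i y) \<in> U} > 0"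
    using open_positive[of "{y \<in> space M. (\<lambda>i. f i y) \<in> U}" x] x by simp
  then show ?thesis by (simp add: emeasure_eq_measure)
qed

end

sublocale decomposed_graphon \<subseteq> ker: standard_kernel M t f l
proof
  show "f i \<in> borel_measurable M" for i using fB by (simp add: bounded_meas_def)
  show "t \<le> i \<Longrightarrow> f i x = 0" for i x by (rule f0)
  show "\<exists>C. \<forall>i. \<forall>x\<in>space M. \<bar>f i x\<bar> \<le> C"
  proof -
    have "\<forall>i. \<exists>C. \<forall>x\<in>space M. \<bar>f i x\<bar> \<le> C" using fB by (auto simp: bounded_meas_def)
    then obtain C where C: "\<And>i x. x \<in> space M \<Longrightarrow> \<bar>f i x\<bar> \<le> C i" by metis
    have "\<bar>f i x\<bar> \<le> (\<Sum>i<t. \<bar>C i\<bar>)" if x: "x \<in> space M" for i x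
    proof (cases "i < t")
      case True
      then have "\<bar>C i\<bar> \<le> (\<Sum>i<t. \<bar>C i\<bar>)" by (intro member_le_sum) auto
      then show ?thesis using C[OF x, of i] by linarith
    qed (simp add: f0 sum_nonneg)
    then show ?thesis by blast
  qed
  show "i < t \<Longrightarrow> j < t \<Longrightarrow> (\<integral>x. f i x * f j x \<partial>M) = (if i = j then 1 else 0)" for i j by (rule f_on)
  show "i < t \<Longrightarrow> l i \<noteq> 0" for i by (rule l0)
  show "compact ((\<lambda>x i. f i x) ` space M)" by (rule compact_f)
  show "inj_on (\<lambda>x i. f i x) (space M)" by (rule inj_f)
  show "open U \<Longrightarrow> x \<in> space M \<Longrightarrow> (\<lambda>i. f i x) \<in> U \<Longrightarrow> 0 < measure M {y \<in> space M. (\<lambda>i. f i y) \<in> U}" for U x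
    by (rule supp_f)
  show "\<exists>B\<in>sets borel. {x \<in> space M. X x \<in> B} \<subseteq> A \<and> emeasure M {x \<in> space M. X x \<in> B} = emeasure M A"
    if "X \<in> borel_measurable M" "inj_on X (space M)" "A \<in> sets M" for X :: "'a \<Rightarrow> nat \<Rightarrow> real" and A
    by (rule standard_injective_inner[OF standard that])
  show "A \<in> sets M" if "A \<subseteq> B" "B \<in> null_sets M" for A B using complete that by blast
qed

section \<open>Transfer from the pointwise kernel to the graphon\<close>

context decomposed_graphon
begin

lemma W_eq_w: "x \<in> space M \<Longrightarrow> AE y in M. W x y = ker.w x y"
  using W_eq_spectral_kernel by (simp add: spectral_kernel_def ker.w_def)

text \<open>Agreement of all sections gives agreement on the product only for functions measurable
  there, which \<open>W\<close> need not be; the comparison passes through a measurable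
  version.\<close>

lemma W_eq_w_pair: "AE z in M \<Otimes>\<^sub>M M. W (fst z) (snd z) = ker.w (fst z) (snd z)"
proof -
  obtain W' where W': "(\<lambda>(x, y). W' x y) \<in> borel_measurable (M \<Otimes>\<^sub>M M)"
    "AE z in M \<Otimes>\<^sub>M M. W (fst z) (snd z) = W' (fst z) (snd z)"
    "AE x in M. AE y in M. W x y = W' x y" using W_version by blast
  have [measurable]: "(\<lambda>z. W' (fst z) (snd z)) \<in> borel_measurable (M \<Otimes>\<^sub>M M)"
    using W'(1) by (simp add: case_prod_beta')
  have [measurable]: "(\<lambda>z. ker.w (fst z) (snd z)) \<in> borel_measurable (M \<Otimes>\<^sub>M M)"
    unfolding ker.w_def by measurable
  have "AE x in M. AE y in M. W' x y = ker.w x y"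
    using W'(3) AE_space
  proof eventually_elim
    case (elim x)
    from elim(1) W_eq_w[OF elim(2)] show ?case by eventually_elim simp
  qed
  then have "AE z in M \<Otimes>\<^sub>M M. W' (fst z) (snd z) = ker.w (fst z) (snd z)"
    by (intro MM.AE_pair_measure) auto
  with W'(2) show ?thesis by eventually_elim simp
qed

lemma distr_PiM_pair:
  assumes "finite J" "p \<in> J" "q \<in> J" "p \<noteq> q"
  shows "distr (Pi\<^sub>M J (\<lambda>_. M)) (M \<Otimes>\<^sub>M M) (\<lambda>\<zeta>. (\<zeta> p, \<zeta> q)) = M \<Otimes>\<^sub>M M"
proof (rule pair_measure_eqI[symmetric])
  interpret PS: product_sigma_finite "\<lambda>_. M" by standard
  have [measurable]: "(\<lambda>\<zeta>. \<zeta> p) \<in> measurable (Pi\<^sub>M J (\<lambda>_. M)) M" "(\<lambda>\<zeta>. \<zeta> q) \<in> measurable (Pi\<^sub>M J (\<lambda>_. M)) M"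
    using assms by auto
  fix A B assume AB: "A \<in> sets M" "B \<in> sets M"
  define X where "X = (\<lambda>i. if i = p then A else if i = q then B else space M)"
  have "emeasure (distr (Pi\<^sub>M J (\<lambda>_. M)) (M \<Otimes>\<^sub>M M) (\<lambda>\<zeta>. (\<zeta> p, \<zeta> q))) (A \<times> B) =
    emeasure (Pi\<^sub>M J (\<lambda>_. M)) ((\<lambda>\<zeta>. (\<zeta> p, \<zeta> q)) -` (A \<times> B) \<inter> space (Pi\<^sub>M J (\<lambda>_. M)))"
    using AB by (intro emeasure_distr) auto
  also have "(\<lambda>\<zeta>. (\<zeta> p, \<zeta> q)) -` (A \<times> B) \<inter> space (Pi\<^sub>M J (\<lambda>_. M)) = PiE J X"
    using assms AB[THEN sets.sets_into_space] by (auto simp: X_def space_PiM PiE_def Pi_def split: if_splits)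
  also have "emeasure (Pi\<^sub>M J (\<lambda>_. M)) (PiE J X) = (\<Prod>i\<in>J. emeasure M (X i))"
    using AB assms by (intro PS.emeasure_PiM) (auto simp: X_def)
  also have "\<dots> = emeasure M (X p) * (emeasure M (X q) * (\<Prod>i\<in>J - {p} - {q}. emeasure M (X i)))"
    using assms by (simp add: prod.remove[of J p] prod.remove[of "J - {p}" q])
  also have "\<dots> = emeasure M A * emeasure M B"
    using assms by (simp add: X_def emeasure_space_1)
  finally show "emeasure M A * emeasure M B = emeasure (distr (Pi\<^sub>M J (\<lambda>_. M)) (M \<Otimes>\<^sub>M M) (\<lambda>\<zeta>. (\<zeta> p, \<zeta> q))) (A \<times> B)" by simp
qed (auto intro: sigma_finite_measure_axioms)

text \<open>Edge by edge, \<open>W\<close> may be replaced by \<open>w\<close> almost everywhere. An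
  edge at the labeled node uses the section at the given \<open>x\<close>, which is why agreement
  was needed for every \<open>x\<close>; an edge between unlabeled nodes uses agreement on the
  product.\<close>

lemma hom_dens1_eq:
  assumes G: "one_labeled_graph V E" and js: "distinct js" "set js = V - {1}" and x: "x \<in> space M"
  shows "hom_dens1 M W V E x = ker.integrals_at js (ker.edge_prod E) (\<lambda>_. x)"
proof -
  define N where "N = V - {1}"
  have fin: "finite N" "finite V" "finite E"
  proof -
    show "finite V" "finite N" using G by (auto simp: one_labeled_graph_def N_def)
    have "E \<subseteq> Pow V" using G by (auto simp: one_labeled_graph_def)
    then show "finite E" using \<open>finite V\<close> finite_subset by blast
  qed
  let ?P = "Pi\<^sub>M N (\<lambda>_. M)"
  define ov where "ov = (\<lambda>(\<zeta> :: nat \<Rightarrow> 'a) i. if i \<in> N then \<zeta> i else x)"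
  have upd: "(\<zeta>(1 := x)) i = ov \<zeta> i" if "i \<in> V" for \<zeta> i
    using that by (auto simp: ov_def N_def fun_upd_apply)
  have edge: "AE \<zeta> in ?P. W ((\<zeta>(1 := x)) (Min e)) ((\<zeta>(1 := x)) (Max e)) = ker.edge_val (ov \<zeta>) e" if e: "e \<in> E" for e
  proof -
    have e2: "card e = 2" "e \<subseteq> V" using G e by (auto simp: one_labeled_graph_def)
    then obtain a b where ab: "e = {a, b}" "a \<noteq> b" by (meson card_2_iff)
    define p q where "p = Min e" and "q = Max e"
    have pq: "p \<noteq> q" "p \<in> V" "q \<in> V" using ab e2 by (auto simp: p_def q_def min_def max_def)
    have goal: "AE \<zeta> in ?P. W (ov \<zeta> p) (ov \<zeta> q) = ker.w (ov \<zeta> p) (ov \<zeta> q)"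
    proof -
      consider "p = 1" "q \<in> N" | "q = 1" "p \<in> N" | "p \<in> N" "q \<in> N" using pq by (auto simp: N_def)
      then show ?thesis
      proof cases
        case 1
        have "AE \<zeta> in ?P. W x (\<zeta> q) = ker.w x (\<zeta> q)"
          using AE_PiM_component[OF _ 1(2) W_eq_w[OF x]] prob_space_axioms by blast
        then show ?thesis using 1 by (simp add: ov_def N_def)
      next
        case 2
        have "AE y in M. W y x = ker.w y x"
          using W_eq_w[OF x] AE_space by eventually_elim (simp add: W_sym[OF _ x] ker.w_sym[of _ x])
        then have "AE \<zeta> in ?P. W (\<zeta> p) x = ker.w (\<zeta> p) x"
          using AE_PiM_component[OF _ 2(2), of "\<lambda>_. M" "\<lambda>y. W y x = ker.w y x"] prob_space_axioms by blast
        then show ?thesis using 2 by (simp add: ov_def N_def)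
      next
        case 3
        have m: "(\<lambda>\<zeta>. (\<zeta> p, \<zeta> q)) \<in> measurable ?P (M \<Otimes>\<^sub>M M)" using 3 by measurable
        have "AE z in distr ?P (M \<Otimes>\<^sub>M M) (\<lambda>\<zeta>. (\<zeta> p, \<zeta> q)). W (fst z) (snd z) = ker.w (fst z) (snd z)"
          unfolding distr_PiM_pair[OF fin(1) 3 pq(1)] by (rule W_eq_w_pair)
        from AE_distrD[OF m this] show ?thesis using 3 by (simp add: ov_def)
      qed
    qed
    then show ?thesis unfolding ker.edge_val_def p_def[symmetric] q_def[symmetric] upd[OF pq(2)] upd[OF pq(3)] .
  qed
  have "AE \<zeta> in ?P. \<forall>e\<in>E. W ((\<zeta>(1 := x)) (Min e)) ((\<zeta>(1 := x)) (Max e)) = ker.edge_val (ov \<zeta>) e"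
    using edge by (simp add: AE_finite_all[OF fin(3)])
  then have "AE \<zeta> in ?P. ker.edge_prod E (ov \<zeta>) = (\<Prod>e\<in>E. W ((\<zeta>(1 := x)) (Min e)) ((\<zeta>(1 := x)) (Max e)))"
    by eventually_elim (simp add: ker.edge_prod_def)
  \<comment> \<open>The integrand with \<open>W\<close> is measurable for the completed product
    because it equals a measurable function off a null set.\<close>
  then have ae: "AE \<zeta> in completion ?P. ker.edge_prod E (ov \<zeta>) = (\<Prod>e\<in>E. W ((\<zeta>(1 := x)) (Min e)) ((\<zeta>(1 := x)) (Max e)))"
    by (rule AE_completion)
  have m: "(\<lambda>\<zeta>. ker.edge_prod E (ov \<zeta>)) \<in> borel_measurable ?P"
    using ker.point_poly_override_measurable[OF ker.point_poly_edge_prod fin(1), of E "\<lambda>_. x"] by (simp add: ov_def)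
  interpret P: prob_space ?P by (intro prob_space_PiM prob_space_axioms)
  interpret C: complete_prob_space "completion ?P"
    by (intro complete_prob_space.intro complete_prob_space_axioms.intro P.prob_space_completion)
      (metis null_sets_completion_subset null_setsD2)
  have mc: "(\<lambda>\<zeta>. ker.edge_prod E (ov \<zeta>)) \<in> borel_measurable (completion ?P)" using m by (rule measurable_completion)
  have "hom_dens1 M W V E x = (\<integral>\<zeta>. ker.edge_prod E (ov \<zeta>) \<partial>completion ?P)"
    unfolding hom_dens1_def N_def[symmetric]
  proof (rule integral_cong_AE[symmetric])
    show "(\<lambda>\<zeta>. \<Prod>e\<in>E. W ((\<zeta>(1 := x)) (Min e)) ((\<zeta>(1 := x)) (Max e))) \<in> borel_measurable (completion ?P)"
      by (rule C.AE_eq_measurable[OF mc ae])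
  qed (rule mc ae)+
  also have "\<dots> = (\<integral>\<zeta>. ker.edge_prod E (ov \<zeta>) \<partial>?P)" by (rule integral_completion[OF m])
  also have "\<dots> = ker.integrals_at js (ker.edge_prod E) (\<lambda>_. x)"
    unfolding ker.integrals_at_PiM[OF ker.point_poly_edge_prod js(1)] js(2) N_def[symmetric] ov_def ..
  finally show ?thesis .
qed

text \<open>S is generated by all eigenfunctions, not only by the chosen \<open>f i\<close>.
  Inserting the finite expansion into the eigenvalue equation of any eigenfunction shows that it is
  a combination of the \<open>f i\<close> at every point.\<close>

lemma eigenfunction_algebra_eq: "eigenfunction_algebra M W = {restrict p (space M) | p. p \<in> ker.kernel_poly}"
proof (intro equalityI subsetI)
  fix g assume "g \<in> eigenfunction_algebra M W"
  then show "g \<in> {restrict p (space M) | p. p \<in> ker.kernel_poly}"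
    unfolding eigenfunction_algebra_def
  proof induction
    case (gen \<phi>)
    then obtain a where sq: "square_integrable M \<phi>" and a: "a \<noteq> 0" "\<And>x. x \<in> space M \<Longrightarrow> a * \<phi> x = kernel_op M W \<phi> x"
      by (auto simp: eigenfunctions_def)
    have \<phi>m: "\<phi> \<in> borel_measurable M" using sq by (simp add: square_integrable_def)
    have \<phi>i: "integrable M \<phi>" using sq square_integrable_imp_integrable by blast
    have fi: "integrable M (\<lambda>y. f i y * \<phi> y)" for i
    proof -
      obtain C where C: "\<And>x. x \<in> space M \<Longrightarrow> \<bar>f i x\<bar> \<le> C" using fB[of i] by (auto simp: bounded_meas_def)
      have fm: "f i \<in> borel_measurable M" using fB by (simp add: bounded_meas_def)
      show ?thesis
      proof (rule Bochner_Integration.integrable_bound)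
        show "integrable M (\<lambda>y. C * \<phi> y)" using \<phi>i by simp
        show "AE y in M. norm (f i y * \<phi> y) \<le> norm (C * \<phi> y)"
          using AE_space
        proof eventually_elim
          case (elim y)
          have "\<bar>f i y\<bar> \<le> \<bar>C\<bar>" using C[OF elim] by linarith
          then show ?case by (simp add: abs_mult mult_right_mono)
        qed
      qed (use fm \<phi>m in measurable)
    qed
    define p where "p = (\<lambda>x. \<Sum>i<t. (l i * (\<integral>y. f i y * \<phi> y \<partial>M) / a) * f i x)"
    have "p \<in> ker.kernel_poly" unfolding p_def by (intro ker.kernel_poly_sum ker.kernel_poly_cmult ker.kernel_poly_f)
    moreover have "\<phi> x = p x" if x: "x \<in> space M" for x
    proof -
      have "kernel_op M W \<phi> x = (\<integral>y. (\<Sum>i<t. l i * f i x * (f i y * \<phi> y)) \<partial>M)"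
        unfolding kernel_op_def
      proof (rule integral_cong_AE)
        show "(\<lambda>y. W x y * \<phi> y) \<in> borel_measurable M" using W_section[OF x] \<phi>m by measurable
        show "(\<lambda>y. \<Sum>i<t. l i * f i x * (f i y * \<phi> y)) \<in> borel_measurable M"
          by (intro borel_measurable_sum borel_measurable_times borel_measurable_const borel_measurable_integrable fi)
        show "AE y in M. W x y * \<phi> y = (\<Sum>i<t. l i * f i x * (f i y * \<phi> y))"
          using W_eq_spectral_kernel[OF x] by eventually_elim (simp add: spectral_kernel_def sum_distrib_right mult.assoc)
      qed
      also have "\<dots> = (\<Sum>i<t. l i * f i x * (\<integral>y. f i y * \<phi> y \<partial>M))" using fi by simp
      finally have "a * \<phi> x = (\<Sum>i<t. l i * f i x * (\<integral>y. f i y * \<phi> y \<partial>M))" using a(2)[OF x] by simp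
      moreover have "a * p x = (\<Sum>i<t. l i * f i x * (\<integral>y. f i y * \<phi> y \<partial>M))"
        using a(1) by (simp add: p_def sum_distrib_left mult_ac)
      ultimately have "a * \<phi> x = a * p x" by (simp only:)
      then show ?thesis using a(1) by simp
    qed
    then have "restrict \<phi> (space M) = restrict p (space M)" by (intro restrict_ext)
    ultimately show ?case by blast
  next
    case (const c)
    then show ?case using ker.kernel_poly_const[of c] by (auto intro!: exI[of _ "\<lambda>_. c"])
  next
    case (add g h)
    then obtain p q where "p \<in> ker.kernel_poly" "q \<in> ker.kernel_poly" "g = restrict p (space M)" "h = restrict q (space M)" by blast
    then show ?case using ker.kernel_poly_add[of p q]
      by (intro CollectI exI[of _ "\<lambda>x. p x + q x"]) (auto intro!: restrict_ext)
  next
    case (mult g h)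
    then obtain p q where "p \<in> ker.kernel_poly" "q \<in> ker.kernel_poly" "g = restrict p (space M)" "h = restrict q (space M)" by blast
    then show ?case using ker.kernel_poly_mult[of p q]
      by (intro CollectI exI[of _ "\<lambda>x. p x * q x"]) (auto intro!: restrict_ext)
  qed
next
  fix g assume "g \<in> {restrict p (space M) | p. p \<in> ker.kernel_poly}"
  then obtain p where p: "p \<in> ker.kernel_poly" "g = restrict p (space M)" by blast
  from p(1) have "restrict p (space M) \<in> generated_algebra (space M) (eigenfunctions M W)"
  proof (induction rule: ker.kernel_poly_induct)
    case (const c)
    show ?case by (rule generated_algebra.const)
  next
    case (f i)
    show ?case
    proof (cases "i < t")
      case True
      have "f i \<in> eigenfunctions M W"
        unfolding eigenfunctions_def
      proof (intro CollectI conjI)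
        show "square_integrable M (f i)"
          using bounded_meas_integrable[OF bounded_meas_mult[OF fB fB], of i i] fB by (simp add: square_integrable_def bounded_meas_def power2_eq_square)
        show "\<not> (AE x in M. f i x = 0)"
        proof
          assume "AE x in M. f i x = 0"
          then have "AE x in M. f i x * f i x = 0" by eventually_elim simp
          then have "(\<integral>x. f i x * f i x \<partial>M) = 0" by (rule integral_eq_zero_AE)
          then show False using f_on[OF True True] by simp
        qed
        show "\<exists>a. a \<noteq> 0 \<and> (\<forall>x\<in>space M. a * f i x = kernel_op M W (f i) x)"
          using l0[OF True] eigen[OF True] by (intro exI[of _ "l i"]) (simp add: T_def)
      qed
      then show ?thesis by (rule generated_algebra.gen)
    next
      case False
      then have "f i = (\<lambda>_. 0)" using f0 by auto
      then show ?thesis by (simp only: generated_algebra.const)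
    qed
  next
    case (add a b)
    have eq: "(\<lambda>x\<in>space M. restrict a (space M) x + restrict b (space M) x) = (\<lambda>x\<in>space M. a x + b x)"
      by (intro restrict_ext) simp
    from generated_algebra.add[OF add.IH] show ?case unfolding eq .
  next
    case (mult a b)
    have eq: "(\<lambda>x\<in>space M. restrict a (space M) x * restrict b (space M) x) = (\<lambda>x\<in>space M. a x * b x)"
      by (intro restrict_ext) simp
    from generated_algebra.mult[OF mult.IH] show ?case unfolding eq .
  qed
  then show "g \<in> eigenfunction_algebra M W" using p(2) by (simp add: eigenfunction_algebra_def)
qed

text \<open>The harder inclusion must remove the exceptional null sets. Composition with
  \<open>g\<close> acts on the eigenfunctions by a matrix, so for fixed \<open>x\<close> the defect
  of invariance is a member of S as a function of \<open>y\<close>, and one that vanishes almost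
  everywhere.\<close>

lemma kernel_aut_eq: "ker.kernel_aut = graphon_Aut M W"
proof (intro equalityI subsetI)
  fix g assume g: "g \<in> ker.kernel_aut"
  have gm: "g \<in> measurable M M" and gd: "distr M M g = M" and gw: "\<And>x y. x \<in> space M \<Longrightarrow> y \<in> space M \<Longrightarrow> ker.w (g x) (g y) = ker.w x y"
    using g by (auto simp: ker.kernel_aut_def)
  have "AE y in M. W (g x) (g y) = W x y" if x: "x \<in> space M" for x
  proof -
    have gx: "g x \<in> space M" using gm x by (rule measurable_space)
    have "AE z in distr M M g. W (g x) z = ker.w (g x) z" unfolding gd by (rule W_eq_w[OF gx])
    from AE_distrD[OF gm this] W_eq_w[OF x] AE_space show ?thesis
      by eventually_elim (simp add: gw[OF x])
  qed
  then show "g \<in> graphon_Aut M W" using g by (auto simp: graphon_Aut_def ker.kernel_aut_def)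
next
  fix g assume g: "g \<in> graphon_Aut M W"
  have gm: "g \<in> measurable M M" and gd: "distr M M g = M" and gW: "\<And>x. x \<in> space M \<Longrightarrow> AE y in M. W (g x) (g y) = W x y"
    using g by (auto simp: graphon_Aut_def)
  have gw: "AE y in M. ker.w (g x) (g y) = ker.w x y" if x: "x \<in> space M" for x
  proof -
    have gx: "g x \<in> space M" using gm x by (rule measurable_space)
    have "AE z in distr M M g. W (g x) z = ker.w (g x) z" unfolding gd by (rule W_eq_w[OF gx])
    from AE_distrD[OF gm this] W_eq_w[OF x] gW[OF x] show ?thesis by eventually_elim simp
  qed
  have gB: "(\<lambda>y. a (g y)) \<in> bounded_meas" if a: "a \<in> bounded_meas" for a
  proof -
    obtain C where "\<And>x. x \<in> space M \<Longrightarrow> \<bar>a x\<bar> \<le> C" using a by (auto simp: bounded_meas_def)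
    then have "\<forall>x\<in>space M. \<bar>a (g x)\<bar> \<le> C" using gm measurable_space by metis
    moreover have "(\<lambda>y. a (g y)) \<in> borel_measurable M" using measurable_compose[OF gm bounded_meas_meas[OF a]] .
    ultimately show ?thesis by (auto simp: bounded_meas_def)
  qed
  have gint: "(\<integral>y. a (g y) \<partial>M) = (\<integral>y. a y \<partial>M)" if "a \<in> bounded_meas" for a
  proof -
    have "(\<integral>y. a y \<partial>distr M M g) = (\<integral>y. a (g y) \<partial>M)"
      using gm that by (intro integral_distr) (auto simp: bounded_meas_def)
    then show ?thesis using gd by simp
  qed
  \<comment> \<open>The matrix is read off the eigenvalue equation at \<open>g x\<close>, after the
    substitution of \<open>g y\<close> for \<open>y\<close> and with invariance applied under the
    integral.\<close>
  define O' where "O' = (\<lambda>i k. l k * (\<integral>y. f k y * f i (g y) \<partial>M) / l i)"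
  have fg: "f i (g x) = (\<Sum>k<t. O' i k * f k x)" if x: "x \<in> space M" and i: "i < t" for x i
  proof -
    have "l i * f i (g x) = (\<integral>y. ker.w (g x) y * f i y \<partial>M)" by (rule ker.w_eigen[OF i, symmetric])
    also have "\<dots> = (\<integral>y. ker.w (g x) (g y) * f i (g y) \<partial>M)"
      by (rule gint[OF bounded_meas_mult[OF ker.w_bounded_meas(2) fB], symmetric])
    also have "\<dots> = (\<integral>y. ker.w x y * f i (g y) \<partial>M)"
    proof (rule integral_cong_AE)
      show "(\<lambda>y. ker.w (g x) (g y) * f i (g y)) \<in> borel_measurable M"
        by (rule bounded_meas_meas[OF bounded_meas_mult[OF gB[OF ker.w_bounded_meas(2)] gB[OF fB]]])
      show "(\<lambda>y. ker.w x y * f i (g y)) \<in> borel_measurable M"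
        by (rule bounded_meas_meas[OF bounded_meas_mult[OF ker.w_bounded_meas(2) gB[OF fB]]])
      show "AE y in M. ker.w (g x) (g y) * f i (g y) = ker.w x y * f i (g y)"
        using gw[OF x] by eventually_elim simp
    qed
    also have "\<dots> = (\<integral>y. (\<Sum>k<t. l k * f k x * (f k y * f i (g y))) \<partial>M)"
      by (simp add: ker.w_def sum_distrib_right mult.assoc)
    also have "\<dots> = (\<Sum>k<t. l k * f k x * (\<integral>y. f k y * f i (g y) \<partial>M))"
      by (simp add: bounded_meas_integrable bounded_meas_mult fB gB)
    also have "\<dots> = l i * (\<Sum>k<t. O' i k * f k x)"
      using l0[OF i] by (simp add: O'_def sum_distrib_left mult_ac)
    finally show ?thesis using l0[OF i] by simp
  qed
  have "ker.w (g x) (g y) = ker.w x y" if x: "x \<in> space M" and y: "y \<in> space M" for x y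
  proof -
    \<comment> \<open>The defect is written through the matrix rather than through \<open>g\<close>,
      which makes its membership in \<open>kernel_poly\<close> evident.\<close>
    define h where "h = (\<lambda>y. (\<Sum>i<t. (l i * f i (g x)) * (\<Sum>k<t. O' i k * f k y)) + (-1) * (\<Sum>i<t. (l i * f i x) * f i y))"
    have hS: "h \<in> ker.kernel_poly" unfolding h_def by (intro ker.kernel_poly_add ker.kernel_poly_cmult ker.kernel_poly_sum ker.kernel_poly_f)
    have hw: "h y = ker.w (g x) (g y) - ker.w x y" if "y \<in> space M" for y
      using that by (simp add: h_def ker.w_def fg)
    have "AE y in M. h y = 0" using gw[OF x] AE_space by eventually_elim (simp add: hw)
    then have "h y = 0" using ker.kernel_poly_zero_AE[OF hS _ y] by simp
    then show ?thesis using hw[OF y] by simp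
  qed
  then show "g \<in> ker.kernel_aut" using g by (auto simp: graphon_Aut_def ker.kernel_aut_def)
qed

lemma edge_prod_multi_dens: "one_labeled_graph V E \<Longrightarrow> ker.edge_prod E \<in> ker.multi_dens"
proof -
  assume G: "one_labeled_graph V E"
  then have "finite E" by (meson Pow_iff finite_Pow_iff finite_subset one_labeled_graph_def subsetI)
  moreover have "\<forall>e\<in>E. card e = 2" using G by (simp add: one_labeled_graph_def)
  ultimately have "(\<lambda>\<eta>. ker.edge_prod E \<eta>) \<in> ker.multi_dens"
  proof induction
    case empty
    show ?case by (simp add: ker.edge_prod_def ker.multi_dens.const)
  next
    case (insert e E)
    then obtain a b where ab: "e = {a, b}" "a \<noteq> b" by (meson card_2_iff insertI1)
    have "(\<lambda>\<eta>. ker.edge_val \<eta> e) \<in> ker.multi_dens" unfolding ab(1) ker.edge_val_pair[OF ab(2)] using ab(2) by (rule ker.multi_dens.edge)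
    then have "(\<lambda>\<eta>. ker.edge_val \<eta> e * ker.edge_prod E \<eta>) \<in> ker.multi_dens" using insert by (intro ker.multi_dens.mult) auto
    then show ?case using insert by (simp add: ker.edge_prod_def)
  qed
  then show ?thesis by simp
qed

lemma integrals_at_multi_dens: "P \<in> ker.multi_dens \<Longrightarrow> ker.integrals_at js P \<in> ker.multi_dens"
  by (induction js) (auto intro: ker.multi_dens.int)

lemma A1_eq: "A1 M W = invariants (space M) (graphon_Aut M W) (eigenfunction_algebra M W)"
proof (intro equalityI subsetI)
  fix a assume "a \<in> A1 M W"
  then obtain n c \<phi> where a: "a = (\<lambda>x\<in>space M. \<Sum>i<n::nat. c i * \<phi> i x)"
    and \<phi>: "\<And>i. i < n \<Longrightarrow> \<exists>V E. \<phi> i = hom_dens1 M W V E \<and> one_labeled_graph V E"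
    unfolding A1_def function_span_def by blast
  have "\<exists>P\<in>ker.multi_dens. \<forall>x\<in>space M. \<phi> i x = P (\<lambda>_. x)" if i: "i < n" for i
  proof -
    obtain V E where VE: "\<phi> i = hom_dens1 M W V E" "one_labeled_graph V E" using \<phi>[OF i] by blast
    define js where "js = sorted_list_of_set (V - {1})"
    have js: "distinct js" "set js = V - {1}" using VE(2) by (auto simp: js_def one_labeled_graph_def)
    show ?thesis
      by (rule bexI[of _ "ker.integrals_at js (ker.edge_prod E)"])
        (use VE hom_dens1_eq[OF VE(2) js] integrals_at_multi_dens edge_prod_multi_dens in auto)
  qed
  then have "\<forall>i. \<exists>P. i < n \<longrightarrow> P \<in> ker.multi_dens \<and> (\<forall>x\<in>space M. \<phi> i x = P (\<lambda>_. x))" by blast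
  then obtain P where P: "\<And>i. i < n \<Longrightarrow> P i \<in> ker.multi_dens" "\<And>i x. i < n \<Longrightarrow> x \<in> space M \<Longrightarrow> \<phi> i x = P i (\<lambda>_. x)" by metis
  define Q where "Q = (\<lambda>\<eta>. \<Sum>i<n. c i * P i \<eta>)"
  have Q: "Q \<in> ker.multi_dens" unfolding Q_def by (intro ker.multi_dens_sum ker.multi_dens_cmult P) auto
  have aQ: "a = restrict (\<lambda>x. Q (\<lambda>_. x)) (space M)" unfolding a Q_def by (intro restrict_ext sum.cong) (auto simp: P)
  have "a \<in> eigenfunction_algebra M W"
    unfolding eigenfunction_algebra_eq aQ using ker.point_poly_diag[OF ker.multi_dens_point_poly[OF Q]] by blast
  moreover have "a (g x) = a x" if g: "g \<in> graphon_Aut M W" and x: "x \<in> space M" for g x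
  proof -
    have gL: "g \<in> ker.kernel_aut" using g kernel_aut_eq by simp
    have gx: "g x \<in> space M" using g x by (auto simp: graphon_Aut_def dest: measurable_space)
    have "Q (g \<circ> (\<lambda>_. x)) = Q (\<lambda>_. x)" by (rule ker.multi_dens_invariant[OF Q gL]) (rule x)
    then show ?thesis using x gx by (simp add: aQ o_def)
  qed
  ultimately show "a \<in> invariants (space M) (graphon_Aut M W) (eigenfunction_algebra M W)"
    by (simp add: invariants_def)
next
  fix a assume "a \<in> invariants (space M) (graphon_Aut M W) (eigenfunction_algebra M W)"
  then obtain p where p: "p \<in> ker.kernel_poly" "a = restrict p (space M)"
    and inv: "\<And>g x. g \<in> graphon_Aut M W \<Longrightarrow> x \<in> space M \<Longrightarrow> a (g x) = a x"
    unfolding invariants_def eigenfunction_algebra_eq by blast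
  \<comment> \<open>Multigraph densities reach every invariant member of S; they are then rewritten
    through simple graphs, and these are compared with the densities of \<open>W\<close> on the
    space.\<close>
  have "\<exists>b\<in>ker.density_algebra. \<forall>x\<in>space M. p x = b x"
  proof (rule ker.invariant_in_density_algebra[OF _ p(1)])
    show "\<exists>g\<in>ker.kernel_aut. g x = y" if "x \<in> space M" "y \<in> space M" "\<forall>a\<in>ker.density_algebra. a x = a y" for x y
      using ker.orbit that by blast
    show "p (g x) = p x" if g: "g \<in> ker.kernel_aut" and x: "x \<in> space M" for g x
    proof -
      have "g x \<in> space M" using g x by (auto simp: ker.kernel_aut_def dest: measurable_space)
      then show ?thesis using inv[of g x] g x kernel_aut_eq p(2) by simp
    qed
  qed
  then obtain b where b: "b \<in> ker.density_algebra" "\<And>x. x \<in> space M \<Longrightarrow> p x = b x" by blast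
  obtain n c \<phi> where \<phi>: "\<And>i. i < n \<Longrightarrow> \<phi> i \<in> ker.one_label_dens" and bs: "\<And>x. b x = (\<Sum>i<n::nat. c i * \<phi> i x)"
    using ker.density_algebra_one_label_dens[OF b(1)] by blast
  have "\<forall>i. \<exists>\<psi>. i < n \<longrightarrow> \<psi> \<in> {hom_dens1 M W V E | V E. one_labeled_graph V E} \<and> (\<forall>x\<in>space M. \<phi> i x = \<psi> x)"
  proof
    fix i
    show "\<exists>\<psi>. i < n \<longrightarrow> \<psi> \<in> {hom_dens1 M W V E | V E. one_labeled_graph V E} \<and> (\<forall>x\<in>space M. \<phi> i x = \<psi> x)"
    proof (cases "i < n")
      case True
      then obtain js V E where "\<phi> i = (\<lambda>x. ker.integrals_at js (ker.edge_prod E) (\<lambda>_. x))" "one_labeled_graph V E" "distinct js" "set js = V - {1}"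
        using \<phi>[OF True] unfolding ker.one_label_dens_def by blast
      then show ?thesis using hom_dens1_eq by (intro exI[of _ "hom_dens1 M W V E"]) auto
    qed blast
  qed
  from choice[OF this] obtain \<psi> where
    "\<forall>i. i < n \<longrightarrow> \<psi> i \<in> {hom_dens1 M W V E | V E. one_labeled_graph V E} \<and> (\<forall>x\<in>space M. \<phi> i x = \<psi> i x)" by blast
  then have \<psi>: "\<And>i. i < n \<Longrightarrow> \<psi> i \<in> {hom_dens1 M W V E | V E. one_labeled_graph V E}"
    "\<And>i x. i < n \<Longrightarrow> x \<in> space M \<Longrightarrow> \<phi> i x = \<psi> i x" by blast+
  have "a = (\<lambda>x\<in>space M. \<Sum>i<n. c i * \<psi> i x)"
    unfolding p(2) by (intro restrict_ext) (simp add: b bs \<psi>)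
  then show "a \<in> A1 M W" unfolding A1_def function_span_def using \<psi>(1) by blast
qed

end

theorem theorem6p5:
  fixes M :: "'a measure" and W :: "'a \<Rightarrow> 'a \<Rightarrow> real"
  assumes "pure_graphon M W"
    and "finite_rank M W"
  shows "A1 M W = invariants (space M) (graphon_Aut M W) (eigenfunction_algebra M W)"
proof -
  interpret pure_finite_rank_graphon M W by (rule pure_finite_rank_graphon.intro) fact+
  obtain t f l where "spectral_data t f l" using spectral_decomposition[OF assms(2)] by blast
  then interpret decomposed_graphon M W t f l by unfold_locales
  show ?thesis by (rule A1_eq)
qed

end
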